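(* For every (nonempty) compact metric space $M$, every countable ordinal $\alpha$ and every $\varepsilon>0$, there exists a compact metric space $N$ with $\alpha_{cf}(N)\geq \alpha$ such that $N_{cf}^{\alpha}$ is $(1+\varepsilon)$-isometric to $M$, i.e. there is a $(1+\varepsilon)$-isometry from $M$ onto $N_{cf}^\alpha$.
   Context: A bijection $\varphi\colon (M,d)\to(N,\rho)$ between metric spaces is a $(1+\varepsilon)$-isometry if $(1-\varepsilon)d(x,y)\leq\rho(\varphi(x),\varphi(y))\leq(1+\varepsilon)d(x,y)$ for all $x,y\in M$. A curve-fragment in $M$ is a Lipschitz map $\varphi\colon K\to M$ with $K\subset\mathbb{R}$ compact. For a metric space $(M,d)$ the curve-flat pseudometric is $d_{cf}(x,y)=\inf \lambda([\min K,\max K]\setminus K)$, the infimum being over all $1$-Lipschitz curve-fragments $\varphi\colon K\to M$ with $\varphi(\min K)=x$, $\varphi(\max K)=y$, where $\lambda$ is Lebesgue measure. Identifying points at $d_{cf}$-distance $0$ gives the metric space $(M_{cf},d_{cf})$, the curve-flat quotient of $M$. By transfinite induction: $M^0_{cf}=M$, $d^0_{cf}=d$; $d_{cf}^{\alpha+1}=(d_{cf}^\alpha)_{cf}$ and $M_{cf}^{\alpha+1}=(M_{cf}^\alpha)_{cf}$; for limit $\alpha$, $d_{cf}^\alpha(x,y)=\inf_{\beta<\alpha}d_{cf}^\beta(x,y)$ and $M_{cf}^\alpha$ is the quotient of $M$ by $d_{cf}^\alpha$ with metric $d_{cf}^\alpha$ (each $d_{cf}^\alpha$ is regarded also as a pseudometric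 on $M$). A metric space is purely $1$-unrectifiable if it contains no bi-Lipschitz copy of a subset of $\mathbb{R}$ of positive Lebesgue measure. The curve-flat index $\alpha_{cf}(M)$ is the smallest ordinal $\alpha$ such that $M_{cf}^\alpha$ is purely $1$-unrectifiable (equivalently, the ordinal at which the sequence $(M_{cf}^\alpha)_\alpha$ stabilizes). *)

theory Defs
  imports "HOL-Analysis.Analysis" "HOL-Library.Extended" "HOL-Library.Countable_Set_Type"
begin

section \<open>Countable ordinals\<close>

text \<open>The type of all countable ordinals: the well-order of type \<open>\<omega>\<^sub>1\<close>, i.e. the successor
  cardinal of \<open>natLeq\<close>. The lemmas \<open>countable_below\<close>, \<open>uncountable_ordinals\<close> and
  \<open>countable_Well_order_represented\<close> below pin it down.\<close>

typedef countable_ordinal = "Field (cardSuc natLeq)"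
proof -
  have "infinite (Field (cardSuc natLeq))"
    using cardSuc_finite[OF natLeq_Card_order] by (simp add: Field_natLeq)
  then show ?thesis by (metis all_not_in_conv finite.emptyI)
qed

instantiation countable_ordinal :: wellorder
begin

definition less_eq_countable_ordinal :: "countable_ordinal \<Rightarrow> countable_ordinal \<Rightarrow> bool" where
  "x \<le> y \<longleftrightarrow> (Rep_countable_ordinal x, Rep_countable_ordinal y) \<in> cardSuc natLeq"

definition less_countable_ordinal :: "countable_ordinal \<Rightarrow> countable_ordinal \<Rightarrow> bool" where
  "x < y \<longleftrightarrow> x \<le> y \<and> \<not> y \<le> (x::countable_ordinal)"

instance
proof -
  let ?r = "cardSuc natLeq"
  have wo: "Well_order ?r"
    by (simp add: cardSuc_Card_order card_order_on_well_order_on natLeq_Card_order)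
  then interpret wo_rel ?r by (simp add: wo_rel_def)
  have F: "Rep_countable_ordinal x \<in> Field ?r" for x
    by (rule Rep_countable_ordinal)
  have le_refl: "x \<le> x" for x :: countable_ordinal
    using refl_onD[OF REFL F] by (simp add: less_eq_countable_ordinal_def)
  have le_trans: "x \<le> z" if "x \<le> y" "y \<le> z" for x y z :: countable_ordinal
    using transD[OF TRANS] that unfolding less_eq_countable_ordinal_def by blast
  have le_antisym: "x = y" if "x \<le> y" "y \<le> x" for x y :: countable_ordinal
    using antisymD[OF ANTISYM] that
    unfolding less_eq_countable_ordinal_def Rep_countable_ordinal_inject[symmetric] by blast
  have le_total: "x \<le> y \<or> y \<le> x" for x y :: countable_ordinal
    using TOTALS F unfolding less_eq_countable_ordinal_def by blast
  have wf_less: "wf {(x, y). x < (y::countable_ordinal)}"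
  proof (rule wf_subset)
    show "wf (inv_image (?r - Id) Rep_countable_ordinal)"
      by (rule wf_inv_image) (rule WF)
    show "{(x, y). x < (y::countable_ordinal)} \<subseteq> inv_image (?r - Id) Rep_countable_ordinal"
      using le_refl
      by (auto simp: less_countable_ordinal_def less_eq_countable_ordinal_def)
  qed
  show "OFCLASS(countable_ordinal, wellorder_class)"
  proof
    fix x y z :: countable_ordinal
    show "x < y \<longleftrightarrow> x \<le> y \<and> \<not> y \<le> x" by (rule less_countable_ordinal_def)
    show "x \<le> x" by (rule le_refl)
    show "x \<le> z" if "x \<le> y" "y \<le> z" using that by (rule le_trans)
    show "x = y" if "x \<le> y" "y \<le> x" using that by (rule le_antisym)
    show "x \<le> y \<or> y \<le> x" by (rule le_total)
  next
    fix P :: "countable_ordinal \<Rightarrow> bool" and a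
    assume step: "\<And>x. (\<And>y. y < x \<Longrightarrow> P y) \<Longrightarrow> P x"
    from wf_less show "P a"
      by (induction a rule: wf_induct_rule) (use step in simp)
  qed
qed

end

lemma countable_below:
  includes cardinal_syntax
  shows "countable {..<(\<alpha>::countable_ordinal)}"
proof -
  let ?r = "cardSuc natLeq" and ?a = "Rep_countable_ordinal \<alpha>"
  have "|underS ?r ?a| <o ?r"
    by (intro card_of_underS cardSuc_Card_order natLeq_Card_order Rep_countable_ordinal)
  then have "|underS ?r ?a| \<le>o natLeq"
    by (simp add: cardSuc_ordLeq_ordLess natLeq_Card_order card_of_Card_order)
  then have "countable (underS ?r ?a)"
    by (simp add: countable_card_le_natLeq)
  moreover have "Rep_countable_ordinal ` {..<\<alpha>} \<subseteq> underS ?r ?a"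
    by (auto simp: underS_def less_countable_ordinal_def less_eq_countable_ordinal_def)
  ultimately have "countable (Rep_countable_ordinal ` {..<\<alpha>})"
    by (rule countable_subset[rotated])
  then show ?thesis
    by (rule countable_image_inj_on) (simp add: inj_on_def Rep_countable_ordinal_inject)
qed

lemma uncountable_ordinals:
  includes cardinal_syntax
  shows "uncountable (UNIV :: countable_ordinal set)"
proof
  assume "countable (UNIV :: countable_ordinal set)"
  then have "countable (range Rep_countable_ordinal)"
    by simp
  then have "countable (Field (cardSuc natLeq))"
    by (simp add: type_definition.Rep_range[OF type_definition_countable_ordinal])
  then have "|Field (cardSuc natLeq)| \<le>o natLeq"
    by (simp add: countable_card_le_natLeq)
  then have "cardSuc natLeq \<le>o natLeq"
    using card_of_Field_ordIso[OF cardSuc_Card_order[OF natLeq_Card_order]]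
      ordIso_symmetric ordIso_ordLeq_trans by blast
  then show False
    using cardSuc_greater[OF natLeq_Card_order] not_ordLess_ordLeq by blast
qed

lemma countable_Well_order_represented:
  includes cardinal_syntax
  assumes "Well_order r" and "countable (Field r)"
  shows "\<exists>\<alpha> f. bij_betw f (Field r) {..<(\<alpha>::countable_ordinal)} \<and>
    (\<forall>x\<in>Field r. \<forall>y\<in>Field r. (x, y) \<in> r \<longleftrightarrow> f x \<le> f y)"
proof -
  let ?r = "cardSuc natLeq"
  have co: "Card_order ?r" and wo: "Well_order ?r"
    by (simp_all add: cardSuc_Card_order card_order_on_well_order_on natLeq_Card_order)
  have "r <o ?r"
  proof (rule ccontr)
    assume "\<not> r <o ?r"
    then have "?r \<le>o r"
      using assms(1) wo by (simp add: not_ordLess_iff_ordLeq)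
    then have "|Field ?r| \<le>o |Field r|"
      by (rule card_of_mono2)
    moreover have "|Field r| \<le>o natLeq"
      using assms(2) by (simp add: countable_card_le_natLeq)
    ultimately have "|Field ?r| \<le>o natLeq"
      by (rule ordLeq_transitive)
    then have "cardSuc natLeq \<le>o natLeq"
      using card_of_Field_ordIso[OF cardSuc_Card_order[OF natLeq_Card_order]]
        ordIso_symmetric ordIso_ordLeq_trans by blast
    then show False
      using cardSuc_greater[OF natLeq_Card_order] not_ordLess_ordLeq by blast
  qed
  then obtain a where a: "a \<in> Field ?r" "r =o Restr ?r (underS ?r a)"
    using assms(1) wo ordLess_iff_ordIso_Restr by blast
  then obtain g where g: "iso r (Restr ?r (underS ?r a)) g"
    by (auto simp: ordIso_def)
  have "Field (Restr ?r (underS ?r a)) = underS ?r a"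
    using wo by (simp add: Field_Restr_ofilter wo_rel.underS_ofilter wo_rel_def)
  then have bij: "bij_betw g (Field r) (underS ?r a)"
    and iff: "\<forall>x\<in>Field r. \<forall>y\<in>Field r. (x, y) \<in> r \<longleftrightarrow> (g x, g y) \<in> ?r"
    using g by (auto simp: iso_iff2 bij_betw_def)
  define f where "f x = Abs_countable_ordinal (g x)" for x
  have g_Field: "g x \<in> Field ?r" if "x \<in> Field r" for x
    using bij_betwE[OF bij] that underS_Field by fast
  then have Rep_f: "Rep_countable_ordinal (f x) = g x" if "x \<in> Field r" for x
    using that by (simp add: f_def Abs_countable_ordinal_inverse)
  let ?\<alpha> = "Abs_countable_ordinal a"
  have less: "\<beta> < ?\<alpha> \<longleftrightarrow> Rep_countable_ordinal \<beta> \<in> underS ?r a" for \<beta>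
    using a(1) by (auto simp: less_le underS_def less_eq_countable_ordinal_def
        Abs_countable_ordinal_inverse simp flip: Rep_countable_ordinal_inject)
  have "bij_betw f (Field r) {..<?\<alpha>}"
  proof (rule bij_betw_imageI)
    show "inj_on f (Field r)"
    proof (rule inj_onI)
      fix x y assume "x \<in> Field r" "y \<in> Field r" "f x = f y"
      then have "g x = g y" using Rep_f by metis
      with \<open>x \<in> Field r\<close> \<open>y \<in> Field r\<close> show "x = y"
        using bij by (simp add: bij_betw_def inj_on_def)
    qed
    show "f ` Field r = {..<?\<alpha>}"
    proof safe
      fix x assume "x \<in> Field r"
      then show "f x < ?\<alpha>" using bij_betwE[OF bij] by (simp add: less Rep_f)
    next
      fix \<beta> assume "\<beta> < ?\<alpha>"
      then have "Rep_countable_ordinal \<beta> \<in> g ` Field r"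
        using bij less by (simp add: bij_betw_def)
      then obtain x where x: "x \<in> Field r" "g x = Rep_countable_ordinal \<beta>"
        by auto
      then have "f x = \<beta>"
        by (simp add: f_def Rep_countable_ordinal_inverse)
      with x(1) show "\<beta> \<in> f ` Field r"
        by blast
    qed
  qed
  moreover have "\<forall>x\<in>Field r. \<forall>y\<in>Field r. (x, y) \<in> r \<longleftrightarrow> f x \<le> f y"
    using iff by (simp add: less_eq_countable_ordinal_def Rep_f)
  ultimately show ?thesis by blast
qed

instantiation countable_ordinal :: zero
begin
definition zero_countable_ordinal :: countable_ordinal where "0 = (LEAST \<alpha> :: countable_ordinal. True)"
instance ..
end

lemma countable_ordinal_zero_le: "0 \<le> (\<alpha>::countable_ordinal)"
  by (simp add: zero_countable_ordinal_def Least_le)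

definition osuc :: "countable_ordinal \<Rightarrow> countable_ordinal" where
  "osuc \<alpha> = (LEAST \<beta>. \<alpha> < \<beta>)"

definition limit_ordinal :: "countable_ordinal \<Rightarrow> bool" where
  "limit_ordinal \<alpha> \<longleftrightarrow> \<alpha> \<noteq> 0 \<and> (\<forall>\<beta>. \<alpha> \<noteq> osuc \<beta>)"

lemma less_osuc: "\<alpha> < osuc \<alpha>"
proof -
  have "\<exists>\<beta>. \<alpha> < \<beta>"
  proof (rule ccontr)
    assume "\<nexists>\<beta>. \<alpha> < \<beta>"
    then have "UNIV = insert \<alpha> {..<\<alpha>}" by (auto simp: not_less order.order_iff_strict)
    then show False using countable_below[of \<alpha>] uncountable_ordinals by (metis countable_insert)
  qed
  then show ?thesis unfolding osuc_def by (rule LeastI_ex)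
qed

lemma less_osuc_iff: "\<beta> < osuc \<alpha> \<longleftrightarrow> \<beta> \<le> \<alpha>"
  by (metis Least_le leD less_osuc not_le_imp_less order_le_less_trans osuc_def)

lemma osuc_inject: "osuc \<alpha> = osuc \<beta> \<longleftrightarrow> \<alpha> = \<beta>"
  by (metis less_osuc less_osuc_iff order_antisym)

lemma osuc_neq_zero: "osuc \<alpha> \<noteq> 0"
  by (metis countable_ordinal_zero_le less_osuc leD)

section \<open>Curve-fragments and the curve-flat pseudometric\<close>

text \<open>A 1-Lipschitz curve-fragment \<open>\<phi>: K \<rightarrow> M\<close> in the metric space \<open>(M, d)\<close>. The domain is
  nonempty, as \<open>min K\<close> and \<open>max K\<close> are used throughout; for nonempty compact \<open>K\<close> they are
  \<open>Inf K\<close> and \<open>Sup K\<close>.\<close>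

definition curve_fragment1 :: "'a set \<Rightarrow> ('a \<Rightarrow> 'a \<Rightarrow> real) \<Rightarrow> real set \<Rightarrow> (real \<Rightarrow> 'a) \<Rightarrow> bool" where
  "curve_fragment1 M d K \<phi> \<longleftrightarrow> compact K \<and> K \<noteq> {} \<and> \<phi> \<in> K \<rightarrow> M \<and>
     (\<forall>s\<in>K. \<forall>t\<in>K. d (\<phi> s) (\<phi> t) \<le> \<bar>s - t\<bar>)"

definition dist_cf :: "'a set \<Rightarrow> ('a \<Rightarrow> 'a \<Rightarrow> real) \<Rightarrow> 'a \<Rightarrow> 'a \<Rightarrow> real" where
  "dist_cf M d x y = Inf {measure lebesgue ({Inf K..Sup K} - K) | K \<phi>.
     curve_fragment1 M d K \<phi> \<and> \<phi> (Inf K) = x \<and> \<phi> (Sup K) = y}"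

text \<open>The infimum is over a nonempty set: a two-point domain joins \<open>x\<close> and \<open>y\<close>.\<close>

lemma curve_fragment1_exists:
  assumes "Metric_space M d" "x \<in> M" "y \<in> M"
  shows "\<exists>K \<phi>. curve_fragment1 M d K \<phi> \<and> \<phi> (Inf K) = x \<and> \<phi> (Sup K) = y"
proof (cases "x = y")
  case True
  then show ?thesis using assms
    by (intro exI[of _ "{0}"] exI[of _ "\<lambda>_. x"])
      (auto simp: curve_fragment1_def Metric_space.mdist_zero)
next
  case False
  let ?D = "d x y" and ?\<phi> = "\<lambda>t::real. if t = 0 then x else y"
  have D: "?D > 0" "d y x = ?D" "d x x = 0" "d y y = 0"
    using assms False
    by (auto simp: Metric_space.mdist_pos_less Metric_space.commute Metric_space.mdist_zero)
  have "Inf {0, ?D} = 0" "Sup {0, ?D} = ?D"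
    using D by (auto simp: cInf_eq_Min cSup_eq_Max)
  then show ?thesis using assms D
    by (intro exI[of _ "{0, ?D}"] exI[of _ ?\<phi>])
      (auto simp: curve_fragment1_def)
qed

section \<open>Quotients by a pseudometric\<close>

text \<open>For a pseudometric \<open>D\<close>, the value of \<open>pm_quot_dist\<close> does not depend on the chosen
  representatives.\<close>

definition pm_class :: "'a set \<Rightarrow> ('a \<Rightarrow> 'a \<Rightarrow> real) \<Rightarrow> 'a \<Rightarrow> 'a set" where
  "pm_class M D x = {y \<in> M. D x y = 0}"

definition pm_quot :: "'a set \<Rightarrow> ('a \<Rightarrow> 'a \<Rightarrow> real) \<Rightarrow> 'a set set" where
  "pm_quot M D = pm_class M D ` M"

definition pm_quot_dist :: "('a \<Rightarrow> 'a \<Rightarrow> real) \<Rightarrow> 'a set \<Rightarrow> 'a set \<Rightarrow> real" where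
  "pm_quot_dist D X Y = D (SOME x. x \<in> X) (SOME y. y \<in> Y)"

section \<open>Iterated curve-flat quotients\<close>

text \<open>\<open>iter_cf M d \<alpha>\<close> is \<open>d\<^sub>c\<^sub>f\<^sup>\<alpha>\<close>, regarded as a pseudometric on \<open>M\<close>. The three cases of the
  recursion are restated in the lemmas \<open>iter_cf_zero\<close>, \<open>iter_cf_osuc\<close> and \<open>iter_cf_limit\<close>.\<close>

function iter_cf :: "'a set \<Rightarrow> ('a \<Rightarrow> 'a \<Rightarrow> real) \<Rightarrow> countable_ordinal \<Rightarrow> 'a \<Rightarrow> 'a \<Rightarrow> real" where
  "iter_cf M d \<alpha> =
    (if \<alpha> = 0 then d
     else if \<exists>\<beta>. \<alpha> = osuc \<beta> then
       (let D = iter_cf M d (THE \<beta>. \<alpha> = osuc \<beta>) in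
        (\<lambda>x y. dist_cf (pm_quot M D) (pm_quot_dist D) (pm_class M D x) (pm_class M D y)))
     else (\<lambda>x y. INF \<beta>\<in>{..<\<alpha>}. iter_cf M d \<beta> x y))"
  by auto
termination
proof (relation "inv_image {(\<beta>, \<alpha>). \<beta> < \<alpha>} (\<lambda>(M, d, \<alpha>). \<alpha>)")
  show "wf (inv_image {(\<beta>, \<alpha>). \<beta> < \<alpha>} (\<lambda>(M :: 'a set, d :: 'a \<Rightarrow> 'a \<Rightarrow> real, \<alpha> :: countable_ordinal). \<alpha>))"
    by (rule wf_inv_image) (rule wf)
qed (auto simp: osuc_inject less_osuc)

declare iter_cf.simps [simp del]

lemma iter_cf_zero: "iter_cf M d 0 = d"
  by (subst iter_cf.simps) simp

lemma iter_cf_osuc: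
  "iter_cf M d (osuc \<alpha>) x y =
    dist_cf (pm_quot M (iter_cf M d \<alpha>)) (pm_quot_dist (iter_cf M d \<alpha>))
      (pm_class M (iter_cf M d \<alpha>) x) (pm_class M (iter_cf M d \<alpha>) y)"
  by (subst iter_cf.simps) (simp add: osuc_neq_zero osuc_inject Let_def)

lemma iter_cf_limit:
  "limit_ordinal \<alpha> \<Longrightarrow> iter_cf M d \<alpha> x y = (INF \<beta>\<in>{..<\<alpha>}. iter_cf M d \<beta> x y)"
  by (subst iter_cf.simps) (auto simp: limit_ordinal_def)

text \<open>\<open>M\<^sub>c\<^sub>f\<^sup>\<alpha>\<close> is always taken as a quotient of \<open>M\<close> itself: for \<open>\<alpha> = 0\<close> its points are the
  singletons, and at successors it is \<open>(M\<^sub>c\<^sub>f\<^sup>\<beta>)\<^sub>c\<^sub>f\<close> up to the canonical identification of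
  iterated quotients.\<close>

definition space_cf :: "'a set \<Rightarrow> ('a \<Rightarrow> 'a \<Rightarrow> real) \<Rightarrow> countable_ordinal \<Rightarrow> 'a set set" where
  "space_cf M d \<alpha> = pm_quot M (iter_cf M d \<alpha>)"

definition mdist_cf :: "'a set \<Rightarrow> ('a \<Rightarrow> 'a \<Rightarrow> real) \<Rightarrow> countable_ordinal \<Rightarrow> 'a set \<Rightarrow> 'a set \<Rightarrow> real" where
  "mdist_cf M d \<alpha> = pm_quot_dist (iter_cf M d \<alpha>)"

section \<open>The curve-flat index\<close>

definition purely_1_unrectifiable :: "'a set \<Rightarrow> ('a \<Rightarrow> 'a \<Rightarrow> real) \<Rightarrow> bool" where
  "purely_1_unrectifiable M d \<longleftrightarrow>
    \<not> (\<exists>A f c C. A \<in> sets lebesgue \<and> emeasure lebesgue A > 0 \<and> f \<in> A \<rightarrow> M \<and> 0 < c \<and>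
        (\<forall>s\<in>A. \<forall>t\<in>A. c * \<bar>s - t\<bar> \<le> d (f s) (f t) \<and> d (f s) (f t) \<le> C * \<bar>s - t\<bar>))"

text \<open>The index is \<open>Pinf\<close> when no countable ordinal qualifies.\<close>

definition cf_index :: "'a set \<Rightarrow> ('a \<Rightarrow> 'a \<Rightarrow> real) \<Rightarrow> countable_ordinal extended" where
  "cf_index M d =
    (if \<exists>\<alpha>. purely_1_unrectifiable (space_cf M d \<alpha>) (mdist_cf M d \<alpha>)
     then Fin (LEAST \<alpha>. purely_1_unrectifiable (space_cf M d \<alpha>) (mdist_cf M d \<alpha>))
     else Pinf)"

section \<open>Almost isometries\<close>

definition almost_isometry ::
  "real \<Rightarrow> 'a set \<Rightarrow> ('a \<Rightarrow> 'a \<Rightarrow> real) \<Rightarrow> 'b set \<Rightarrow> ('b \<Rightarrow> 'b \<Rightarrow> real) \<Rightarrow> ('a \<Rightarrow> 'b) \<Rightarrow> bool" where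
  "almost_isometry \<epsilon> M d N \<rho> \<phi> \<longleftrightarrow> bij_betw \<phi> M N \<and>
    (\<forall>x\<in>M. \<forall>y\<in>M. (1 - \<epsilon>) * d x y \<le> \<rho> (\<phi> x) (\<phi> y) \<and> \<rho> (\<phi> x) (\<phi> y) \<le> (1 + \<epsilon>) * d x y)"

end

theory Submission
  imports Defs
begin

text \<open>
  A function that is 1-Lipschitz for \<open>d\<close> is 1-Lipschitz for \<open>d\<^sub>c\<^sub>f\<close> if and only if it maps every
  curve-fragment to a null set, so lower bounds on the iterated metrics reduce to exhibiting such
  functions.

  By induction on \<open>\<alpha>\<close>, let \<open>\<beta>\<^sub>n < \<alpha>\<close> be such that every \<open>\<gamma> < \<alpha>\<close> exceeds only finitely many
  \<open>\<beta>\<^sub>n\<close>. The induction hypothesis for the unit interval gives spaces \<open>A\<^sub>n\<close> that are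
  an arc at stage \<open>\<beta>\<^sub>n\<close> and a point at stage \<open>\<beta>\<^sub>n + 1\<close>. Remetrize \<open>M\<close> by
  \<open>max d (sqrt d)\<close>, which kills all rectifiability, and restore the metric \<open>d\<close> by bridges: for a
  sequence of pairs \<open>(u\<^sub>n, v\<^sub>n)\<close> in which all pairs of points are well approximated at their own
  scale, attach a copy of \<open>A\<^sub>n\<close> at \<open>u\<^sub>n\<close> whose other end is at distance \<open>d u\<^sub>n v\<^sub>n\<close> from
  \<open>v\<^sub>n\<close>. At stage \<open>\<alpha>\<close> all bridges have collapsed, and chaining them over the scales gives the upper
  bound \<open>(1 + \<epsilon>) d\<close>. Before stage \<open>\<alpha>\<close> only finitely many have collapsed, so the
  base is still a snowflake away from finitely many points; hence no curve-fragment gains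
  length in \<open>M\<close>, and \<open>d\<close> remains a lower bound.
\<close>

section \<open>Null images and increments along compact subsets of the line\<close>

text \<open>A snowflake carries no length: where a fragment satisfies
  \<open>sqrt (d y z) \<le> \<bar>s - t\<bar>\<close>, the increments of \<open>d\<close>-distances
  are quadratic in time and their image is null. The obstacle is that collapsed bridges shorten the
  metric, so this inequality survives only away from their endpoints. Hence two things are bounded
  below, one after the other: first 1/2-Hoelder bump functions that vanish at these endpoints, then,
  with their help, \<open>d\<close> itself. The endpoints, finite in number, add only finitely many
  values of a distance function. The metric of the glued space is a supremum of pullbacks, so the
  functions and retractions needed for lower bounds are 1-Lipschitz by definition. For the pieces of
  the bridges, distortion 2 of the unit interval is good enough: Lipschitz constants depending on
  \<open>n\<close> affect neither the collapse of a piece nor its rectifiability before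
  that.\<close>

lemma equipartition_cover:
  fixes a l x :: real
  assumes "0 < l" "a \<le> x" "x < a + l"
  shows "\<exists>i\<le>m. x \<in> {a + i * (l / Suc m) ..< a + Suc i * (l / Suc m)}"
proof -
  define w where "w = l / Suc m"
  have w: "w > 0" using assms by (simp add: w_def)
  define i where "i = nat \<lfloor>(x - a) / w\<rfloor>"
  have fl: "real i \<le> (x - a) / w" "(x - a) / w < real i + 1"
    using assms w unfolding i_def by (simp_all add: of_nat_nat)
  have "l / w = Suc m" using assms by (simp add: w_def)
  moreover have "(x - a) / w < l / w"
    using assms w by (intro divide_strict_right_mono) auto
  ultimately have "(x - a) / w < Suc m" by simp
  then have "i \<le> m"
    using fl by simp
  moreover have "a + i * w \<le> x" "x < a + Suc i * w"
    using fl w by (simp_all add: field_simps)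
  ultimately show ?thesis
    unfolding w_def by auto
qed

text \<open>The image of \<open>S \<inter> J i\<close> lies in an interval of radius
  \<open>\<delta> i\<close> around one of its values, so the whole image is covered by length
  \<open>2 * sum \<delta> I\<close>.\<close>

lemma negligible_image_small_oscillation:
  fixes f :: "'c \<Rightarrow> real"
  assumes "\<And>e. e > 0 \<Longrightarrow> \<exists>I J \<delta>. finite (I :: nat set) \<and> S \<subseteq> (\<Union>i\<in>I. J i) \<and> (\<forall>i\<in>I. \<delta> i \<ge> 0) \<and>
      (\<forall>i\<in>I. \<forall>s\<in>S \<inter> J i. \<forall>t\<in>S \<inter> J i. \<bar>f s - f t\<bar> \<le> \<delta> i) \<and> sum \<delta> I \<le> e"
  shows "negligible (f ` S)"
  unfolding negligible_outer_le
proof (intro allI impI)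
  fix e :: real
  assume "e > 0"
  then obtain I J \<delta> where I: "finite (I :: nat set)" "S \<subseteq> (\<Union>i\<in>I. J i)" "\<forall>i\<in>I. \<delta> i \<ge> 0"
    and osc: "\<forall>i\<in>I. \<forall>s\<in>S \<inter> J i. \<forall>t\<in>S \<inter> J i. \<bar>f s - f t\<bar> \<le> \<delta> i" and sum: "sum \<delta> I \<le> e / 2"
    using assms[of "e / 2"] by auto
  \<comment> \<open>If \<open>S \<inter> J i\<close> is empty the centre is arbitrary; this only
    enlarges the cover.\<close>
  define c where "c i = f (SOME s. s \<in> S \<inter> J i)" for i
  define T where "T = (\<Union>i\<in>I. {c i - \<delta> i .. c i + \<delta> i})"
  have "f ` S \<subseteq> T"
  proof
    fix y assume "y \<in> f ` S"
    then obtain s i where s: "y = f s" "s \<in> S" "i \<in> I" "s \<in> J i" using I by blast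
    then have "(SOME s. s \<in> S \<inter> J i) \<in> S \<inter> J i" by (metis IntI someI)
    then have "\<bar>f s - c i\<bar> \<le> \<delta> i" using osc s unfolding c_def by blast
    then show "y \<in> T" using s unfolding T_def by (intro UN_I[of i]) auto
  qed
  moreover have "T \<in> lmeasurable"
    unfolding T_def using I by (intro fmeasurable.finite_UN) auto
  moreover have "measure lebesgue T \<le> e"
  proof -
    have "measure lebesgue T \<le> (\<Sum>i\<in>I. measure lebesgue {c i - \<delta> i .. c i + \<delta> i})"
      unfolding T_def using I by (intro measure_UNION_le) auto
    also have "\<dots> = (\<Sum>i\<in>I. 2 * \<delta> i)"
      using I by (intro sum.cong) auto
    finally show ?thesis using sum by (simp flip: sum_distrib_left)
  qed
  ultimately show "\<exists>T. f ` S \<subseteq> T \<and> T \<in> lmeasurable \<and> measure lebesgue T \<le> e" by blast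
qed

text \<open>\<open>Suc m\<close> intervals of length \<open>l / Suc m\<close> give total oscillation
  \<open>l\<^sup>2 / Suc m\<close>, which tends to \<open>0\<close>. This is how a snowflake makes
  images null.\<close>

lemma negligible_image_quadratic:
  fixes f :: "real \<Rightarrow> real"
  assumes "bounded S" "0 < c"
    and quad: "\<And>s t. s \<in> S \<Longrightarrow> t \<in> S \<Longrightarrow> \<bar>s - t\<bar> < c \<Longrightarrow> \<bar>f s - f t\<bar> \<le> (s - t)\<^sup>2"
  shows "negligible (f ` S)"
proof (rule negligible_image_small_oscillation)
  fix e :: real
  assume "e > 0"
  obtain B where B: "B > 0" "\<And>s. s \<in> S \<Longrightarrow> \<bar>s\<bar> \<le> B"
    using assms(1) by (auto simp: bounded_pos)
  \<comment> \<open>The extra \<open>1\<close> puts the right endpoint \<open>B\<close> inside the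
    half-open intervals.\<close>
  define l where "l = 2 * B + 1"
  have l: "l > 0" using B by (simp add: l_def)
  \<comment> \<open>The first summand makes the intervals shorter than \<open>c\<close>, so that
    \<open>quad\<close> applies inside each; the second brings the total below
    \<open>e\<close>.\<close>
  obtain m :: nat where m: "l / c + l\<^sup>2 / e < real m"
    using reals_Archimedean2 by blast
  define w where "w = l / Suc m"
  have nn: "l / c > 0" "l\<^sup>2 / e > 0" using l \<open>c > 0\<close> \<open>e > 0\<close> by auto
  have w: "w > 0" using l by (simp add: w_def)
  have "l / c < Suc m" "l\<^sup>2 / e < Suc m" using m nn by auto
  then have wc: "w < c" and we: "l\<^sup>2 / Suc m < e"
    using \<open>c > 0\<close> \<open>e > 0\<close> by (auto simp: w_def field_simps)
  let ?J = "\<lambda>i::nat. {-B + i * w ..< -B + Suc i * w}"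
  have "S \<subseteq> (\<Union>i\<in>{..m}. ?J i)"
  proof
    fix s assume "s \<in> S"
    then show "s \<in> (\<Union>i\<in>{..m}. ?J i)"
      using equipartition_cover[OF l, of "-B" s m] B(2)[of s] by (fastforce simp: l_def w_def)
  qed
  moreover have "\<bar>f s - f t\<bar> \<le> w\<^sup>2" if "s \<in> S \<inter> ?J i" "t \<in> S \<inter> ?J i" for s t i
  proof -
    have *: "\<bar>s - t\<bar> \<le> w" using that by (auto simp: algebra_simps)
    then have "\<bar>f s - f t\<bar> \<le> (s - t)\<^sup>2" using quad[of s t] that wc by auto
    also have "\<dots> \<le> w\<^sup>2" using * by (simp add: abs_le_square_iff[symmetric])
    finally show ?thesis .
  qed
  moreover have "(\<Sum>i\<in>{..m}. w\<^sup>2) \<le> e"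
  proof -
    have "(\<Sum>i\<in>{..m}. w\<^sup>2) = l\<^sup>2 / Suc m"
      unfolding w_def by (simp add: power_divide) (simp add: power2_eq_square)
    then show ?thesis using we by simp
  qed
  ultimately show "\<exists>I J \<delta>. finite (I :: nat set) \<and> S \<subseteq> (\<Union>i\<in>I. J i) \<and> (\<forall>i\<in>I. \<delta> i \<ge> 0) \<and>
      (\<forall>i\<in>I. \<forall>s\<in>S \<inter> J i. \<forall>t\<in>S \<inter> J i. \<bar>f s - f t\<bar> \<le> \<delta> i) \<and> sum \<delta> I \<le> e"
    by (intro exI[of _ "{..m}"] exI[of _ ?J] exI[of _ "\<lambda>_. w\<^sup>2"]) auto
qed

lemma gaps_lmeasurable: "compact (K :: real set) \<Longrightarrow> {s..t} - K \<in> lmeasurable"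
  by (intro fmeasurable.Diff lmeasurable_compact) auto

text \<open>On an interval of length at most \<open>w\<close> that meets \<open>K\<close>, all gaps lie in the
  \<open>w\<close>-neighbourhood of \<open>K\<close>; the measure of that neighbourhood outside \<open>K\<close> tends to \<open>0\<close>.\<close>

lemma negligible_image_gap_Lipschitz:
  fixes f :: "real \<Rightarrow> real"
  assumes K: "compact K" and C: "C \<ge> 0"
    and f: "\<And>s t. s \<in> K \<Longrightarrow> t \<in> K \<Longrightarrow> s \<le> t \<Longrightarrow> \<bar>f s - f t\<bar> \<le> C * measure lebesgue ({s..t} - K)"
  shows "negligible (f ` K)"
proof (cases "K = {}")
  case False
  define a where "a = Inf K"
  define l where "l = Sup K - Inf K + 1"
  have bd: "bdd_below K" "bdd_above K"
    using compact_imp_bounded[OF K] bounded_imp_bdd_above bounded_imp_bdd_below by auto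
  have ab: "a \<le> s" "s < a + l" if "s \<in> K" for s
    using cInf_lower[OF that bd(1)] cSup_upper[OF that bd(2)] by (auto simp: a_def l_def)
  then have l: "l > 0" using False by force
  define N where "N m = {x \<in> {a..a + l} - K. infdist x K \<le> l / Suc m}" for m :: nat
  have N_meas: "N m \<in> lmeasurable" for m
  proof -
    have [measurable]: "(\<lambda>x. infdist x K) \<in> borel_measurable borel"
      by (intro borel_measurable_continuous_onI continuous_intros)
    have "{x. infdist x K \<le> l / Suc m} \<in> sets borel" by measurable
    then have "({a..a + l} - K) \<inter> {x. infdist x K \<le> l / Suc m} \<in> lmeasurable"
      by (intro fmeasurable_Int_fmeasurable[OF gaps_lmeasurable[OF K]]) auto
    moreover have "N m = ({a..a + l} - K) \<inter> {x. infdist x K \<le> l / Suc m}" by (auto simp: N_def)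
    ultimately show ?thesis by simp
  qed
  have "(\<lambda>m. measure lebesgue (N m)) \<longlonglongrightarrow> measure lebesgue (\<Inter> (range N))"
  proof (rule Lim_measure_decseq)
    show "range N \<subseteq> sets lebesgue" using N_meas by (auto simp: fmeasurableD)
    show "decseq N"
    proof (rule decseq_SucI)
      fix m
      have "l / Suc (Suc m) \<le> l / Suc m" using l by (intro divide_left_mono) auto
      then show "N (Suc m) \<subseteq> N m" by (auto simp: N_def)
    qed
    show "emeasure lebesgue (N i) \<noteq> \<infinity>" for i
      using N_meas[of i] by (auto simp: fmeasurable_def)
  qed
  moreover have "\<Inter> (range N) = {}"
  proof -
    have False if x: "x \<notin> K" "\<And>m :: nat. infdist x K \<le> l / Suc m" for x
    proof -
      have "infdist x K > 0"
        using K x False infdist_pos_not_in_closed compact_imp_closed by blast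
      then obtain m :: nat where "l / infdist x K < real m"
        using reals_Archimedean2 by blast
      then have "l / infdist x K < Suc m" by simp
      then have "l / Suc m < infdist x K" using \<open>infdist x K > 0\<close> by (simp add: field_simps)
      then show False using x(2)[of m] by simp
    qed
    then show ?thesis by (fastforce simp: N_def)
  qed
  ultimately have lim: "(\<lambda>m. measure lebesgue (N m)) \<longlonglongrightarrow> 0" by simp
  show ?thesis
  proof (rule negligible_image_small_oscillation)
    fix e :: real
    assume "e > 0"
    have "(\<lambda>m. C * measure lebesgue (N m)) \<longlonglongrightarrow> 0" using tendsto_mult_right_zero[OF lim] by auto
    then have "\<forall>\<^sub>F m in sequentially. C * measure lebesgue (N m) < e"
      using \<open>e > 0\<close> order_tendstoD(2) by blast
    then obtain m where m: "C * measure lebesgue (N m) < e"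
      using eventually_happens'[OF sequentially_bot] by blast
    define J where "J i = {a + i * (l / Suc m) ..< a + Suc i * (l / Suc m)}" for i :: nat
    have w: "l / Suc m > 0" using l by auto
    have disj: "disjoint_family J"
    proof -
      have "J i \<inter> J j = {}" if "i < j" for i j :: nat
      proof -
        have "real (Suc i) * (l / Suc m) \<le> real j * (l / Suc m)"
          using that w by (intro mult_right_mono) auto
        then show ?thesis by (auto simp: J_def)
      qed
      then show ?thesis unfolding disjoint_family_on_def by (metis Int_commute linorder_neqE_nat)
    qed
    have NJ: "N m \<inter> J i \<in> lmeasurable" for i
      using N_meas by (auto simp: J_def intro!: fmeasurable_Int_fmeasurable)
    have NJ_sets: "N m \<inter> J i \<in> sets lebesgue" for i using NJ by (rule fmeasurableD)
    have "K \<subseteq> (\<Union>i\<in>{..m}. J i)"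
    proof
      fix s assume "s \<in> K"
      then obtain i where "i \<le> m" "s \<in> J i"
        unfolding J_def using equipartition_cover[OF l ab] by blast
      then show "s \<in> (\<Union>i\<in>{..m}. J i)" by blast
    qed
    moreover have osc: "\<bar>f s - f t\<bar> \<le> C * measure lebesgue (N m \<inter> J i)"
      if "s \<in> K \<inter> J i" "t \<in> K \<inter> J i" "s \<le> t" for s t i
    proof -
      have "{s..t} - K \<subseteq> N m \<inter> J i"
      proof
        fix x assume x: "x \<in> {s..t} - K"
        have "infdist x K \<le> dist x s" using that by (intro infdist_le) auto
        also have "\<dots> \<le> l / Suc m"
          using x that unfolding J_def dist_real_def of_nat_Suc[of i] distrib_right by auto
        finally have "infdist x K \<le> l / Suc m" .
        moreover have "a \<le> x" "x \<le> a + l" using ab(1)[of s] ab(2)[of t] that x by auto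
        ultimately show "x \<in> N m \<inter> J i" using x that by (auto simp: N_def J_def)
      qed
      then have "measure lebesgue ({s..t} - K) \<le> measure lebesgue (N m \<inter> J i)"
        using gaps_lmeasurable[OF K] NJ by (intro measure_mono_fmeasurable) (auto simp: fmeasurableD)
      then show ?thesis using f[of s t] that C by (meson IntD1 mult_left_mono order_trans)
    qed
    moreover have "\<bar>f s - f t\<bar> \<le> C * measure lebesgue (N m \<inter> J i)"
      if "s \<in> K \<inter> J i" "t \<in> K \<inter> J i" for s t i
      using osc[OF that] osc[OF that(2,1)] by (cases "s \<le> t") (auto simp: abs_minus_commute)
    moreover have "(\<Sum>i\<in>{..m}. C * measure lebesgue (N m \<inter> J i)) \<le> e"
    proof -
      have "(\<Sum>i\<in>{..m}. measure lebesgue (N m \<inter> J i)) = measure lebesgue (\<Union>i\<in>{..m}. N m \<inter> J i)"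
      proof (rule measure_finite_Union[symmetric])
        show "(\<lambda>i. N m \<inter> J i) ` {..m} \<subseteq> sets lebesgue" using NJ_sets by blast
        show "disjoint_family_on (\<lambda>i. N m \<inter> J i) {..m}"
          using disj unfolding disjoint_family_on_def by blast
        show "emeasure lebesgue (N m \<inter> J i) \<noteq> \<infinity>" for i
          using fmeasurableD2[OF NJ] by (simp add: infinity_ennreal_def)
      qed simp
      also have "\<dots> \<le> measure lebesgue (N m)"
      proof (rule measure_mono_fmeasurable)
        show "(\<Union>i\<in>{..m}. N m \<inter> J i) \<in> sets lebesgue" using NJ_sets by (intro sets.finite_UN) auto
      qed (use N_meas in blast)+
      finally have "C * (\<Sum>i\<in>{..m}. measure lebesgue (N m \<inter> J i)) \<le> C * measure lebesgue (N m)"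
        using C mult_left_mono by blast
      then show ?thesis using m by (simp flip: sum_distrib_left)
    qed
    moreover have "0 \<le> C * measure lebesgue (N m \<inter> J i)" for i using C by simp
    ultimately show "\<exists>I J \<delta>. finite (I :: nat set) \<and> K \<subseteq> (\<Union>i\<in>I. J i) \<and> (\<forall>i\<in>I. \<delta> i \<ge> 0) \<and>
      (\<forall>i\<in>I. \<forall>s\<in>K \<inter> J i. \<forall>t\<in>K \<inter> J i. \<bar>f s - f t\<bar> \<le> \<delta> i) \<and> sum \<delta> I \<le> e"
      by (intro exI[of _ "{..m}"] exI[of _ J] exI[of _ "\<lambda>i. C * measure lebesgue (N m \<inter> J i)"])
        (intro conjI finite_atMost ballI; assumption?; blast)
  qed
qed auto

lemma McShane_extension:
  fixes f :: "real \<Rightarrow> real"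
  assumes "K \<noteq> {}" and f: "\<And>s t. s \<in> K \<Longrightarrow> t \<in> K \<Longrightarrow> \<bar>f s - f t\<bar> \<le> \<bar>s - t\<bar>"
  obtains F where "\<And>s. s \<in> K \<Longrightarrow> F s = f s" "\<And>s t. \<bar>F s - F t\<bar> \<le> \<bar>s - t\<bar>"
proof
  define F where "F t = (INF s\<in>K. f s + \<bar>s - t\<bar>)" for t
  obtain k where k: "k \<in> K" using assms(1) by blast
  have bdd: "bdd_below ((\<lambda>s. f s + \<bar>s - t\<bar>) ` K)" for t
  proof (rule bdd_belowI2)
    fix s assume "s \<in> K"
    then show "f k - \<bar>k - t\<bar> \<le> f s + \<bar>s - t\<bar>" using f[OF k, of s] by linarith
  qed
  show "F s = f s" if "s \<in> K" for s
  proof (rule antisym)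
    show "F s \<le> f s" unfolding F_def using cINF_lower[OF bdd that, of s] by simp
    show "f s \<le> F s" unfolding F_def
    proof (rule cINF_greatest[OF assms(1)])
      fix u assume "u \<in> K"
      then show "f s \<le> f u + \<bar>u - s\<bar>" using f[of u s] that by linarith
    qed
  qed
  have "F s - F t \<le> \<bar>s - t\<bar>" for s t
  proof -
    have "F s - \<bar>s - t\<bar> \<le> F t" unfolding F_def[of t]
    proof (rule cINF_greatest[OF assms(1)])
      fix u assume "u \<in> K"
      then have "F s \<le> f u + \<bar>u - s\<bar>" unfolding F_def by (intro cINF_lower bdd)
      then show "F s - \<bar>s - t\<bar> \<le> f u + \<bar>u - t\<bar>" by linarith
    qed
    then show ?thesis by simp
  qed
  then show "\<bar>F s - F t\<bar> \<le> \<bar>s - t\<bar>" for s t by (smt (verit))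
qed

text \<open>The interval between \<open>f (min K)\<close> and \<open>f (max K)\<close> is covered by the null set \<open>f ` K\<close> and the
  image of the gaps under a 1-Lipschitz extension of \<open>f\<close>, whose measure is at most that of the gaps.\<close>

lemma increment_le_gaps:
  fixes f :: "real \<Rightarrow> real"
  assumes K: "compact K" "K \<noteq> {}" and f: "\<And>s t. s \<in> K \<Longrightarrow> t \<in> K \<Longrightarrow> \<bar>f s - f t\<bar> \<le> \<bar>s - t\<bar>"
    and null: "negligible (f ` K)"
  shows "f (Sup K) - f (Inf K) \<le> measure lebesgue ({Inf K..Sup K} - K)"
proof (rule field_le_epsilon)
  fix e :: real assume "e > 0"
  define a b where "a = Inf K" and "b = Sup K"
  have abK: "a \<in> K" "b \<in> K"
    unfolding a_def b_def using K
    by (auto intro!: closed_contains_Inf closed_contains_Sup compact_imp_closed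
        bounded_imp_bdd_above bounded_imp_bdd_below compact_imp_bounded)
  then have "a \<le> b" unfolding a_def
    using K by (intro cInf_lower) (auto intro: bounded_imp_bdd_below compact_imp_bounded)
  obtain F where F: "\<And>s. s \<in> K \<Longrightarrow> F s = f s" and F_lip: "\<And>s t. \<bar>F s - F t\<bar> \<le> \<bar>s - t\<bar>"
    using McShane_extension[OF K(2) f] by blast
  let ?S = "{a..b} - K"
  have S: "?S \<in> lmeasurable" "?S \<subseteq> cbox a b" using gaps_lmeasurable[OF K(1)] by auto
  obtain \<D> where D: "countable \<D>"
      "\<And>J. J \<in> \<D> \<Longrightarrow> J \<subseteq> cbox a b \<and> J \<noteq> {} \<and> (\<exists>c d. J = cbox c d)"
      "pairwise (\<lambda>A B. interior A \<inter> interior B = {}) \<D>"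
      "?S \<subseteq> \<Union>\<D>" "\<Union>\<D> \<in> lmeasurable" "measure lebesgue (\<Union>\<D>) \<le> measure lebesgue ?S + e"
    by (rule measurable_outer_intervals_bounded[OF S \<open>e > 0\<close>]) auto
  \<comment> \<open>An interval of the same length as \<open>J\<close>, centred at the value of
    \<open>F\<close> at the midpoint of \<open>J\<close>; it contains the image of \<open>J\<close>
    because \<open>F\<close> is 1-Lipschitz.\<close>
  define G where "G J = {F ((Inf J + Sup J) / 2) - (Sup J - Inf J) / 2 .. F ((Inf J + Sup J) / 2) + (Sup J - Inf J) / 2}"
    for J :: "real set"
  have D_box: "J = {Inf J..Sup J} \<and> Inf J \<le> Sup J" if "J \<in> \<D>" for J
    using D(2)[OF that] by auto
  have FG: "F ` J \<subseteq> G J" if "J \<in> \<D>" for J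
  proof
    fix y assume "y \<in> F ` J"
    then obtain t where t: "y = F t" "t \<in> J" by blast
    then have "Inf J \<le> t" "t \<le> Sup J" using D_box[OF that] atLeastAtMost_iff by blast+
    then have "\<bar>t - (Inf J + Sup J) / 2\<bar> \<le> (Sup J - Inf J) / 2" by (simp add: abs_if field_simps)
    then have "\<bar>F t - F ((Inf J + Sup J) / 2)\<bar> \<le> (Sup J - Inf J) / 2"
      using F_lip[of t "(Inf J + Sup J) / 2"] by linarith
    then show "y \<in> G J" unfolding G_def atLeastAtMost_iff t(1) by linarith
  qed
  have G_meas: "G J \<in> lmeasurable" for J by (simp add: G_def)
  have G_measure: "measure lebesgue (G J) = measure lebesgue J" if "J \<in> \<D>" for J
  proof -
    obtain c d where "J = {c..d}" "c \<le> d" using D(2)[OF \<open>J \<in> \<D>\<close>] by auto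
    then show ?thesis by (simp add: G_def field_simps)
  qed
  \<comment> \<open>The intervals in \<open>\<D>\<close> overlap only in null sets, so in a finite
    subfamily the lengths add up to the measure of the union. The uniform bound then passes to the
    countable union.\<close>
  have fin: "measure lebesgue (\<Union>J\<in>\<D>'. G J) \<le> measure lebesgue ?S + e" if "\<D>' \<subseteq> \<D>" "finite \<D>'" for \<D>'
  proof -
    have "measure lebesgue (\<Union>J\<in>\<D>'. G J) \<le> (\<Sum>J\<in>\<D>'. measure lebesgue (G J))"
      using G_meas by (intro measure_UNION_le that fmeasurableD)
    also have "\<dots> = (\<Sum>J\<in>\<D>'. measure lebesgue J)" using that G_measure by (intro sum.cong) auto
    also have "\<dots> = measure lebesgue (\<Union>\<D>')"
    proof (rule measure_negligible_finite_Union[symmetric, OF that(2)])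
      show "J \<in> lmeasurable" if "J \<in> \<D>'" for J
        using D(2)[of J] that \<open>\<D>' \<subseteq> \<D>\<close> by auto
      show "pairwise (\<lambda>S T. negligible (S \<inter> T)) \<D>'"
      proof (rule pairwiseI)
        fix A B assume AB: "A \<in> \<D>'" "B \<in> \<D>'" "A \<noteq> B"
        then have "interior (A \<inter> B) = {}" using D(3) that(1) by (auto simp: pairwise_def)
        moreover have "convex A" "convex B"
          using D(2)[of A] D(2)[of B] AB that(1) by auto
        then have "convex (A \<inter> B)" by (rule convex_Int)
        ultimately show "negligible (A \<inter> B)" using negligible_convex_interior by blast
      qed
    qed
    also have "\<dots> \<le> measure lebesgue (\<Union>\<D>)"
    proof (rule measure_mono_fmeasurable)
      show "\<Union>\<D>' \<in> sets lebesgue"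
      proof (rule sets.finite_Union[OF that(2)])
        show "\<D>' \<subseteq> sets lebesgue" using D(2) that(1) by fastforce
      qed
      show "\<Union>\<D>' \<subseteq> \<Union>\<D>" using that(1) by blast
    qed (rule D(5))
    finally show ?thesis using D(6) by simp
  qed
  have UG: "(\<Union>J\<in>\<D>. G J) \<in> lmeasurable" "measure lebesgue (\<Union>J\<in>\<D>. G J) \<le> measure lebesgue ?S + e"
    by (rule fmeasurable_UN_bound[OF D(1) G_meas fin] measure_UN_bound[OF D(1) G_meas fin]; assumption)+
  have fK: "f ` K \<in> lmeasurable" "measure lebesgue (f ` K) = 0"
    using null by (auto simp: negligible_iff_measure)
  have cover: "{f a..f b} \<subseteq> f ` K \<union> (\<Union>J\<in>\<D>. G J)"
  proof
    fix y assume "y \<in> {f a..f b}"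
    moreover have "continuous_on {a..b} F"
      using F_lip by (intro lipschitz_on_continuous_on[of 1] lipschitz_onI) (auto simp: dist_real_def)
    ultimately obtain t where t: "a \<le> t" "t \<le> b" "F t = y"
      using IVT'[of F a y b] \<open>a \<le> b\<close> F abK by auto
    show "y \<in> f ` K \<union> (\<Union>J\<in>\<D>. G J)"
    proof (cases "t \<in> K")
      case True then show ?thesis using F t by force
    next
      case False
      then obtain J where "J \<in> \<D>" "t \<in> J" using D(4) t by auto
      then show ?thesis using FG t by blast
    qed
  qed
  show "f (Sup K) - f (Inf K) \<le> measure lebesgue ({Inf K..Sup K} - K) + e"
  proof (cases "f a \<le> f b")
    case True
    then have "f b - f a = measure lebesgue {f a..f b}" by simp
    also have "\<dots> \<le> measure lebesgue (f ` K \<union> (\<Union>J\<in>\<D>. G J))"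
      using cover fK UG by (intro measure_mono_fmeasurable) auto
    also have "\<dots> \<le> measure lebesgue (f ` K) + measure lebesgue (\<Union>J\<in>\<D>. G J)"
      using fK UG by (intro measure_Un_le) (auto simp: fmeasurableD)
    finally show ?thesis using fK UG by (simp add: a_def b_def)
  next
    case False
    have "measure lebesgue ({Inf K..Sup K} - K) \<ge> 0" by simp
    then show ?thesis using False \<open>e > 0\<close> unfolding a_def b_def by linarith
  qed
qed

section \<open>Pseudometrics and their curve-flat iterates\<close>

text \<open>Every stage is kept as a pseudometric on the same carrier, so stages can be compared
  without maps between quotients. Quotients are formed only in the final statement.\<close>

locale pseudometric =
  fixes M :: "'a set" and d :: "'a \<Rightarrow> 'a \<Rightarrow> real"
  assumes dist_self [simp]: "x \<in> M \<Longrightarrow> d x x = 0"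
    and dist_commute: "x \<in> M \<Longrightarrow> y \<in> M \<Longrightarrow> d x y = d y x"
    and dist_triangle: "x \<in> M \<Longrightarrow> y \<in> M \<Longrightarrow> z \<in> M \<Longrightarrow> d x z \<le> d x y + d y z"
begin

lemma dist_nonneg: "x \<in> M \<Longrightarrow> y \<in> M \<Longrightarrow> 0 \<le> d x y"
  using dist_triangle[of x y x] dist_commute[of x y] by simp

lemma dist_diff_le: "x \<in> M \<Longrightarrow> y \<in> M \<Longrightarrow> z \<in> M \<Longrightarrow> \<bar>d x y - d x z\<bar> \<le> d y z"
  using dist_triangle[of x y z] dist_triangle[of x z y] dist_commute[of y z] by simp

lemma dist_cong:
  assumes "x \<in> M" "x' \<in> M" "y \<in> M" "y' \<in> M" "d x x' = 0" "d y y' = 0"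
  shows "d x y = d x' y'"
proof -
  have "d x' x = 0" "d y' y = 0" using assms dist_commute by metis+
  then show ?thesis
    using assms dist_triangle[of x x' y] dist_triangle[of x' y' y] dist_triangle[of x' x y']
      dist_triangle[of x y y'] by simp
qed

end

lemma Metric_space_pseudometric: "Metric_space M d \<Longrightarrow> pseudometric M d"
  unfolding pseudometric_def
  using Metric_space.mdist_zero Metric_space.commute Metric_space.triangle by metis

lemma curve_fragment1_bounds:
  assumes "curve_fragment1 M d K \<phi>"
  shows "Inf K \<in> K" "Sup K \<in> K" "t \<in> K \<Longrightarrow> Inf K \<le> t" "t \<in> K \<Longrightarrow> t \<le> Sup K"
proof -
  have K: "compact K" "K \<noteq> {}" using assms by (auto simp: curve_fragment1_def)
  have bd: "bdd_below K" "bdd_above K"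
    using compact_imp_bounded[OF K(1)] bounded_imp_bdd_above bounded_imp_bdd_below by auto
  show "Inf K \<in> K" "Sup K \<in> K"
    using K bd by (auto intro!: closed_contains_Inf closed_contains_Sup compact_imp_closed)
  show "t \<in> K \<Longrightarrow> Inf K \<le> t" "t \<in> K \<Longrightarrow> t \<le> Sup K"
    using bd by (auto intro: cInf_lower cSup_upper)
qed

text \<open>An \<open>m\<close>-Lipschitz map turns a fragment into a fragment once time is
  stretched by \<open>m\<close>, and the gaps scale by the same factor. The case
  \<open>m = 1\<close> is the translation used to concatenate fragments.\<close>

lemma curve_fragment1_affine:
  assumes \<phi>: "curve_fragment1 M d K \<phi>" and m: "m > 0"
    and f: "\<And>x. x \<in> M \<Longrightarrow> f x \<in> N" "\<And>x y. x \<in> M \<Longrightarrow> y \<in> M \<Longrightarrow> e (f x) (f y) \<le> m * d x y"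
  shows "curve_fragment1 N e ((\<lambda>t. m * t + c) ` K) (\<lambda>s. f (\<phi> ((s - c) / m)))"
    and "Inf ((\<lambda>t. m * t + c) ` K) = m * Inf K + c" "Sup ((\<lambda>t. m * t + c) ` K) = m * Sup K + c"
    and "measure lebesgue ({m * Inf K + c..m * Sup K + c} - (\<lambda>t. m * t + c) ` K) =
      m * measure lebesgue ({Inf K..Sup K} - K)"
proof -
  note b = curve_fragment1_bounds[OF \<phi>]
  have "compact ((\<lambda>t. m * t + c) ` K)"
    using \<phi> by (intro compact_continuous_image continuous_intros) (auto simp: curve_fragment1_def)
  moreover have "e (f (\<phi> s)) (f (\<phi> t)) \<le> \<bar>m * s - m * t\<bar>" if "s \<in> K" "t \<in> K" for s t
  proof -
    have "e (f (\<phi> s)) (f (\<phi> t)) \<le> m * d (\<phi> s) (\<phi> t)"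
      using f \<phi> that by (auto simp: curve_fragment1_def)
    also have "\<dots> \<le> m * \<bar>s - t\<bar>" using \<phi> that m by (auto simp: curve_fragment1_def)
    finally show ?thesis using m by (simp add: abs_mult right_diff_distrib[symmetric])
  qed
  ultimately show "curve_fragment1 N e ((\<lambda>t. m * t + c) ` K) (\<lambda>s. f (\<phi> ((s - c) / m)))"
    using \<phi> m f(1) unfolding curve_fragment1_def Pi_iff by auto
  show "Inf ((\<lambda>t. m * t + c) ` K) = m * Inf K + c"
    using b m by (intro cInf_eq_minimum) auto
  show "Sup ((\<lambda>t. m * t + c) ` K) = m * Sup K + c"
    using b m by (intro cSup_eq_maximum) auto
  have "{m * Inf K + c..m * Sup K + c} - (\<lambda>t. m * t + c) ` K = (\<lambda>t. m *\<^sub>R t + c) ` ({Inf K..Sup K} - K)"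
  proof -
    have "(\<lambda>t. m * t + c) ` {Inf K..Sup K} = {m * Inf K + c..m * Sup K + c}"
      using m b image_affinity_atLeastAtMost[of m c "Inf K" "Sup K"] by auto
    moreover have "inj (\<lambda>t. m * t + c)" using m by (auto simp: inj_def)
    ultimately show ?thesis by (simp add: image_set_diff)
  qed
  then show "measure lebesgue ({m * Inf K + c..m * Sup K + c} - (\<lambda>t. m * t + c) ` K) =
      m * measure lebesgue ({Inf K..Sup K} - K)"
    using measure_lebesgue_affine[of m c "{Inf K..Sup K} - K"] m by simp
qed

lemma dist_cf_le:
  assumes "curve_fragment1 M d K \<phi>"
  shows "dist_cf M d (\<phi> (Inf K)) (\<phi> (Sup K)) \<le> measure lebesgue ({Inf K..Sup K} - K)"
  unfolding dist_cf_def using assms by (intro cInf_lower bdd_belowI[of _ 0]) auto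

section \<open>Pseudometric axioms and Lipschitz maps for \<open>dist_cf\<close>\<close>

context pseudometric
begin

text \<open>The strict inequality keeps the two points of the domain apart even if
  \<open>d x y = 0\<close>, which a pseudometric allows for distinct points.\<close>

lemma dist_fragment:
  assumes "x \<in> M" "y \<in> M" "r > d x y"
  defines "K \<equiv> {0, r}" and "\<phi> \<equiv> \<lambda>t::real. if t = 0 then x else y"
  shows "curve_fragment1 M d K \<phi>" "\<phi> (Inf K) = x" "\<phi> (Sup K) = y"
    "measure lebesgue ({Inf K..Sup K} - K) = r"
proof -
  have r: "r > 0" using assms dist_nonneg[of x y] by simp
  then have IS: "Inf K = 0" "Sup K = r"
    by (auto simp: K_def cInf_eq_Min cSup_eq_Max)
  show "curve_fragment1 M d K \<phi>"
    using assms dist_commute[of x y] r by (auto simp: curve_fragment1_def)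
  show "\<phi> (Inf K) = x" "\<phi> (Sup K) = y" using IS r by (auto simp: \<phi>_def)
  have "measure lebesgue ({0..r} - {0,r}) = measure lebesgue {0..r}"
    by (intro measure_Diff_null_set) (auto simp: negligible_iff_null_sets[symmetric])
  then show "measure lebesgue ({Inf K..Sup K} - K) = r"
    using IS r by (simp add: K_def)
qed

lemma dist_cf_greatest:
  assumes "x \<in> M" "y \<in> M"
    and "\<And>K \<phi>. curve_fragment1 M d K \<phi> \<Longrightarrow> \<phi> (Inf K) = x \<Longrightarrow> \<phi> (Sup K) = y \<Longrightarrow>
      c \<le> measure lebesgue ({Inf K..Sup K} - K)"
  shows "c \<le> dist_cf M d x y"
  unfolding dist_cf_def
proof (rule cInf_greatest)
  show "{measure lebesgue ({Inf K..Sup K} - K) |K \<phi>. curve_fragment1 M d K \<phi> \<and> \<phi> (Inf K) = x \<and> \<phi> (Sup K) = y} \<noteq> {}"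
    using dist_fragment[OF assms(1,2), of "d x y + 1"] by auto
qed (use assms(3) in auto)

lemma dist_cf_nonneg: "x \<in> M \<Longrightarrow> y \<in> M \<Longrightarrow> 0 \<le> dist_cf M d x y"
  by (rule dist_cf_greatest) auto

lemma dist_cf_le_dist:
  assumes "x \<in> M" "y \<in> M"
  shows "dist_cf M d x y \<le> d x y"
proof (rule dense_ge)
  fix r assume r: "d x y < r"
  show "dist_cf M d x y \<le> r"
    using dist_cf_le[OF dist_fragment(1)[OF assms r]] unfolding dist_fragment(2-4)[OF assms r] .
qed

lemma dist_cf_Lipschitz:
  assumes "x \<in> M" "y \<in> M" and C: "C > 0"
    and f: "\<And>x. x \<in> M \<Longrightarrow> f x \<in> N" "\<And>x y. x \<in> M \<Longrightarrow> y \<in> M \<Longrightarrow> e (f x) (f y) \<le> C * d x y"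
  shows "dist_cf N e (f x) (f y) \<le> C * dist_cf M d x y"
proof -
  have "dist_cf N e (f x) (f y) / C \<le> dist_cf M d x y"
  proof (rule dist_cf_greatest[OF assms(1,2)])
    fix K \<phi> assume \<phi>: "curve_fragment1 M d K \<phi>" "\<phi> (Inf K) = x" "\<phi> (Sup K) = y"
    let ?K = "(\<lambda>t. C * t + 0) ` K"
    have a: "curve_fragment1 N e ?K (\<lambda>s. f (\<phi> ((s - 0) / C)))"
      "Inf ?K = C * Inf K + 0" "Sup ?K = C * Sup K + 0"
      "measure lebesgue ({C * Inf K + 0..C * Sup K + 0} - ?K) = C * measure lebesgue ({Inf K..Sup K} - K)"
      by (rule curve_fragment1_affine[where e = e and N = N and f = f, OF \<phi>(1) C f]; assumption)+
    have "dist_cf N e (f (\<phi> (((C * Inf K + 0) - 0) / C))) (f (\<phi> (((C * Sup K + 0) - 0) / C))) \<le>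
        C * measure lebesgue ({Inf K..Sup K} - K)"
      using dist_cf_le[OF a(1)] unfolding a(2) a(3) a(4) .
    then show "dist_cf N e (f x) (f y) / C \<le> measure lebesgue ({Inf K..Sup K} - K)"
      using \<phi>(2,3) C by (simp add: divide_le_eq mult.commute)
  qed
  then show ?thesis using C by (simp add: field_simps)
qed

lemma dist_cf_commute_le:
  assumes "x \<in> M" "y \<in> M"
  shows "dist_cf M d y x \<le> dist_cf M d x y"
proof (rule dist_cf_greatest[OF assms])
  fix K \<phi> assume \<phi>: "curve_fragment1 M d K \<phi>" "\<phi> (Inf K) = x" "\<phi> (Sup K) = y"
  note b = curve_fragment1_bounds[OF \<phi>(1)]
  have frag: "curve_fragment1 M d (uminus ` K) (\<lambda>t. \<phi> (- t))"
    using \<phi>(1) unfolding curve_fragment1_def by (auto simp: compact_negations abs_minus_commute)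
  have IS: "Inf (uminus ` K) = - Sup K" "Sup (uminus ` K) = - Inf K"
    using b by (auto intro!: cInf_eq_minimum cSup_eq_maximum)
  have "{- Sup K..- Inf K} - uminus ` K = (\<lambda>t. (- 1) *\<^sub>R t + 0) ` ({Inf K..Sup K} - K)"
    by (auto simp: image_iff) (metis DiffI atLeastAtMost_iff minus_le_iff le_minus_iff minus_minus)
  then have "measure lebesgue ({- Sup K..- Inf K} - uminus ` K) = measure lebesgue ({Inf K..Sup K} - K)"
    using measure_lebesgue_affine[of "-1" 0 "{Inf K..Sup K} - K"] by simp
  then show "dist_cf M d y x \<le> measure lebesgue ({Inf K..Sup K} - K)"
    using dist_cf_le[OF frag] unfolding IS using \<phi>(2,3) by simp
qed

lemma fragment_concat:
  assumes \<phi>: "curve_fragment1 M d K \<phi>" and \<psi>: "curve_fragment1 M d L \<psi>"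
    and joint: "Sup K = Inf L" "\<phi> (Sup K) = \<psi> (Inf L)"
  defines "\<eta> \<equiv> \<lambda>t. if t \<le> Sup K then \<phi> t else \<psi> t"
  shows "curve_fragment1 M d (K \<union> L) \<eta>" "Inf (K \<union> L) = Inf K" "Sup (K \<union> L) = Sup L"
    "\<eta> (Inf K) = \<phi> (Inf K)" "\<eta> (Sup L) = \<psi> (Sup L)"
    "measure lebesgue ({Inf K..Sup L} - (K \<union> L)) \<le>
      measure lebesgue ({Inf K..Sup K} - K) + measure lebesgue ({Inf L..Sup L} - L)"
proof -
  note b = curve_fragment1_bounds[OF \<phi>] and b' = curve_fragment1_bounds[OF \<psi>]
  have *: "\<eta> t = \<phi> t" "\<phi> t \<in> M" if "t \<in> K" for t
    using b(4)[OF that] \<phi> that by (auto simp: \<eta>_def curve_fragment1_def)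
  have **: "\<eta> t = \<psi> t" "\<psi> t \<in> M" if "t \<in> L" for t
    using b'(3)[OF that] \<psi> that joint by (auto simp: \<eta>_def curve_fragment1_def)
  have cross: "d (\<phi> s) (\<psi> t) \<le> \<bar>s - t\<bar>" if "s \<in> K" "t \<in> L" for s t
  proof -
    have "d (\<phi> s) (\<psi> t) \<le> d (\<phi> s) (\<phi> (Sup K)) + d (\<psi> (Inf L)) (\<psi> t)"
      using dist_triangle[of "\<phi> s" "\<phi> (Sup K)" "\<psi> t"] joint(2) *(2)[OF that(1)] **(2)[OF that(2)]
        *(2)[OF b(2)] by simp
    also have "\<dots> \<le> \<bar>s - Sup K\<bar> + \<bar>Inf L - t\<bar>"
      using \<phi> \<psi> that b(2) b'(1) unfolding curve_fragment1_def by (intro add_mono) auto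
    also have "\<dots> = \<bar>s - t\<bar>" using b(4)[OF that(1)] b'(3)[OF that(2)] joint(1) by simp
    finally show ?thesis .
  qed
  show "curve_fragment1 M d (K \<union> L) \<eta>" unfolding curve_fragment1_def
  proof (intro conjI ballI)
    show "compact (K \<union> L)" "K \<union> L \<noteq> {}"
      using \<phi> \<psi> by (auto simp: curve_fragment1_def intro: compact_Un)
    show "\<eta> \<in> K \<union> L \<rightarrow> M" using * ** by auto
    fix s t assume "s \<in> K \<union> L" "t \<in> K \<union> L"
    then consider "s \<in> K" "t \<in> K" | "s \<in> L" "t \<in> L" | "s \<in> K" "t \<in> L" | "s \<in> L" "t \<in> K" by blast
    then show "d (\<eta> s) (\<eta> t) \<le> \<bar>s - t\<bar>"
    proof cases
      case 4
      then show ?thesis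
        using cross[of t s] * ** dist_commute by (simp add: abs_minus_commute)
    qed (use * ** \<phi> \<psi> cross in \<open>auto simp: curve_fragment1_def\<close>)
  qed
  have le: "Inf K \<le> Sup K" "Inf L \<le> Sup L" using b b' by auto
  show "Inf (K \<union> L) = Inf K"
    using b b' joint le by (intro cInf_eq_minimum) (auto, force)
  show "Sup (K \<union> L) = Sup L"
    using b b' joint le by (intro cSup_eq_maximum) (auto, force)
  show "\<eta> (Inf K) = \<phi> (Inf K)" "\<eta> (Sup L) = \<psi> (Sup L)" using * ** b b' by auto
  have c: "compact K" "compact L" using \<phi> \<psi> by (auto simp: curve_fragment1_def)
  have "measure lebesgue ({Inf K..Sup L} - (K \<union> L)) \<le>
      measure lebesgue (({Inf K..Sup K} - K) \<union> ({Inf L..Sup L} - L))"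
  proof (rule measure_mono_fmeasurable)
    show "{Inf K..Sup L} - (K \<union> L) \<subseteq> ({Inf K..Sup K} - K) \<union> ({Inf L..Sup L} - L)"
      using joint(1) by auto
  qed (use c in \<open>auto intro!: gaps_lmeasurable fmeasurable.Un fmeasurableD[OF gaps_lmeasurable] compact_Un\<close>)
  also have "\<dots> \<le> measure lebesgue ({Inf K..Sup K} - K) + measure lebesgue ({Inf L..Sup L} - L)"
    by (intro measure_Un_le fmeasurableD gaps_lmeasurable c)
  finally show "measure lebesgue ({Inf K..Sup L} - (K \<union> L)) \<le>
      measure lebesgue ({Inf K..Sup K} - K) + measure lebesgue ({Inf L..Sup L} - L)" .
qed

lemma dist_cf_triangle:
  assumes "x \<in> M" "y \<in> M" "z \<in> M"
  shows "dist_cf M d x z \<le> dist_cf M d x y + dist_cf M d y z"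
proof -
  have "dist_cf M d x z - measure lebesgue ({Inf K..Sup K} - K) \<le> dist_cf M d y z"
    if \<phi>: "curve_fragment1 M d K \<phi>" "\<phi> (Inf K) = x" "\<phi> (Sup K) = y" for K \<phi>
  proof (rule dist_cf_greatest[OF assms(2,3)])
    fix L \<psi> assume \<psi>: "curve_fragment1 M d L \<psi>" "\<psi> (Inf L) = y" "\<psi> (Sup L) = z"
    let ?c = "Sup K - Inf L"
    let ?L = "(\<lambda>t. 1 * t + ?c) ` L" and ?\<psi> = "\<lambda>s. \<psi> ((s - ?c) / 1)"
    have *: "curve_fragment1 M d ?L ?\<psi>" "Inf ?L = Sup K" "Sup ?L = Sup L + ?c"
      "measure lebesgue ({Sup K..Sup L + ?c} - ?L) = measure lebesgue ({Inf L..Sup L} - L)"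
      using curve_fragment1_affine[where c = ?c and m = 1 and e = d and f = "\<lambda>x. x" and N = M, OF \<psi>(1)] by simp_all
    have j: "Sup K = Inf ?L" "\<phi> (Sup K) = ?\<psi> (Inf ?L)" unfolding *(2) using \<phi> \<psi> by simp_all
    note c = fragment_concat[OF \<phi>(1) *(1) j]
    have "dist_cf M d x z \<le> measure lebesgue ({Inf K..Sup ?L} - (K \<union> ?L))"
      using dist_cf_le[OF c(1)] unfolding c(2,3) c(4) c(5) unfolding *(3) using \<phi>(2) \<psi>(3) by simp
    also have "\<dots> \<le> measure lebesgue ({Inf K..Sup K} - K) + measure lebesgue ({Inf L..Sup L} - L)"
      using c(6) unfolding *(2,3) *(4) .
    finally show "dist_cf M d x z - measure lebesgue ({Inf K..Sup K} - K) \<le> measure lebesgue ({Inf L..Sup L} - L)"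
      by simp
  qed
  then have "dist_cf M d x z - dist_cf M d y z \<le> dist_cf M d x y"
    by (intro dist_cf_greatest[OF assms(1,2)]) (force simp: algebra_simps)
  then show ?thesis by simp
qed

lemma pseudometric_dist_cf: "pseudometric M (dist_cf M d)"
proof
  fix x y z assume *: "x \<in> M"
  show "dist_cf M d x x = 0"
    using dist_cf_le_dist[OF * *] dist_cf_nonneg[OF * *] * by simp
  assume "y \<in> M"
  with * show "dist_cf M d x y = dist_cf M d y x" by (intro antisym dist_cf_commute_le)
qed (rule dist_cf_triangle)

end

text \<open>\<open>f\<close> may identify points at distance \<open>0\<close>. A chosen right
  inverse preserves distances too, and the composite \<open>?g (f z)\<close> is at distance
  \<open>0\<close> from \<open>z\<close>, so Lipschitz comparison works in both directions.\<close>

lemma dist_cf_isometry: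
  assumes "pseudometric M d" "pseudometric N e" and f: "f ` M = N"
    and iso: "\<And>x y. x \<in> M \<Longrightarrow> y \<in> M \<Longrightarrow> e (f x) (f y) = d x y"
    and xy: "x \<in> M" "y \<in> M"
  shows "dist_cf N e (f x) (f y) = dist_cf M d x y"
proof (rule antisym)
  interpret M: pseudometric M d by fact
  interpret N: pseudometric N e by fact
  interpret cf: pseudometric M "dist_cf M d" by (rule M.pseudometric_dist_cf)
  show "dist_cf N e (f x) (f y) \<le> dist_cf M d x y"
    using M.dist_cf_Lipschitz[OF xy, of 1 f N e] f iso by auto
  let ?g = "inv_into M f"
  have g: "?g z \<in> M" "f (?g z) = z" if "z \<in> N" for z
    using that f inv_into_into f_inv_into_f by metis+
  have zero: "dist_cf M d z (?g (f z)) = 0" if "z \<in> M" for z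
  proof -
    have *: "f z \<in> N" using f that by blast
    have "d z (?g (f z)) = e (f z) (f (?g (f z)))" using iso g(1)[OF *] that by simp
    then have "d z (?g (f z)) = 0" using g(2)[OF *] * by simp
    then show ?thesis using M.dist_cf_le_dist[of z "?g (f z)"] cf.dist_nonneg[of z "?g (f z)"] that g(1)[OF *]
      by simp
  qed
  have fxy: "f x \<in> N" "f y \<in> N" using f xy by auto
  have "dist_cf M d x y = dist_cf M d (?g (f x)) (?g (f y))"
    using cf.dist_cong[of x "?g (f x)" y "?g (f y)"] zero xy g fxy by auto
  also have "\<dots> \<le> 1 * dist_cf N e (f x) (f y)"
  proof (rule N.dist_cf_Lipschitz)
    show "d (?g u) (?g v) \<le> 1 * e u v" if "u \<in> N" "v \<in> N" for u v
      using iso[of "?g u" "?g v"] g that by simp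
  qed (use g fxy in auto)
  finally show "dist_cf M d x y \<le> dist_cf N e (f x) (f y)" by simp
qed

section \<open>Quotients and the transfinite iterates\<close>

lemma
  assumes "pseudometric M D"
  shows pseudometric_quot: "pseudometric (pm_quot M D) (pm_quot_dist D)"
    and pm_quot_dist_class: "x \<in> M \<Longrightarrow> y \<in> M \<Longrightarrow> pm_quot_dist D (pm_class M D x) (pm_class M D y) = D x y"
proof -
  interpret pseudometric M D by fact
  have rep: "(SOME y. y \<in> pm_class M D x) \<in> M \<and> D x (SOME y. y \<in> pm_class M D x) = 0" if "x \<in> M" for x
    using someI[of "\<lambda>y. y \<in> pm_class M D x" x] that by (simp add: pm_class_def)
  show *: "pm_quot_dist D (pm_class M D x) (pm_class M D y) = D x y" if "x \<in> M" "y \<in> M" for x y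
    unfolding pm_quot_dist_def using dist_cong[of x _ y] rep that by metis
  show "pseudometric (pm_quot M D) (pm_quot_dist D)"
    by standard (auto simp: pm_quot_def * dist_commute dist_triangle)
qed

text \<open>The class map is distance preserving and onto, so the curve-flat distance of the
  quotient can be computed on \<open>M\<close> itself.\<close>

lemma iter_cf_osuc_pseudometric:
  assumes "pseudometric M (iter_cf M d \<alpha>)" "x \<in> M" "y \<in> M"
  shows "iter_cf M d (osuc \<alpha>) x y = dist_cf M (iter_cf M d \<alpha>) x y"
  unfolding iter_cf_osuc
  by (rule dist_cf_isometry[OF assms(1) pseudometric_quot[OF assms(1)] _ _ assms(2,3)])
    (auto simp: pm_quot_def pm_quot_dist_class[OF assms(1)])

lemma ordinal_cases:
  obtains "\<alpha> = 0" | \<beta> where "\<alpha> = osuc \<beta>" | "limit_ordinal \<alpha>"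
  unfolding limit_ordinal_def by blast

lemma ordinal_induct [case_names zero osuc limit]:
  assumes "P 0" "\<And>\<beta>. P \<beta> \<Longrightarrow> P (osuc \<beta>)"
    "\<And>\<beta>. limit_ordinal \<beta> \<Longrightarrow> (\<And>\<gamma>. \<gamma> < \<beta> \<Longrightarrow> P \<gamma>) \<Longrightarrow> P \<beta>"
  shows "P (\<alpha> :: countable_ordinal)"
proof (induction \<alpha> rule: less_induct)
  case (less \<alpha>)
  then show ?case using assms less_osuc by (cases rule: ordinal_cases[of \<alpha>]) auto
qed

lemma osuc_le_iff: "osuc \<beta> \<le> \<alpha> \<longleftrightarrow> \<beta> < \<alpha>"
  by (metis leD less_osuc_iff not_le_imp_less)

lemma limit_ordinal_pos: "limit_ordinal \<alpha> \<Longrightarrow> 0 < \<alpha>"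
  using countable_ordinal_zero_le[of \<alpha>] by (auto simp: limit_ordinal_def order.strict_iff_order)

text \<open>The two claims need each other: at a limit the triangle inequality compares stages
  \<open>\<beta>\<close> and \<open>\<gamma>\<close> at their maximum, by monotonicity; at a
  successor monotonicity uses that the previous stage is a pseudometric.\<close>

lemma iter_cf_props:
  assumes "pseudometric M d"
  shows "pseudometric M (iter_cf M d \<alpha>) \<and>
    (\<forall>\<beta>\<le>\<alpha>. \<forall>x\<in>M. \<forall>y\<in>M. iter_cf M d \<alpha> x y \<le> iter_cf M d \<beta> x y)"
proof (induction \<alpha> rule: ordinal_induct)
  case zero
  have "\<beta> \<le> 0 \<Longrightarrow> \<beta> = 0" for \<beta> :: countable_ordinal
    using countable_ordinal_zero_le[of \<beta>] by simp
  then show ?case using assms by (metis iter_cf_zero order_refl)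
next
  case (osuc \<alpha>)
  then interpret D: pseudometric M "iter_cf M d \<alpha>" by simp
  interpret cf: pseudometric M "dist_cf M (iter_cf M d \<alpha>)" by (rule D.pseudometric_dist_cf)
  have eq: "iter_cf M d (osuc \<alpha>) x y = dist_cf M (iter_cf M d \<alpha>) x y" if "x \<in> M" "y \<in> M" for x y
    using iter_cf_osuc_pseudometric[OF D.pseudometric_axioms that] .
  have "pseudometric M (iter_cf M d (osuc \<alpha>))"
    by standard (auto simp: eq cf.dist_commute cf.dist_triangle)
  moreover have "iter_cf M d (osuc \<alpha>) x y \<le> iter_cf M d \<beta> x y" if "\<beta> \<le> osuc \<alpha>" "x \<in> M" "y \<in> M" for \<beta> x y
  proof (cases "\<beta> = osuc \<alpha>")
    case False
    then have "\<beta> \<le> \<alpha>" using that less_osuc_iff order.not_eq_order_implies_strict by blast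
    then show ?thesis using osuc that eq D.dist_cf_le_dist by (metis order_trans)
  qed simp
  ultimately show ?case by blast
next
  case (limit \<alpha>)
  then have "0 < \<alpha>" by (rule_tac limit_ordinal_pos)
  then have ne: "{..<\<alpha>} \<noteq> {}" by blast
  have eq: "iter_cf M d \<alpha> x y = (INF \<beta>\<in>{..<\<alpha>}. iter_cf M d \<beta> x y)" for x y
    using limit by (simp add: iter_cf_limit)
  have pm: "pseudometric M (iter_cf M d \<beta>)" if "\<beta> < \<alpha>" for \<beta> using limit that by blast
  have bdd: "bdd_below ((\<lambda>\<beta>. iter_cf M d \<beta> x y) ` {..<\<alpha>})" if "x \<in> M" "y \<in> M" for x y
    using pseudometric.dist_nonneg[OF pm] that by (intro bdd_belowI2[of _ 0]) auto
  have le: "iter_cf M d \<alpha> x y \<le> iter_cf M d \<beta> x y" if "\<beta> < \<alpha>" "x \<in> M" "y \<in> M" for \<beta> x y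
    unfolding eq using that by (intro cINF_lower bdd) auto
  have "pseudometric M (iter_cf M d \<alpha>)"
  proof
    fix x assume x: "x \<in> M"
    show "iter_cf M d \<alpha> x x = 0"
      unfolding eq using pseudometric.dist_self[OF pm x] ne by simp
    fix y assume y: "y \<in> M"
    show "iter_cf M d \<alpha> x y = iter_cf M d \<alpha> y x"
      unfolding eq using pseudometric.dist_commute[OF pm x y] by (intro INF_cong) auto
    fix z assume z: "z \<in> M"
    have "iter_cf M d \<alpha> x z - iter_cf M d \<beta> x y \<le> iter_cf M d \<gamma> y z" if "\<beta> < \<alpha>" "\<gamma> < \<alpha>" for \<beta> \<gamma>
    proof -
      let ?\<delta> = "max \<beta> \<gamma>"
      have "?\<delta> < \<alpha>" using that by simp
      then have "iter_cf M d \<alpha> x z \<le> iter_cf M d ?\<delta> x y + iter_cf M d ?\<delta> y z"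
        using le[of ?\<delta> x z] pseudometric.dist_triangle[OF pm x y z, of ?\<delta>] x z by simp
      also have "\<dots> \<le> iter_cf M d \<beta> x y + iter_cf M d \<gamma> y z"
        using limit(2)[OF \<open>?\<delta> < \<alpha>\<close>] x y z by (intro add_mono) auto
      finally show ?thesis by simp
    qed
    then have "iter_cf M d \<alpha> x z - iter_cf M d \<beta> x y \<le> iter_cf M d \<alpha> y z" if "\<beta> < \<alpha>" for \<beta>
      unfolding eq[of y z] using ne that by (intro cINF_greatest) auto
    then have "iter_cf M d \<alpha> x z - iter_cf M d \<alpha> y z \<le> iter_cf M d \<alpha> x y"
      unfolding eq[of x y] using ne by (intro cINF_greatest) (auto simp: algebra_simps)
    then show "iter_cf M d \<alpha> x z \<le> iter_cf M d \<alpha> x y + iter_cf M d \<alpha> y z" by simp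
  qed
  then show ?case using le by (auto simp: order.order_iff_strict)
qed

lemma pseudometric_iter_cf: "pseudometric M d \<Longrightarrow> pseudometric M (iter_cf M d \<alpha>)"
  using iter_cf_props by blast

lemma iter_cf_antimono:
  "pseudometric M d \<Longrightarrow> \<beta> \<le> \<alpha> \<Longrightarrow> x \<in> M \<Longrightarrow> y \<in> M \<Longrightarrow> iter_cf M d \<alpha> x y \<le> iter_cf M d \<beta> x y"
  using iter_cf_props by blast

lemma iter_cf_le_dist:
  "pseudometric M d \<Longrightarrow> x \<in> M \<Longrightarrow> y \<in> M \<Longrightarrow> iter_cf M d \<alpha> x y \<le> d x y"
  using iter_cf_antimono[OF _ countable_ordinal_zero_le] by (metis iter_cf_zero)

lemma iter_cf_osuc':
  "pseudometric M d \<Longrightarrow> x \<in> M \<Longrightarrow> y \<in> M \<Longrightarrow> iter_cf M d (osuc \<alpha>) x y = dist_cf M (iter_cf M d \<alpha>) x y"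
  by (intro iter_cf_osuc_pseudometric pseudometric_iter_cf)

lemma iter_cf_limit_greatest:
  assumes "limit_ordinal \<alpha>" "\<And>\<beta>. \<beta> < \<alpha> \<Longrightarrow> c \<le> iter_cf M d \<beta> x y"
  shows "c \<le> iter_cf M d \<alpha> x y"
  unfolding iter_cf_limit[OF assms(1)] using limit_ordinal_pos[OF assms(1)] assms(2)
  by (intro cINF_greatest) auto

text \<open>Each successor step and each infimum preserves the constant \<open>C\<close>, so it does
  not accumulate along the ordinals.\<close>

lemma iter_cf_Lipschitz:
  assumes "pseudometric M d" "pseudometric N e" "C > 0"
    and f: "\<And>x. x \<in> M \<Longrightarrow> f x \<in> N" "\<And>x y. x \<in> M \<Longrightarrow> y \<in> M \<Longrightarrow> e (f x) (f y) \<le> C * d x y"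
    and xy: "x \<in> M" "y \<in> M"
  shows "iter_cf N e \<alpha> (f x) (f y) \<le> C * iter_cf M d \<alpha> x y"
  using xy
proof (induction \<alpha> arbitrary: x y rule: ordinal_induct)
  case zero
  then show ?case using f by (simp add: iter_cf_zero)
next
  case (osuc \<beta>)
  interpret pseudometric M "iter_cf M d \<beta>" using assms pseudometric_iter_cf by blast
  show ?case using dist_cf_Lipschitz[OF osuc(2,3) assms(3), of f N "iter_cf N e \<beta>"] osuc f assms
    by (simp add: iter_cf_osuc')
next
  case (limit \<beta>)
  have "iter_cf N e \<beta> (f x) (f y) / C \<le> iter_cf M d \<beta> x y"
  proof (rule iter_cf_limit_greatest[OF limit(1)])
    fix \<gamma> assume "\<gamma> < \<beta>"
    then have "iter_cf N e \<beta> (f x) (f y) \<le> iter_cf N e \<gamma> (f x) (f y)"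
      using assms limit by (intro iter_cf_antimono) auto
    also have "\<dots> \<le> C * iter_cf M d \<gamma> x y" using limit \<open>\<gamma> < \<beta>\<close> by blast
    finally show "iter_cf N e \<beta> (f x) (f y) / C \<le> iter_cf M d \<gamma> x y"
      using assms(3) by (simp add: field_simps)
  qed
  then show ?case using assms(3) by (simp add: field_simps)
qed

section \<open>Lower bounds for \<open>dist_cf\<close> from null images\<close>

definition fragment_null :: "'a set \<Rightarrow> ('a \<Rightarrow> 'a \<Rightarrow> real) \<Rightarrow> ('a \<Rightarrow> real) \<Rightarrow> bool" where
  "fragment_null M d g \<longleftrightarrow> (\<forall>K \<phi>. curve_fragment1 M d K \<phi> \<longrightarrow> negligible ((\<lambda>t. g (\<phi> t)) ` K))"

context pseudometric
begin

lemma fragment_null_imp_dist_cf: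
  assumes g: "\<And>x y. x \<in> M \<Longrightarrow> y \<in> M \<Longrightarrow> \<bar>g x - g y\<bar> \<le> d x y" and null: "fragment_null M d g"
    and xy: "x \<in> M" "y \<in> M"
  shows "\<bar>g x - g y\<bar> \<le> dist_cf M d x y"
proof -
  interpret cf: pseudometric M "dist_cf M d" by (rule pseudometric_dist_cf)
  have *: "g y - g x \<le> dist_cf M d x y" if xy: "x \<in> M" "y \<in> M" for x y
  proof (rule dist_cf_greatest[OF xy])
    fix K \<phi> assume \<phi>: "curve_fragment1 M d K \<phi>" "\<phi> (Inf K) = x" "\<phi> (Sup K) = y"
    have "\<bar>g (\<phi> s) - g (\<phi> t)\<bar> \<le> \<bar>s - t\<bar>" if "s \<in> K" "t \<in> K" for s t
      using g[of "\<phi> s" "\<phi> t"] \<phi>(1) that by (fastforce simp: curve_fragment1_def Pi_iff)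
    then show "g y - g x \<le> measure lebesgue ({Inf K..Sup K} - K)"
      using increment_le_gaps[of K "\<lambda>t. g (\<phi> t)"] null \<phi>
      by (auto simp: curve_fragment1_def fragment_null_def)
  qed
  show ?thesis using *[OF xy] *[OF xy(2,1)] cf.dist_commute[OF xy] by simp
qed

text \<open>Restricting a fragment to \<open>{s..t}\<close> bounds the
  \<open>dist_cf\<close>-distance of its values at \<open>s\<close> and \<open>t\<close> by the gaps
  in between, so \<open>negligible_image_gap_Lipschitz\<close> applies. In this way a Lipschitz
  bound known at a later stage yields null images at the stage before.\<close>

lemma dist_cf_imp_fragment_null:
  assumes C: "C \<ge> 0" and g: "\<And>x y. x \<in> M \<Longrightarrow> y \<in> M \<Longrightarrow> \<bar>g x - g y\<bar> \<le> C * dist_cf M d x y"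
  shows "fragment_null M d g"
  unfolding fragment_null_def
proof (intro allI impI)
  fix K \<phi> assume \<phi>: "curve_fragment1 M d K \<phi>"
  then have K: "compact K" by (simp add: curve_fragment1_def)
  show "negligible ((\<lambda>t. g (\<phi> t)) ` K)"
  proof (rule negligible_image_gap_Lipschitz[OF K C])
    fix s t assume st: "s \<in> K" "t \<in> K" "s \<le> t"
    let ?L = "K \<inter> {s..t}"
    have IS: "Inf ?L = s" "Sup ?L = t" using st by (auto intro!: cInf_eq_minimum cSup_eq_maximum)
    have "curve_fragment1 M d ?L \<phi>"
      using \<phi> st by (auto simp: curve_fragment1_def intro: compact_Int_closed)
    then have "dist_cf M d (\<phi> s) (\<phi> t) \<le> measure lebesgue ({s..t} - ?L)"
      using dist_cf_le[of M d ?L \<phi>] unfolding IS by blast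
    moreover have "{s..t} - ?L = {s..t} - K" by auto
    ultimately have "C * dist_cf M d (\<phi> s) (\<phi> t) \<le> C * measure lebesgue ({s..t} - K)"
      using C mult_left_mono by metis
    moreover have "\<phi> s \<in> M" "\<phi> t \<in> M" using \<phi> st by (auto simp: curve_fragment1_def)
    ultimately show "\<bar>g (\<phi> s) - g (\<phi> t)\<bar> \<le> C * measure lebesgue ({s..t} - K)"
      using g order_trans by blast
  qed
qed

end

section \<open>Compactness, embeddings and realizations\<close>

text \<open>Sequential compactness in a form that makes sense for pseudometrics; limits are unique
  only up to distance \<open>0\<close>.\<close>

definition pm_compact :: "'a set \<Rightarrow> ('a \<Rightarrow> 'a \<Rightarrow> real) \<Rightarrow> bool" where
  "pm_compact M d \<longleftrightarrow>
    (\<forall>\<sigma>. range \<sigma> \<subseteq> M \<longrightarrow> (\<exists>l\<in>M. \<exists>r::nat \<Rightarrow> nat. strict_mono r \<and> (\<lambda>k. d (\<sigma> (r k)) l) \<longlonglongrightarrow> 0))"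

lemma (in Metric_space) compact_space_iff_pm_compact:
  "compact_space mtopology \<longleftrightarrow> pm_compact M d"
proof -
  have "limitin mtopology (\<sigma> \<circ> r) l sequentially \<longleftrightarrow> l \<in> M \<and> (\<lambda>k. d (\<sigma> (r k)) l) \<longlonglongrightarrow> 0"
    if "range \<sigma> \<subseteq> M" for \<sigma> l and r :: "nat \<Rightarrow> nat"
    using that by (auto simp: limitin_metric_dist_null o_def image_subset_iff)
  then show ?thesis
    unfolding compact_space_def topspace_mtopology compactin_sequentially pm_compact_def by blast
qed

lemma pm_compactE:
  fixes \<sigma> :: "nat \<Rightarrow> 'a"
  assumes "pm_compact M d" "\<And>n. \<sigma> n \<in> M"
  obtains l r where "l \<in> M" "strict_mono (r :: nat \<Rightarrow> nat)" "(\<lambda>k. d (\<sigma> (r k)) l) \<longlonglongrightarrow> 0"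
  using assms unfolding pm_compact_def by (metis image_subsetI)

context pseudometric
begin

lemma totally_bounded:
  assumes "pm_compact M d" "e > 0"
  shows "\<exists>F. finite F \<and> F \<subseteq> M \<and> (\<forall>x\<in>M. \<exists>u\<in>F. d x u < e)"
proof (rule ccontr)
  assume nex: "\<not> ?thesis"
  have far: "\<exists>x\<in>M. \<forall>u\<in>F. \<not> d x u < e" if F: "finite F" "F \<subseteq> M" for F
  proof (rule ccontr)
    assume "\<not> ?thesis"
    then have "\<forall>x\<in>M. \<exists>u\<in>F. d x u < e" by simp
    with nex F show False by metis
  qed
  have "\<exists>\<sigma> :: nat \<Rightarrow> 'a. \<forall>n. \<sigma> n \<in> M \<and> (\<forall>i<n. \<not> d (\<sigma> n) (\<sigma> i) < e)"
  proof (rule dependent_wellorder_choice)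
    fix \<sigma> :: "nat \<Rightarrow> 'a" and n
    assume "\<And>i. i < n \<Longrightarrow> \<sigma> i \<in> M \<and> (\<forall>j<i. \<not> d (\<sigma> i) (\<sigma> j) < e)"
    then have "\<sigma> ` {..<n} \<subseteq> M" by auto
    then obtain x where "x \<in> M" "\<forall>u\<in>\<sigma> ` {..<n}. \<not> d x u < e"
      using far[of "\<sigma> ` {..<n}"] by auto
    then show "\<exists>x. x \<in> M \<and> (\<forall>i<n. \<not> d x (\<sigma> i) < e)" by auto
  qed simp
  then obtain \<sigma> :: "nat \<Rightarrow> 'a" where "\<forall>n. \<sigma> n \<in> M \<and> (\<forall>i<n. \<not> d (\<sigma> n) (\<sigma> i) < e)" ..
  then have \<sigma>: "\<sigma> n \<in> M" "i < n \<Longrightarrow> \<not> d (\<sigma> n) (\<sigma> i) < e" for n i by simp_all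
  obtain l r where lr: "l \<in> M" "strict_mono r" "(\<lambda>k. d (\<sigma> (r k)) l) \<longlonglongrightarrow> 0"
    using pm_compactE[where \<sigma> = \<sigma>, OF assms(1) \<sigma>(1)] .
  have "\<forall>\<^sub>F k in sequentially. d (\<sigma> (r k)) l < e / 2"
    using order_tendstoD(2)[OF lr(3), of "e / 2"] assms(2) by simp
  then obtain k where k: "\<And>j. j \<ge> k \<Longrightarrow> d (\<sigma> (r j)) l < e / 2"
    by (auto simp: eventually_sequentially)
  have "d (\<sigma> (r (Suc k))) (\<sigma> (r k)) < e"
    using dist_triangle[of "\<sigma> (r (Suc k))" l "\<sigma> (r k)"] dist_commute[of l "\<sigma> (r k)"] k[of k] k[of "Suc k"] \<sigma> lr
    by simp
  then show False using \<sigma>(2)[of "r k" "r (Suc k)"] lr(2) by (simp add: strict_mono_def)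
qed

lemma bounded_dist:
  assumes "pm_compact M d"
  obtains R where "R > 0" "\<And>x y. x \<in> M \<Longrightarrow> y \<in> M \<Longrightarrow> d x y \<le> R"
proof -
  obtain F where F: "finite F" "F \<subseteq> M" "\<And>x. x \<in> M \<Longrightarrow> \<exists>u\<in>F. d x u < 1"
    using totally_bounded[OF assms, of 1] by auto
  have "finite ((\<lambda>(u, v). d u v) ` (F \<times> F))" using F by simp
  then obtain B where B: "\<And>u v. u \<in> F \<Longrightarrow> v \<in> F \<Longrightarrow> d u v \<le> B"
    using bdd_above_finite unfolding bdd_above_def by fastforce
  show ?thesis
  proof
    show "\<bar>B\<bar> + 2 > 0" by simp
    fix x y assume xy: "x \<in> M" "y \<in> M"
    then obtain u v where uv: "u \<in> F" "v \<in> F" "d x u < 1" "d y v < 1" using F(3) by blast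
    then have "u \<in> M" "v \<in> M" using F by auto
    then show "d x y \<le> \<bar>B\<bar> + 2"
      using dist_triangle[of x u y] dist_triangle[of u v y] dist_commute[of v y] B[OF uv(1,2)] uv xy by simp
  qed
qed

lemma dense_sequence:
  assumes "pm_compact M d" "M \<noteq> {}"
  obtains z :: "nat \<Rightarrow> 'a" where "\<And>k. z k \<in> M" "\<And>x e. x \<in> M \<Longrightarrow> e > 0 \<Longrightarrow> \<exists>k. d x (z k) < e"
proof -
  have "\<forall>n. \<exists>F. finite F \<and> F \<subseteq> M \<and> (\<forall>x\<in>M. \<exists>u\<in>F. d x u < inverse (Suc n))"
    by (intro allI totally_bounded[OF assms(1)]) simp
  then obtain F where F: "\<And>n. finite (F n)" "\<And>n. F n \<subseteq> M" "\<And>n x. x \<in> M \<Longrightarrow> \<exists>u\<in>F n. d x u < inverse (Suc n)"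
    by metis
  let ?Z = "\<Union>n. F n"
  have "countable ?Z" by (intro countable_UN countableI_type countable_finite F(1))
  moreover have "?Z \<noteq> {}"
  proof -
    obtain x where "x \<in> M" using assms(2) by blast
    then show ?thesis using F(3)[of x 0] by blast
  qed
  ultimately have Z: "countable ?Z" "?Z \<noteq> {}" .
  show ?thesis
  proof
    show "from_nat_into ?Z k \<in> M" for k using from_nat_into[OF Z(2)] F(2) by blast
    fix x and e :: real assume "x \<in> M" "e > 0"
    then obtain n where "inverse (Suc n) < e" using reals_Archimedean by blast
    moreover obtain u where "u \<in> F n" "d x u < inverse (Suc n)" using F(3) \<open>x \<in> M\<close> by blast
    moreover obtain k where "from_nat_into ?Z k = u" using from_nat_into_surj[OF Z(1), of u] \<open>u \<in> F n\<close> by blast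
    ultimately show "\<exists>k. d x (from_nat_into ?Z k) < e" by (metis less_trans)
  qed
qed

text \<open>Points are encoded by their distances to a dense sequence; this also identifies points at
  distance \<open>0\<close>.\<close>

lemma embed_nat_real:
  assumes "pm_compact M d" "M \<noteq> {}"
  obtains N :: "(nat \<Rightarrow> real) set" and e f where "Metric_space N e" "f ` M = N"
    "\<And>x y. x \<in> M \<Longrightarrow> y \<in> M \<Longrightarrow> e (f x) (f y) = d x y"
proof -
  obtain z :: "nat \<Rightarrow> 'a" where z: "\<And>k. z k \<in> M" "\<And>x e. x \<in> M \<Longrightarrow> e > 0 \<Longrightarrow> \<exists>k. d x (z k) < e"
    using dense_sequence[OF assms] by blast
  define f where "f x = (\<lambda>k. d x (z k))" for x
  define g where "g = inv_into M f"
  \<comment> \<open>The value \<open>0\<close> outside the image serves the axioms of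
    \<open>Metric_space\<close> that range over the whole type: nonnegativity and symmetry.\<close>
  define e where "e u v = (if u \<in> f ` M \<and> v \<in> f ` M then d (g u) (g v) else 0)" for u v
  have f_eq: "f x = f y \<longleftrightarrow> d x y = 0" if xy: "x \<in> M" "y \<in> M" for x y
  proof
    assume eq: "f x = f y"
    have "d x y \<le> r" if "r > 0" for r
    proof -
      obtain k where "d x (z k) < r / 2" using z(2)[OF xy(1), of "r / 2"] \<open>r > 0\<close> by auto
      moreover from this have "d y (z k) < r / 2" using fun_cong[OF eq, of k] by (simp add: f_def)
      ultimately show ?thesis using dist_triangle[of x "z k" y] dist_commute[of y "z k"] xy z(1) by simp
    qed
    then have "d x y \<le> 0" by (rule dense_ge)
    then show "d x y = 0" using dist_nonneg[OF xy] by simp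
  next
    assume "d x y = 0"
    then show "f x = f y" unfolding f_def using dist_cong[of x y "z k" "z k" for k] xy z(1) by auto
  qed
  have g: "g (f x) \<in> M" "f (g (f x)) = f x" if "x \<in> M" for x
    unfolding g_def using that by (auto intro: inv_into_into f_inv_into_f)
  have iso: "e (f x) (f y) = d x y" if "x \<in> M" "y \<in> M" for x y
  proof -
    have "d (g (f x)) x = 0" "d (g (f y)) y = 0" using g that f_eq by blast+
    then show ?thesis using dist_cong[of "g (f x)" x "g (f y)" y] that g by (simp add: e_def)
  qed
  have "Metric_space (f ` M) e"
  proof
    show "0 \<le> e u v" for u v using g dist_nonneg by (auto simp: e_def)
    show "e u v = e v u" for u v using g dist_commute by (auto simp: e_def)
    show "e u v = 0 \<longleftrightarrow> u = v" if "u \<in> f ` M" "v \<in> f ` M" for u v using that iso f_eq by auto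
    show "e u w \<le> e u v + e v w" if "u \<in> f ` M" "v \<in> f ` M" "w \<in> f ` M" for u v w
      using that iso dist_triangle by auto
  qed
  then show ?thesis using that iso by blast
qed

end

lemma pm_compact_image:
  assumes "pm_compact M d" "f ` M = N" "C \<ge> 0"
    and lip: "\<And>x y. x \<in> M \<Longrightarrow> y \<in> M \<Longrightarrow> 0 \<le> e (f x) (f y) \<and> e (f x) (f y) \<le> C * d x y"
  shows "pm_compact N e"
  unfolding pm_compact_def
proof (intro allI impI)
  fix \<sigma> :: "nat \<Rightarrow> 'b" assume "range \<sigma> \<subseteq> N"
  then have "\<forall>n. \<exists>x\<in>M. f x = \<sigma> n" using assms(2) by (metis imageE rangeI subsetD)
  then obtain \<tau> where \<tau>: "\<And>n. \<tau> n \<in> M" "\<And>n. f (\<tau> n) = \<sigma> n" by metis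
  obtain l r where lr: "l \<in> M" "strict_mono r" "(\<lambda>k. d (\<tau> (r k)) l) \<longlonglongrightarrow> 0"
    using pm_compactE[where \<sigma> = \<tau>, OF assms(1) \<tau>(1)] .
  have "(\<lambda>k. C * d (\<tau> (r k)) l) \<longlonglongrightarrow> 0" using tendsto_mult_right_zero[OF lr(3)] .
  then have "(\<lambda>k. e (\<sigma> (r k)) (f l)) \<longlonglongrightarrow> 0"
    using lip[OF \<tau>(1) lr(1)] \<tau>(2) by (rule_tac tendsto_sandwich[OF _ _ tendsto_const]) auto
  then show "\<exists>l\<in>N. \<exists>r. strict_mono r \<and> (\<lambda>k. e (\<sigma> (r k)) l) \<longlonglongrightarrow> 0"
    using lr assms(2) by blast
qed

section \<open>Transfer of iterates, rectifiability and realizations\<close>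

lemma iter_cf_isometry:
  assumes "pseudometric M d" "pseudometric N e" and f: "f ` M = N"
    and iso: "\<And>x y. x \<in> M \<Longrightarrow> y \<in> M \<Longrightarrow> e (f x) (f y) = d x y"
    and xy: "x \<in> M" "y \<in> M"
  shows "iter_cf N e \<alpha> (f x) (f y) = iter_cf M d \<alpha> x y"
proof (rule antisym)
  interpret pseudometric M "iter_cf M d \<alpha>" using assms(1) by (rule pseudometric_iter_cf)
  show "iter_cf N e \<alpha> (f x) (f y) \<le> iter_cf M d \<alpha> x y"
    using iter_cf_Lipschitz[OF assms(1,2), of 1 f x y] f iso xy by auto
  let ?g = "inv_into M f"
  have g: "?g z \<in> M" "f (?g z) = z" if "z \<in> N" for z
    using that f inv_into_into f_inv_into_f by metis+
  have zero: "iter_cf M d \<alpha> z (?g (f z)) = 0" if "z \<in> M" for z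
  proof -
    have *: "f z \<in> N" using f that by blast
    have "d z (?g (f z)) = e (f z) (f (?g (f z)))" using iso g(1)[OF *] that by simp
    also have "\<dots> = 0" using g(2)[OF *] * pseudometric.dist_self[OF assms(2)] by simp
    finally show ?thesis using iter_cf_le_dist[OF assms(1), of z "?g (f z)" \<alpha>] dist_nonneg[of z "?g (f z)"] that g(1)[OF *]
      by simp
  qed
  have fxy: "f x \<in> N" "f y \<in> N" using f xy by auto
  have "iter_cf M d \<alpha> x y = iter_cf M d \<alpha> (?g (f x)) (?g (f y))"
    using dist_cong[of x "?g (f x)" y "?g (f y)"] zero xy g fxy by auto
  also have "\<dots> \<le> 1 * iter_cf N e \<alpha> (f x) (f y)"
  proof (rule iter_cf_Lipschitz[OF assms(2,1)])
    show "d (?g u) (?g v) \<le> 1 * e u v" if "u \<in> N" "v \<in> N" for u v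
      using iso[of "?g u" "?g v"] g that by simp
  qed (use g fxy in auto)
  finally show "iter_cf M d \<alpha> x y \<le> iter_cf N e \<alpha> (f x) (f y)" by simp
qed

lemma not_purely_1_unrectifiable_biLipschitz:
  assumes "\<not> purely_1_unrectifiable M d" and f: "\<And>x. x \<in> M \<Longrightarrow> f x \<in> N" and "c > 0" "C \<ge> 0"
    and bil: "\<And>x y. x \<in> M \<Longrightarrow> y \<in> M \<Longrightarrow> c * d x y \<le> e (f x) (f y) \<and> e (f x) (f y) \<le> C * d x y"
  shows "\<not> purely_1_unrectifiable N e"
proof -
  obtain A g c' C' where A: "A \<in> sets lebesgue" "emeasure lebesgue A > 0" and g: "g \<in> A \<rightarrow> M" "0 < c'"
    and bil': "\<And>s t. s \<in> A \<Longrightarrow> t \<in> A \<Longrightarrow> c' * \<bar>s - t\<bar> \<le> d (g s) (g t) \<and> d (g s) (g t) \<le> C' * \<bar>s - t\<bar>"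
    using assms(1) unfolding purely_1_unrectifiable_def by blast
  have "(c * c') * \<bar>s - t\<bar> \<le> e (f (g s)) (f (g t)) \<and> e (f (g s)) (f (g t)) \<le> (C * C') * \<bar>s - t\<bar>"
    if st: "s \<in> A" "t \<in> A" for s t
  proof
    have gst: "g s \<in> M" "g t \<in> M" using g st by auto
    have "c * (c' * \<bar>s - t\<bar>) \<le> c * d (g s) (g t)" using bil'[OF st] assms(3) by simp
    then show "(c * c') * \<bar>s - t\<bar> \<le> e (f (g s)) (f (g t))" using bil[OF gst] by simp
    have "C * d (g s) (g t) \<le> C * (C' * \<bar>s - t\<bar>)" using bil'[OF st] assms(4) mult_left_mono by blast
    then show "e (f (g s)) (f (g t)) \<le> (C * C') * \<bar>s - t\<bar>" using bil[OF gst] by simp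
  qed
  moreover have "(\<lambda>s. f (g s)) \<in> A \<rightarrow> N" "0 < c * c'" using f g assms(3) by auto
  ultimately show ?thesis using A unfolding purely_1_unrectifiable_def by blast
qed

text \<open>The form in which the theorem is proved by induction. \<open>\<pi>\<close> induces the
  inverse of the almost isometry: when \<open>d\<close> is a metric, the two bounds make its fibres
  the classes of stage \<open>\<alpha>\<close>. The lower bound holds with factor
  \<open>1\<close>.\<close>

definition cf_realizes :: "countable_ordinal \<Rightarrow> real \<Rightarrow> 'a set \<Rightarrow> ('a \<Rightarrow> 'a \<Rightarrow> real) \<Rightarrow>
    'b set \<Rightarrow> ('b \<Rightarrow> 'b \<Rightarrow> real) \<Rightarrow> ('b \<Rightarrow> 'a) \<Rightarrow> bool" where
  "cf_realizes \<alpha> \<epsilon> M d N \<rho> \<pi> \<longleftrightarrow> pseudometric N \<rho> \<and> pm_compact N \<rho> \<and>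
    (\<forall>\<beta><\<alpha>. \<not> purely_1_unrectifiable N (iter_cf N \<rho> \<beta>)) \<and> \<pi> ` N = M \<and>
    (\<forall>a\<in>N. \<forall>b\<in>N. d (\<pi> a) (\<pi> b) \<le> iter_cf N \<rho> \<alpha> a b \<and> iter_cf N \<rho> \<alpha> a b \<le> (1 + \<epsilon>) * d (\<pi> a) (\<pi> b))"

text \<open>The glued space lives in a sum type and carries only a pseudometric. Bringing it back to
  a metric space of sequences lets the induction on \<open>\<alpha>\<close> stay in one
  type.\<close>

lemma cf_realizes_embed:
  assumes real: "cf_realizes \<alpha> \<epsilon> M d N \<rho> \<pi>" and "M \<noteq> {}"
    and M: "Metric_space M d"
  obtains N' :: "(nat \<Rightarrow> real) set" and \<rho>' \<pi>' where "Metric_space N' \<rho>'" "cf_realizes \<alpha> \<epsilon> M d N' \<rho>' \<pi>'"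
proof -
  have N: "pseudometric N \<rho>" "pm_compact N \<rho>" "N \<noteq> {}"
    and rect: "\<And>\<beta>. \<beta> < \<alpha> \<Longrightarrow> \<not> purely_1_unrectifiable N (iter_cf N \<rho> \<beta>)" and onto: "\<pi> ` N = M"
    and near: "\<And>a b. a \<in> N \<Longrightarrow> b \<in> N \<Longrightarrow> d (\<pi> a) (\<pi> b) \<le> iter_cf N \<rho> \<alpha> a b \<and>
      iter_cf N \<rho> \<alpha> a b \<le> (1 + \<epsilon>) * d (\<pi> a) (\<pi> b)"
    using assms unfolding cf_realizes_def by blast+
  interpret pseudometric N \<rho> by fact
  obtain N' :: "(nat \<Rightarrow> real) set" and \<rho>' f where N': "Metric_space N' \<rho>'" "f ` N = N'"
    and iso: "\<And>x y. x \<in> N \<Longrightarrow> y \<in> N \<Longrightarrow> \<rho>' (f x) (f y) = \<rho> x y"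
    using embed_nat_real[OF N(2,3)] by blast
  have pm': "pseudometric N' \<rho>'" using N' Metric_space_pseudometric by blast
  have eq: "iter_cf N' \<rho>' \<beta> (f a) (f b) = iter_cf N \<rho> \<beta> a b" if "a \<in> N" "b \<in> N" for a b \<beta>
    by (rule iter_cf_isometry[OF N(1) pm' N'(2)]) (use iso that in auto)
  let ?g = "inv_into N f"
  have g: "?g u \<in> N" "f (?g u) = u" if "u \<in> N'" for u
    using that N'(2) inv_into_into f_inv_into_f by metis+
  have fN: "f a \<in> N'" if "a \<in> N" for a using N'(2) that by blast
  \<comment> \<open>\<open>\<pi>\<close> factors through \<open>f\<close>: points at
    \<open>\<rho>\<close>-distance \<open>0\<close> are also at distance \<open>0\<close> at stage
    \<open>\<alpha>\<close>, hence have images at \<open>d\<close>-distance \<open>0\<close> in the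
    metric space \<open>M\<close>.\<close>
  have rep: "\<pi> (?g (f a)) = \<pi> a" if a: "a \<in> N" for a
  proof -
    have ga: "?g (f a) \<in> N" "f (?g (f a)) = f a" using g[OF fN[OF a]] by auto
    then have "\<rho> (?g (f a)) a = 0" using iso[of "?g (f a)" a] iso[of a a] a by simp
    then have "iter_cf N \<rho> \<alpha> (?g (f a)) a \<le> 0" using iter_cf_le_dist[OF N(1) ga(1) a] by metis
    then have "d (\<pi> (?g (f a))) (\<pi> a) \<le> 0" using near[OF ga(1) a] by linarith
    moreover have "\<pi> (?g (f a)) \<in> M" "\<pi> a \<in> M" using onto ga(1) a by blast+
    ultimately show ?thesis using Metric_space.nonneg[OF M] Metric_space.zero[OF M] by (metis order_antisym)
  qed
  show ?thesis
  proof
    show "cf_realizes \<alpha> \<epsilon> M d N' \<rho>' (\<lambda>u. \<pi> (?g u))" unfolding cf_realizes_def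
    proof (intro conjI ballI allI impI)
      show "pm_compact N' \<rho>'"
        using pm_compact_image[OF N(2) N'(2), of 1 \<rho>'] iso dist_nonneg by simp
      show "\<not> purely_1_unrectifiable N' (iter_cf N' \<rho>' \<beta>)" if "\<beta> < \<alpha>" for \<beta>
        using not_purely_1_unrectifiable_biLipschitz[OF rect[OF that], of f N' 1 1 "iter_cf N' \<rho>' \<beta>"] eq fN by auto
      show "(\<lambda>u. \<pi> (?g u)) ` N' = M"
        unfolding N'(2)[symmetric] image_image onto[symmetric] by (intro image_cong refl rep)
      fix u v assume uv: "u \<in> N'" "v \<in> N'"
      have "iter_cf N' \<rho>' \<alpha> u v = iter_cf N \<rho> \<alpha> (?g u) (?g v)" using eq[of "?g u" "?g v"] g uv by simp
      then show "d (\<pi> (?g u)) (\<pi> (?g v)) \<le> iter_cf N' \<rho>' \<alpha> u v"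
        "iter_cf N' \<rho>' \<alpha> u v \<le> (1 + \<epsilon>) * d (\<pi> (?g u)) (\<pi> (?g v))"
        using near[of "?g u" "?g v"] g uv by simp_all
    qed (fact pm')
  qed (fact N'(1))
qed

lemma cf_realizes_retarget:
  assumes real: "cf_realizes \<alpha> \<epsilon> M' d' N \<rho> \<pi>" and f: "f ` M = M'" "inj_on f M"
    and iso: "\<And>x y. x \<in> M \<Longrightarrow> y \<in> M \<Longrightarrow> d' (f x) (f y) = d x y"
  shows "cf_realizes \<alpha> \<epsilon> M d N \<rho> (\<lambda>a. inv_into M f (\<pi> a))"
proof -
  have \<pi>: "\<pi> ` N = M'" using real by (simp add: cf_realizes_def)
  have g: "inv_into M f u \<in> M" "f (inv_into M f u) = u" if "u \<in> M'" for u
    using that f(1) inv_into_into f_inv_into_f by metis+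
  have "(\<lambda>a. inv_into M f (\<pi> a)) ` N = inv_into M f ` M'" using \<pi> by (simp flip: \<pi> add: image_image)
  also have "\<dots> = M" using f by (simp flip: f(1))
  finally have "(\<lambda>a. inv_into M f (\<pi> a)) ` N = M" .
  moreover have "d (inv_into M f (\<pi> a)) (inv_into M f (\<pi> b)) = d' (\<pi> a) (\<pi> b)" if "a \<in> N" "b \<in> N" for a b
    using iso[of "inv_into M f (\<pi> a)" "inv_into M f (\<pi> b)"] g that \<pi> by (metis imageI)
  ultimately show ?thesis using real unfolding cf_realizes_def by simp
qed

lemma purely_1_unrectifiable_quot:
  assumes "pseudometric M D" "\<not> purely_1_unrectifiable M D"
  shows "\<not> purely_1_unrectifiable (pm_quot M D) (pm_quot_dist D)"
  using not_purely_1_unrectifiable_biLipschitz[OF assms(2), of "pm_class M D" "pm_quot M D" 1 1 "pm_quot_dist D"]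
  by (simp add: pm_quot_dist_class[OF assms(1)]) (simp add: pm_quot_def)

text \<open>By \<open>near\<close>, stage \<open>\<alpha>\<close> identifies \<open>a\<close> and
  \<open>b\<close> exactly when \<open>\<pi> a = \<pi> b\<close>; so sending \<open>x\<close> to the
  class of any preimage is a bijection. The index is at least \<open>\<alpha>\<close> because no
  earlier stage is purely unrectifiable.\<close>

lemma cf_realizes_imp_almost_isometric:
  assumes M: "Metric_space M d" and real: "cf_realizes \<alpha> \<epsilon> M d N \<rho> \<pi>" and "\<epsilon> > 0"
  shows "Fin \<alpha> \<le> cf_index N \<rho>"
    and "\<exists>\<phi>. almost_isometry \<epsilon> M d (space_cf N \<rho> \<alpha>) (mdist_cf N \<rho> \<alpha>) \<phi>"
proof -
  have N: "pseudometric N \<rho>" and onto: "\<pi> ` N = M"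
    and rect: "\<And>\<beta>. \<beta> < \<alpha> \<Longrightarrow> \<not> purely_1_unrectifiable N (iter_cf N \<rho> \<beta>)"
    and near: "\<And>a b. a \<in> N \<Longrightarrow> b \<in> N \<Longrightarrow> d (\<pi> a) (\<pi> b) \<le> iter_cf N \<rho> \<alpha> a b"
      "\<And>a b. a \<in> N \<Longrightarrow> b \<in> N \<Longrightarrow> iter_cf N \<rho> \<alpha> a b \<le> (1 + \<epsilon>) * d (\<pi> a) (\<pi> b)"
    using real unfolding cf_realizes_def by blast+
  interpret M: Metric_space M d by fact
  have rect': "\<not> purely_1_unrectifiable (space_cf N \<rho> \<beta>) (mdist_cf N \<rho> \<beta>)" if "\<beta> < \<alpha>" for \<beta>
    unfolding space_cf_def mdist_cf_def
    by (intro purely_1_unrectifiable_quot pseudometric_iter_cf N rect that)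
  show "Fin \<alpha> \<le> cf_index N \<rho>"
  proof (cases "\<exists>\<beta>. purely_1_unrectifiable (space_cf N \<rho> \<beta>) (mdist_cf N \<rho> \<beta>)")
    case True
    then have "\<not> (LEAST \<beta>. purely_1_unrectifiable (space_cf N \<rho> \<beta>) (mdist_cf N \<rho> \<beta>)) < \<alpha>"
      using LeastI_ex[OF True] rect' by blast
    then show ?thesis using True by (simp add: cf_index_def not_less)
  qed (simp add: cf_index_def)
  let ?D = "iter_cf N \<rho> \<alpha>"
  interpret D: pseudometric N ?D using N by (rule pseudometric_iter_cf)
  let ?g = "inv_into N \<pi>"
  have g: "?g x \<in> N" "\<pi> (?g x) = x" if "x \<in> M" for x
    using that onto inv_into_into f_inv_into_f by metis+
  have \<pi>M: "\<pi> a \<in> M" if "a \<in> N" for a using onto that by blast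
  have zero: "?D a b = 0 \<longleftrightarrow> \<pi> a = \<pi> b" if "a \<in> N" "b \<in> N" for a b
    using near(1)[OF that] near(2)[OF that] D.dist_nonneg[OF that] M.nonneg[of "\<pi> a" "\<pi> b"]
      M.zero[OF \<pi>M[OF that(1)] \<pi>M[OF that(2)]] by (metis mult_zero_right order_antisym)
  define \<phi> where "\<phi> x = pm_class N ?D (?g x)" for x
  have "bij_betw \<phi> M (space_cf N \<rho> \<alpha>)"
  proof (rule bij_betw_imageI)
    show "inj_on \<phi> M"
    proof (rule inj_onI)
      fix x y assume xy: "x \<in> M" "y \<in> M" "\<phi> x = \<phi> y"
      have "?g x \<in> \<phi> x" using g(1)[OF xy(1)] by (simp add: \<phi>_def pm_class_def)
      then have "?D (?g y) (?g x) = 0" unfolding xy(3) by (simp add: \<phi>_def pm_class_def)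
      then show "x = y" using zero[OF g(1)[OF xy(2)] g(1)[OF xy(1)]] g(2)[OF xy(1)] g(2)[OF xy(2)] by simp
    qed
    have cls: "pm_class N ?D a = \<phi> (\<pi> a)" if "a \<in> N" for a
      using that g[OF \<pi>M[OF that]] zero by (auto simp: \<phi>_def pm_class_def)
    show "\<phi> ` M = space_cf N \<rho> \<alpha>"
      unfolding space_cf_def pm_quot_def onto[symmetric] image_image using cls by (intro image_cong) auto
  qed
  moreover have "mdist_cf N \<rho> \<alpha> (\<phi> x) (\<phi> y) = ?D (?g x) (?g y)" if "x \<in> M" "y \<in> M" for x y
    unfolding mdist_cf_def \<phi>_def by (intro pm_quot_dist_class D.pseudometric_axioms g that)
  moreover have "(1 - \<epsilon>) * d x y \<le> d x y" for x y
    using assms(3) M.nonneg by (simp add: algebra_simps)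
  moreover have "d x y \<le> ?D (?g x) (?g y)" "?D (?g x) (?g y) \<le> (1 + \<epsilon>) * d x y" if "x \<in> M" "y \<in> M" for x y
    using near(1)[OF g(1)[OF that(1)] g(1)[OF that(2)]] near(2)[OF g(1)[OF that(1)] g(1)[OF that(2)]]
    by (simp_all add: g(2) that)
  ultimately have "almost_isometry \<epsilon> M d (space_cf N \<rho> \<alpha>) (mdist_cf N \<rho> \<alpha>) \<phi>"
    unfolding almost_isometry_def by (smt (verit))
  then show "\<exists>\<phi>. almost_isometry \<epsilon> M d (space_cf N \<rho> \<alpha>) (mdist_cf N \<rho> \<alpha>) \<phi>" by blast
qed

section \<open>Attaching bridges to a snowflake\<close>

lemma negligible_differentiable_image:
  fixes f :: "real \<Rightarrow> real"
  assumes "negligible S" "\<And>x. x \<in> S \<Longrightarrow> f differentiable at x"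
  shows "negligible (f ` S)"
proof (rule negligible_differentiable_image_negligible[OF _ assms(1)])
  show "f differentiable_on S"
    using assms(2) differentiable_at_imp_differentiable_on by blast
qed simp

lemma negligible_affine_image: "negligible S \<Longrightarrow> negligible ((\<lambda>x. a + b * x :: real) ` S)"
  by (rule negligible_differentiable_image) auto

lemma negligible_sqrt_image:
  assumes "negligible S" "\<And>x. x \<in> S \<Longrightarrow> x \<ge> 0"
  shows "negligible (sqrt ` S)"
proof -
  have "sqrt differentiable at x" if "x > 0" for x
    using DERIV_real_sqrt[OF that] real_differentiable_def by blast
  then have "negligible (sqrt ` (S \<inter> {0<..}))"
    using assms(1) by (intro negligible_differentiable_image negligible_Int) auto
  moreover have "sqrt ` S \<subseteq> insert 0 (sqrt ` (S \<inter> {0<..}))"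
    using assms(2) by (force simp: order.order_iff_strict)
  ultimately show ?thesis using negligible_insert negligible_subset by blast
qed

lemma sqrt_diff_le: "0 \<le> x \<Longrightarrow> 0 \<le> y \<Longrightarrow> \<bar>sqrt x - sqrt y\<bar> \<le> sqrt \<bar>x - y\<bar>"
proof (induction x y rule: linorder_wlog)
  case (le x y)
  have "sqrt y \<le> sqrt x + sqrt (y - x)"
    using sqrt_add_le_add_sqrt[of x "y - x"] le by simp
  then show ?case using le by (simp add: abs_if)
qed (simp add: abs_minus_commute)

text \<open>A bridge from \<open>u n\<close> to \<open>v n\<close>: the space \<open>A n\<close>, attached to \<open>M\<close> at \<open>u n\<close> by its foot \<open>p n\<close>,
  whose tip \<open>q n\<close> is at distance \<open>d (u n) (v n)\<close> from \<open>v n\<close>. It collapses to a point at stage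
  \<open>\<beta> n + 1\<close> and not before.\<close>

locale bridges = pseudometric M d for M :: "'a set" and d +
  fixes u v :: "nat \<Rightarrow> 'a" and A :: "nat \<Rightarrow> 'b set" and e :: "nat \<Rightarrow> 'b \<Rightarrow> 'b \<Rightarrow> real"
    and p q :: "nat \<Rightarrow> 'b" and h :: "nat \<Rightarrow> 'b \<Rightarrow> real" and L :: "nat \<Rightarrow> real"
    and \<beta> :: "nat \<Rightarrow> countable_ordinal" and \<alpha> :: countable_ordinal
  assumes M_compact: "pm_compact M d"
    and uv: "u n \<in> M" "v n \<in> M"
    and gaps: "(\<lambda>n. d (u n) (v n)) \<longlonglongrightarrow> 0"
    and A_pseudometric: "pseudometric (A n) (e n)" and A_compact: "pm_compact (A n) (e n)"
    and ends: "p n \<in> A n" "q n \<in> A n" "h n (p n) = 0" "h n (q n) = 1"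
    and e_small: "a \<in> A n \<Longrightarrow> b \<in> A n \<Longrightarrow> e n a b \<le> 1 / Suc n"
    and e_gap: "a \<in> A n \<Longrightarrow> b \<in> A n \<Longrightarrow> 0 < d (u n) (v n) \<Longrightarrow> e n a b \<le> d (u n) (v n)"
    and h_range: "a \<in> A n \<Longrightarrow> 0 \<le> h n a" "a \<in> A n \<Longrightarrow> h n a \<le> 1"
    and L_nonneg: "0 \<le> L n"
    and h_Lipschitz: "a \<in> A n \<Longrightarrow> b \<in> A n \<Longrightarrow> \<bar>h n a - h n b\<bar> \<le> L n * iter_cf (A n) (e n) (\<beta> n) a b"
    and collapse: "a \<in> A n \<Longrightarrow> b \<in> A n \<Longrightarrow> iter_cf (A n) (e n) (osuc (\<beta> n)) a b = 0"
    and A_rectifiable: "\<gamma> \<le> \<beta> n \<Longrightarrow> \<not> purely_1_unrectifiable (A n) (iter_cf (A n) (e n) \<gamma>)"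
    and \<beta>_less: "\<beta> n < \<alpha>" and \<beta>_cofinal: "\<gamma> < \<alpha> \<Longrightarrow> finite {n. \<beta> n < \<gamma>}"
begin

section \<open>The glued space and its metric\<close>

definition N :: "('a + nat \<times> 'b) set" where
  "N = Inl ` M \<union> {Inr (n, a) | n a. a \<in> A n}"

fun pr :: "'a + nat \<times> 'b \<Rightarrow> 'a" where
  "pr (Inl x) = x"
| "pr (Inr (n, a)) = u n"

text \<open>Interpolation along \<open>h n\<close> between the values at the two ends of bridge
  \<open>n\<close>. Thus \<open>ext w\<close> takes equal values at the tip and at
  \<open>v n\<close>, as well as at the foot and at \<open>u n\<close>.\<close>

fun ext :: "('a \<Rightarrow> real) \<Rightarrow> 'a + nat \<times> 'b \<Rightarrow> real" where
  "ext w (Inl x) = w x"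
| "ext w (Inr (n, a)) = (1 - h n a) * w (u n) + h n a * w (v n)"

fun rt :: "nat \<Rightarrow> 'a + nat \<times> 'b \<Rightarrow> 'b" where
  "rt n (Inl x) = p n"
| "rt n (Inr (m, a)) = (if m = n then a else p n)"

definition W :: "('a \<Rightarrow> real) set" where
  "W = {w. \<forall>x\<in>M. \<forall>y\<in>M. \<bar>w x - w y\<bar> \<le> sqrt (d x y)}"

text \<open>The supremum of these numbers is the smallest pseudometric for which \<open>pr\<close>,
  every \<open>ext w\<close> and every retraction \<open>rt n\<close> are 1-Lipschitz. On the base
  it equals the maximum of \<open>d\<close> and \<open>sqrt d\<close>, since
  \<open>sqrt (d x _)\<close> belongs to \<open>W\<close> and the retractions are constant
  there.\<close>

definition dists :: "'a + nat \<times> 'b \<Rightarrow> 'a + nat \<times> 'b \<Rightarrow> real set" where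
  "dists a b = insert (d (pr a) (pr b))
     ((\<lambda>w. \<bar>ext w a - ext w b\<bar>) ` W \<union> range (\<lambda>n. e n (rt n a) (rt n b)))"

definition \<rho> :: "'a + nat \<times> 'b \<Rightarrow> 'a + nat \<times> 'b \<Rightarrow> real" where
  "\<rho> a b = Sup (dists a b)"

lemma N_cases:
  assumes "z \<in> N"
  obtains x where "x \<in> M" "z = Inl x" | n a where "a \<in> A n" "z = Inr (n, a)"
  using assms unfolding N_def by blast

lemma in_N [simp]: "Inl x \<in> N \<longleftrightarrow> x \<in> M" "Inr (n, a) \<in> N \<longleftrightarrow> a \<in> A n"
  by (auto simp: N_def)

lemma pr_in: "z \<in> N \<Longrightarrow> pr z \<in> M"
  by (auto elim!: N_cases simp: uv)

lemma rt_in: "z \<in> N \<Longrightarrow> rt n z \<in> A n"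
  by (auto elim!: N_cases simp: ends)

lemma W_D: "w \<in> W \<Longrightarrow> x \<in> M \<Longrightarrow> y \<in> M \<Longrightarrow> \<bar>w x - w y\<bar> \<le> sqrt (d x y)"
  by (auto simp: W_def)

lemma e_nonneg: "a \<in> A n \<Longrightarrow> b \<in> A n \<Longrightarrow> 0 \<le> e n a b"
  using pseudometric.dist_nonneg[OF A_pseudometric] .

lemma e_self [simp]: "a \<in> A n \<Longrightarrow> e n a a = 0"
  using pseudometric.dist_self[OF A_pseudometric] .

lemma gap_nonneg: "0 \<le> d (u n) (v n)"
  using dist_nonneg uv by blast

text \<open>On a piece \<open>ext w\<close> is a convex combination of values of \<open>w\<close> on
  \<open>M\<close>, and these differ from \<open>w (u 0)\<close> by at most
  \<open>sqrt R\<close>.\<close>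

lemma dists_bdd:
  assumes "a \<in> N" "b \<in> N"
  shows "bdd_above (dists a b)"
proof -
  obtain R where R: "R > 0" "\<And>x y. x \<in> M \<Longrightarrow> y \<in> M \<Longrightarrow> d x y \<le> R"
    using bounded_dist[OF M_compact] by blast
  have ext: "\<bar>ext w z - w (u 0)\<bar> \<le> sqrt R" if "w \<in> W" "z \<in> N" for w z
    using that(2)
  proof (cases rule: N_cases)
    case (1 x)
    then have "\<bar>w x - w (u 0)\<bar> \<le> sqrt (d x (u 0))" "d x (u 0) \<le> R"
      using W_D[OF that(1)] R(2) uv by blast+
    then have "\<bar>w x - w (u 0)\<bar> \<le> sqrt R" using real_sqrt_le_mono order_trans by blast
    then show ?thesis using 1 by simp
  next
    case (2 n a)
    let ?k = "w (u 0)"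
    have "\<bar>w x - ?k\<bar> \<le> sqrt R" if "x \<in> M" for x
      using W_D[OF \<open>w \<in> W\<close> that uv(1)[of 0]] real_sqrt_le_mono[OF R(2)[OF that uv(1)[of 0]]] by linarith
    then have "\<bar>w (u n) - ?k\<bar> \<le> sqrt R" "\<bar>w (v n) - ?k\<bar> \<le> sqrt R" using uv by blast+
    then have "(1 - h n a) * \<bar>w (u n) - ?k\<bar> + h n a * \<bar>w (v n) - ?k\<bar> \<le> (1 - h n a) * sqrt R + h n a * sqrt R"
      using h_range 2 by (intro add_mono mult_left_mono) auto
    moreover have "ext w z - ?k = (1 - h n a) * (w (u n) - ?k) + h n a * (w (v n) - ?k)"
      using 2 by (simp add: algebra_simps)
    moreover have "\<bar>(1 - h n a) * (w (u n) - ?k) + h n a * (w (v n) - ?k)\<bar>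
        \<le> (1 - h n a) * \<bar>w (u n) - ?k\<bar> + h n a * \<bar>w (v n) - ?k\<bar>"
      using h_range[OF 2(1)] abs_triangle_ineq[of "(1 - h n a) * (w (u n) - ?k)" "h n a * (w (v n) - ?k)"]
      by (simp add: abs_mult)
    ultimately show ?thesis by (simp add: algebra_simps)
  qed
  show ?thesis
  proof (rule bdd_aboveI)
    fix t assume "t \<in> dists a b"
    then consider "t = d (pr a) (pr b)" | w where "w \<in> W" "t = \<bar>ext w a - ext w b\<bar>"
      | n where "t = e n (rt n a) (rt n b)"
      unfolding dists_def by blast
    then show "t \<le> R + 2 * sqrt R + 1"
    proof cases
      case 1
      then have "t \<le> R" using R(2) pr_in assms by blast
      then show ?thesis using R(1) real_sqrt_ge_zero[of R] by linarith
    next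
      case 2
      then show ?thesis using ext[OF 2(1) assms(1)] ext[OF 2(1) assms(2)] R(1) by (simp add: abs_le_iff)
    next
      case (3 n)
      have "e n (rt n a) (rt n b) \<le> 1 / Suc n" using e_small rt_in assms by blast
      also have "\<dots> \<le> 1" by simp
      finally show ?thesis using 3 R(1) real_sqrt_ge_zero[of R] by linarith
    qed
  qed
qed

lemma rho_le:
  assumes "d (pr a) (pr b) \<le> c" "\<And>w. w \<in> W \<Longrightarrow> \<bar>ext w a - ext w b\<bar> \<le> c" "\<And>n. e n (rt n a) (rt n b) \<le> c"
  shows "\<rho> a b \<le> c"
  unfolding \<rho>_def using assms by (intro cSup_least) (auto simp: dists_def)

lemma rho_ge:
  assumes "a \<in> N" "b \<in> N"
  shows "d (pr a) (pr b) \<le> \<rho> a b" "w \<in> W \<Longrightarrow> \<bar>ext w a - ext w b\<bar> \<le> \<rho> a b" "e n (rt n a) (rt n b) \<le> \<rho> a b"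
  unfolding \<rho>_def using dists_bdd[OF assms] by (auto intro!: cSup_upper simp: dists_def)

lemma rho_commute_le: "a \<in> N \<Longrightarrow> b \<in> N \<Longrightarrow> \<rho> b a \<le> \<rho> a b"
proof (rule rho_le)
  assume ab: "a \<in> N" "b \<in> N"
  show "d (pr b) (pr a) \<le> \<rho> a b"
    using rho_ge(1)[OF ab] dist_commute[OF pr_in pr_in, OF ab] by simp
  show "\<bar>ext w b - ext w a\<bar> \<le> \<rho> a b" if "w \<in> W" for w
    using rho_ge(2)[OF ab that] by (simp add: abs_minus_commute)
  show "e n (rt n b) (rt n a) \<le> \<rho> a b" for n
    using rho_ge(3)[OF ab, of n] pseudometric.dist_commute[OF A_pseudometric rt_in rt_in, OF ab] by simp
qed

lemma rho_self: "a \<in> N \<Longrightarrow> \<rho> a a = 0"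
  using rho_ge(1)[of a a] pr_in[of a] rt_in[of a] by (intro antisym rho_le) auto

lemma rho_triangle:
  assumes "a \<in> N" "b \<in> N" "c \<in> N"
  shows "\<rho> a c \<le> \<rho> a b + \<rho> b c"
proof (rule rho_le)
  show "d (pr a) (pr c) \<le> \<rho> a b + \<rho> b c"
    using dist_triangle[of "pr a" "pr b" "pr c"] rho_ge(1)[of a b] rho_ge(1)[of b c] assms pr_in by fastforce
  show "\<bar>ext w a - ext w c\<bar> \<le> \<rho> a b + \<rho> b c" if "w \<in> W" for w
    using rho_ge(2)[OF assms(1,2) that] rho_ge(2)[OF assms(2,3) that] by linarith
  show "e n (rt n a) (rt n c) \<le> \<rho> a b + \<rho> b c" for n
    using pseudometric.dist_triangle[OF A_pseudometric rt_in[OF assms(1)] rt_in[OF assms(2)] rt_in[OF assms(3)], of n]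
      rho_ge(3)[OF assms(1,2), of n] rho_ge(3)[OF assms(2,3), of n] by linarith
qed

lemma N_pseudometric: "pseudometric N \<rho>"
  by standard (auto intro: rho_self antisym rho_commute_le rho_triangle)

lemma rho_base:
  assumes "x \<in> M" "y \<in> M"
  shows "\<rho> (Inl x) (Inl y) \<le> d x y + sqrt (d x y)"
  using assms dist_nonneg[OF assms] W_D[OF _ assms] ends by (intro rho_le) (auto intro: add_increasing)

text \<open>A Lipschitz constant for the inclusion of piece \<open>n\<close>: the \<open>1\<close>
  covers the pullback of \<open>e n\<close>; the product covers \<open>ext w\<close>, because
  \<open>h n\<close> is \<open>L n\<close>-Lipschitz and \<open>w\<close> changes by at most
  \<open>sqrt (d (u n) (v n))\<close> between the ends. It may be unbounded in
  \<open>n\<close>.\<close>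

abbreviation stretch :: "nat \<Rightarrow> real" where
  "stretch n \<equiv> 1 + L n * sqrt (d (u n) (v n))"

lemma stretch_pos: "0 < stretch n"
  using L_nonneg[of n] gap_nonneg[of n] by (intro add_pos_nonneg) auto

lemma rho_piece:
  assumes "a \<in> A n" "b \<in> A n"
  shows "\<rho> (Inr (n, a)) (Inr (n, b)) \<le> stretch n * e n a b"
proof (rule rho_le)
  have nn: "0 \<le> e n a b" "0 \<le> L n * sqrt (d (u n) (v n))"
    using e_nonneg[OF assms] L_nonneg[of n] gap_nonneg[of n] by auto
  show "d (pr (Inr (n, a))) (pr (Inr (n, b))) \<le> stretch n * e n a b"
    using nn uv by simp
  show "e m (rt m (Inr (n, a))) (rt m (Inr (n, b))) \<le> stretch n * e n a b" for m
  proof (cases "m = n")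
    case True
    then show ?thesis using mult_nonneg_nonneg[OF nn(2,1)] by (simp add: distrib_right)
  next
    case False
    then show ?thesis using mult_nonneg_nonneg[of "stretch n" "e n a b"] nn ends by simp
  qed
  fix w assume w: "w \<in> W"
  have "ext w (Inr (n, a)) - ext w (Inr (n, b)) = (h n a - h n b) * (w (v n) - w (u n))"
    by (simp add: algebra_simps)
  then have "\<bar>ext w (Inr (n, a)) - ext w (Inr (n, b))\<bar> = \<bar>h n a - h n b\<bar> * \<bar>w (u n) - w (v n)\<bar>"
    by (simp add: abs_mult abs_minus_commute)
  also have "\<dots> \<le> (L n * e n a b) * sqrt (d (u n) (v n))"
  proof (intro mult_mono)
    have "L n * iter_cf (A n) (e n) (\<beta> n) a b \<le> L n * e n a b"
      using L_nonneg iter_cf_le_dist[OF A_pseudometric assms] mult_left_mono by blast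
    then show "\<bar>h n a - h n b\<bar> \<le> L n * e n a b" using h_Lipschitz[OF assms] by linarith
    show "\<bar>w (u n) - w (v n)\<bar> \<le> sqrt (d (u n) (v n))" using W_D[OF w uv] .
  qed (use nn L_nonneg in auto)
  finally show "\<bar>ext w (Inr (n, a)) - ext w (Inr (n, b))\<bar> \<le> stretch n * e n a b"
    using nn by (simp add: algebra_simps)
qed

text \<open>\<open>N\<close> is a disjoint union; this vanishing distance is what glues piece
  \<open>n\<close> to the base.\<close>

lemma rho_foot: "\<rho> (Inl (u n)) (Inr (n, p n)) \<le> 0"
  using uv ends by (intro rho_le) auto

text \<open>Since \<open>h n (q n) = 1\<close>, all functions \<open>ext w\<close> agree at the two
  points. The projection contributes exactly the gap, and the retraction onto piece \<open>n\<close>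
  at most the gap, by \<open>e_gap\<close>.\<close>

lemma rho_tip: "0 < d (u n) (v n) \<Longrightarrow> \<rho> (Inr (n, q n)) (Inl (v n)) \<le> d (u n) (v n)"
  using uv ends e_gap[OF ends(2,1)] by (intro rho_le) auto

lemma rho_near_base:
  assumes "a \<in> A n"
  shows "\<rho> (Inr (n, a)) (Inl (u n)) \<le> sqrt (d (u n) (v n)) + 1 / Suc n"
proof (rule rho_le)
  have nn: "0 \<le> sqrt (d (u n) (v n))" using gap_nonneg[of n] by simp
  then show "d (pr (Inr (n, a))) (pr (Inl (u n))) \<le> sqrt (d (u n) (v n)) + 1 / Suc n"
    using uv by simp
  show "e m (rt m (Inr (n, a))) (rt m (Inl (u n))) \<le> sqrt (d (u n) (v n)) + 1 / Suc n" for m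
    using e_small[OF assms ends(1)] nn ends by (auto simp: add_increasing)
  fix w assume w: "w \<in> W"
  have "ext w (Inr (n, a)) - ext w (Inl (u n)) = h n a * (w (v n) - w (u n))"
    by (simp add: algebra_simps)
  then have "\<bar>ext w (Inr (n, a)) - ext w (Inl (u n))\<bar> = h n a * \<bar>w (u n) - w (v n)\<bar>"
    using h_range[OF assms] by (simp add: abs_mult abs_minus_commute)
  also have "\<dots> \<le> 1 * sqrt (d (u n) (v n))"
    using h_range[OF assms] W_D[OF w uv] by (intro mult_mono) auto
  finally show "\<bar>ext w (Inr (n, a)) - ext w (Inl (u n))\<bar> \<le> sqrt (d (u n) (v n)) + 1 / Suc n"
    by (simp add: add_increasing2)
qed

text \<open>Either some piece is visited infinitely often, and it is compact; or the indices of the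
  visited pieces tend to infinity, and as the pieces shrink to their feet the sequence is asymptotic
  to its projection to the compact base.\<close>

lemma N_compact: "pm_compact N \<rho>"
  unfolding pm_compact_def
proof (intro allI impI)
  interpret N: pseudometric N \<rho> by (rule N_pseudometric)
  fix \<sigma> :: "nat \<Rightarrow> 'a + nat \<times> 'b" assume "range \<sigma> \<subseteq> N"
  then have \<sigma>: "\<sigma> k \<in> N" for k by auto
  define P :: "nat \<Rightarrow> ('a + nat \<times> 'b) set" where "P n = Inr ` ({n} \<times> A n)" for n
  have P_N: "P n \<subseteq> N" for n by (auto simp: P_def)
  show "\<exists>l\<in>N. \<exists>r. strict_mono r \<and> (\<lambda>k. \<rho> (\<sigma> (r k)) l) \<longlonglongrightarrow> 0"
  proof (cases "\<exists>n. infinite {k. \<sigma> k \<in> P n}")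
    case True
    then obtain n where inf: "infinite {k. \<sigma> k \<in> P n}" ..
    define s where "s = enumerate {k. \<sigma> k \<in> P n}"
    have s: "strict_mono s" "\<sigma> (s k) \<in> P n" for k
      using strict_mono_enumerate[OF inf] enumerate_in_set[OF inf, of k] by (auto simp: s_def)
    have "pm_compact (P n) \<rho>"
    proof (rule pm_compact_image[OF A_compact[of n]])
      show "(\<lambda>a. Inr (n, a)) ` A n = P n" by (auto simp: P_def)
      show "0 \<le> stretch n" using stretch_pos[of n] by simp
    qed (use rho_piece N.dist_nonneg in auto)
    then obtain l r where "l \<in> P n" "strict_mono r" "(\<lambda>k. \<rho> (\<sigma> (s (r k))) l) \<longlonglongrightarrow> 0"
      using pm_compactE[where \<sigma> = "\<lambda>k. \<sigma> (s k)"] s(2) by blast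
    then show ?thesis using P_N strict_mono_o[OF s(1)] by (intro bexI[of _ l] exI[of _ "s \<circ> r"]) (auto simp: o_def)
  next
    case False
    obtain l r where lr: "l \<in> M" "strict_mono r" "(\<lambda>k. d (pr (\<sigma> (r k))) l) \<longlonglongrightarrow> 0"
      using pm_compactE[where \<sigma> = "\<lambda>k. pr (\<sigma> k)", OF M_compact pr_in[OF \<sigma>]] .
    define g where "g n = sqrt (d (u n) (v n)) + 1 / Suc n" for n
    have g: "g \<longlonglongrightarrow> 0"
      unfolding g_def using tendsto_add[OF tendsto_real_sqrt[OF gaps] LIMSEQ_Suc[OF lim_1_over_n]] by simp
    have near: "(\<lambda>k. \<rho> (\<sigma> k) (Inl (pr (\<sigma> k)))) \<longlonglongrightarrow> 0"
    proof (rule LIMSEQ_I)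
      fix c :: real assume c: "0 < c"
      then obtain n0 where n0: "\<And>n. n \<ge> n0 \<Longrightarrow> g n < c"
        using order_tendstoD(2)[OF g c] by (auto simp: eventually_sequentially)
      have "finite (\<Union>n<n0. {k. \<sigma> k \<in> P n})" using False by auto
      then obtain k0 where k0: "\<And>k. k \<in> (\<Union>n<n0. {k. \<sigma> k \<in> P n}) \<Longrightarrow> k < k0"
        using finite_nat_set_iff_bounded by meson
      have "\<rho> (\<sigma> k) (Inl (pr (\<sigma> k))) < c" if "k \<ge> k0" for k
        using \<sigma>[of k]
      proof (cases rule: N_cases)
        case (1 x)
        then show ?thesis using c by (simp add: rho_self)
      next
        case (2 n a)
        then have "\<sigma> k \<in> P n" by (auto simp: P_def)
        have "n \<ge> n0"
        proof (rule ccontr)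
          assume "\<not> n0 \<le> n"
          then have "k \<in> (\<Union>n<n0. {k. \<sigma> k \<in> P n})" using \<open>\<sigma> k \<in> P n\<close> by auto
          then have "k < k0" by (rule k0)
          then show False using that by simp
        qed
        then have "g n < c" by (rule n0)
        moreover have "\<rho> (\<sigma> k) (Inl (pr (\<sigma> k))) \<le> g n"
          unfolding 2(2) pr.simps g_def using 2(1) by (rule rho_near_base)
        ultimately show ?thesis by simp
      qed
      moreover have "0 \<le> \<rho> (\<sigma> k) (Inl (pr (\<sigma> k)))" for k
        using N.dist_nonneg \<sigma> pr_in by simp
      ultimately show "\<exists>k0. \<forall>k\<ge>k0. norm (\<rho> (\<sigma> k) (Inl (pr (\<sigma> k))) - 0) < c" by auto
    qed
    have "(\<lambda>k. \<rho> (\<sigma> (r k)) (Inl (pr (\<sigma> (r k)))) + (d (pr (\<sigma> (r k))) l + sqrt (d (pr (\<sigma> (r k))) l))) \<longlonglongrightarrow> 0 + (0 + sqrt 0)"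
      using LIMSEQ_subseq_LIMSEQ[OF near lr(2)] by (intro tendsto_intros lr(3)) (simp add: o_def)
    then have lim: "(\<lambda>k. \<rho> (\<sigma> (r k)) (Inl (pr (\<sigma> (r k)))) + (d (pr (\<sigma> (r k))) l + sqrt (d (pr (\<sigma> (r k))) l))) \<longlonglongrightarrow> 0"
      by simp
    have le: "\<rho> (\<sigma> k) (Inl l) \<le> \<rho> (\<sigma> k) (Inl (pr (\<sigma> k))) + (d (pr (\<sigma> k)) l + sqrt (d (pr (\<sigma> k)) l))" for k
      using rho_triangle[of "\<sigma> k" "Inl (pr (\<sigma> k))" "Inl l"] rho_base[of "pr (\<sigma> k)" l] \<sigma> pr_in lr(1) by simp
    have "(\<lambda>k. \<rho> (\<sigma> (r k)) (Inl l)) \<longlonglongrightarrow> 0"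
      by (rule tendsto_sandwich[OF _ _ tendsto_const lim]) (use le N.dist_nonneg \<sigma> lr(1) in auto)
    then show ?thesis using lr by (intro bexI[of _ "Inl l"]) auto
  qed
qed

section \<open>Collapse of the bridges and the upper bound at stage \<open>\<alpha>\<close>\<close>

abbreviation D :: "countable_ordinal \<Rightarrow> 'a + nat \<times> 'b \<Rightarrow> 'a + nat \<times> 'b \<Rightarrow> real" where
  "D \<equiv> iter_cf N \<rho>"

lemma D_pseudometric: "pseudometric N (D \<gamma>)"
  using N_pseudometric by (rule pseudometric_iter_cf)

lemma D_le_rho: "a \<in> N \<Longrightarrow> b \<in> N \<Longrightarrow> D \<gamma> a b \<le> \<rho> a b"
  using N_pseudometric by (rule iter_cf_le_dist)

lemma D_piece_le: "a \<in> A n \<Longrightarrow> b \<in> A n \<Longrightarrow> D \<gamma> (Inr (n, a)) (Inr (n, b)) \<le> stretch n * iter_cf (A n) (e n) \<gamma> a b"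
  by (rule iter_cf_Lipschitz[OF A_pseudometric N_pseudometric stretch_pos]) (auto intro: rho_piece)

text \<open>With \<open>D_piece_le\<close> this says that piece \<open>n\<close>, with its own stage
  \<open>\<gamma>\<close>, sits bi-Lipschitzly in stage \<open>\<gamma>\<close> of \<open>N\<close>;
  its collapse and its rectifiability carry over.\<close>

lemma D_retract: "a \<in> N \<Longrightarrow> b \<in> N \<Longrightarrow> iter_cf (A n) (e n) \<gamma> (rt n a) (rt n b) \<le> D \<gamma> a b"
  using iter_cf_Lipschitz[OF N_pseudometric A_pseudometric, of 1 "rt n" n a b] rt_in rho_ge(3) by simp

lemma D_piece_zero:
  assumes "a \<in> A n" "b \<in> A n"
  shows "D \<alpha> (Inr (n, a)) (Inr (n, b)) = 0"
proof -
  interpret pseudometric N "D \<alpha>" by (rule D_pseudometric)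
  have "D \<alpha> (Inr (n, a)) (Inr (n, b)) \<le> D (osuc (\<beta> n)) (Inr (n, a)) (Inr (n, b))"
    using assms \<beta>_less by (intro iter_cf_antimono[OF N_pseudometric]) (auto simp: osuc_le_iff)
  also have "\<dots> \<le> 0" using D_piece_le[OF assms, of "osuc (\<beta> n)"] collapse[OF assms] by simp
  finally show ?thesis using dist_nonneg[of "Inr (n, a)" "Inr (n, b)"] assms by simp
qed

lemma D_foot_zero: 
  assumes "a \<in> A n"
  shows "D \<alpha> (Inr (n, a)) (Inl (u n)) = 0"
proof -
  interpret pseudometric N "D \<alpha>" by (rule D_pseudometric)
  have "D \<alpha> (Inl (u n)) (Inr (n, p n)) \<le> 0"
    using D_le_rho[of "Inl (u n)" "Inr (n, p n)" \<alpha>] rho_foot[of n] uv ends by simp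
  then show ?thesis
    using dist_triangle[of "Inr (n, a)" "Inr (n, p n)" "Inl (u n)"] dist_commute[of "Inl (u n)" "Inr (n, p n)"]
      dist_nonneg[of "Inr (n, a)" "Inl (u n)"] D_piece_zero[OF assms ends(1)] assms uv ends by simp
qed

lemma D_pr:
  assumes "a \<in> N" "b \<in> N"
  shows "D \<alpha> a b = D \<alpha> (Inl (pr a)) (Inl (pr b))"
proof -
  interpret pseudometric N "D \<alpha>" by (rule D_pseudometric)
  have "D \<alpha> z (Inl (pr z)) = 0" if "z \<in> N" for z
    using that D_foot_zero uv by (auto elim!: N_cases)
  then show ?thesis using assms pr_in by (intro dist_cong) auto
qed

lemma D_bridge: "D \<alpha> (Inl (u n)) (Inl (v n)) \<le> d (u n) (v n)"
proof (cases "d (u n) (v n) > 0")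
  case True
  interpret pseudometric N "D \<alpha>" by (rule D_pseudometric)
  have "D \<alpha> (Inl (u n)) (Inr (n, q n)) = 0"
    using D_foot_zero[OF ends(2)] dist_commute uv ends by simp
  then show ?thesis
    using dist_triangle[of "Inl (u n)" "Inr (n, q n)" "Inl (v n)"] rho_tip[OF True]
      D_le_rho[of "Inr (n, q n)" "Inl (v n)" \<alpha>] uv ends by simp
next
  case False
  then have "d (u n) (v n) = 0" using gap_nonneg[of n] by simp
  then show ?thesis using D_le_rho[of "Inl (u n)" "Inl (v n)" \<alpha>] rho_base[OF uv(1)[of n] uv(2)[of n]] uv by simp
qed

text \<open>Crossing one bridge reduces the distance that remains to be travelled by the factor \<open>\<delta>\<close>, at
  both ends.\<close>

lemma D_upper:
  assumes \<delta>: "0 < \<delta>" "\<delta> \<le> 1 / 16"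
    and dense: "\<And>x y. x \<in> M \<Longrightarrow> y \<in> M \<Longrightarrow> 0 < d x y \<Longrightarrow> \<exists>n. d x (u n) \<le> \<delta> * d x y \<and> d y (v n) \<le> \<delta> * d x y"
    and xy: "x \<in> M" "y \<in> M"
  shows "D \<alpha> (Inl x) (Inl y) \<le> (1 + 8 * \<delta>) * d x y"
proof -
  interpret D: pseudometric N "D \<alpha>" by (rule D_pseudometric)
  \<comment> \<open>\<open>k\<close> counts the generations of bridges used. The snowflake bound on
    what is left starts the induction, and each generation halves the error term.\<close>
  have step: "D \<alpha> (Inl x) (Inl y) \<le> (1 + 8 * \<delta>) * d x y + (1 / 2) ^ k * (d x y + sqrt (d x y))"
    if "x \<in> M" "y \<in> M" for k x y
    using that
  proof (induction k arbitrary: x y)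
    case 0
    have "0 \<le> (1 + 8 * \<delta>) * d x y" using \<delta> dist_nonneg[OF 0] by simp
    then show ?case using D_le_rho[of "Inl x" "Inl y" \<alpha>] rho_base[OF 0] 0 by simp
  next
    case (Suc k)
    let ?r = "d x y"
    have r: "0 \<le> ?r" using dist_nonneg Suc by blast
    show ?case
    proof (cases "?r = 0")
      case True
      then show ?thesis using D_le_rho[of "Inl x" "Inl y" \<alpha>] rho_base[of x y] Suc by simp
    next
      case False
      then obtain n where n: "d x (u n) \<le> \<delta> * ?r" "d y (v n) \<le> \<delta> * ?r"
        using dense[of x y] Suc r by auto
      \<comment> \<open>Here \<open>\<delta> \<le> 1 / 16\<close> enters: the square root of the
        remaining distance is at most \<open>sqrt ?r / 4\<close>. Two ends with a quarter of the
        error each leave one half.\<close>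
      have side: "D \<alpha> (Inl z) (Inl z') \<le> (1 + 8 * \<delta>) * (\<delta> * ?r) + (1 / 2) ^ k * ((?r + sqrt ?r) / 4)"
        if "z \<in> M" "z' \<in> M" "d z z' \<le> \<delta> * ?r" for z z'
      proof -
        have "d z z' \<le> ?r / 4" "d z z' \<le> ?r / 16"
          using that(3) mult_right_mono[OF \<delta>(2) r] r by linarith+
        moreover from this have "sqrt (d z z') \<le> sqrt (?r / 16)" by simp
        moreover have "sqrt (?r / 16) = sqrt ?r / 4" by (simp add: real_sqrt_divide)
        ultimately have "d z z' + sqrt (d z z') \<le> (?r + sqrt ?r) / 4" by (simp add: add_divide_distrib)
        then have "(1 / 2) ^ k * (d z z' + sqrt (d z z')) \<le> (1 / 2) ^ k * ((?r + sqrt ?r) / 4)"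
          by (intro mult_left_mono) auto
        moreover have "(1 + 8 * \<delta>) * d z z' \<le> (1 + 8 * \<delta>) * (\<delta> * ?r)"
          using that(3) \<delta> by (intro mult_left_mono) auto
        ultimately show ?thesis using Suc.IH[OF that(1,2)] by linarith
      qed
      have mid: "d (u n) (v n) \<le> ?r + 2 * (\<delta> * ?r)"
        using dist_triangle[of "u n" x "v n"] dist_triangle[of x y "v n"] dist_commute[of "u n" x] n uv Suc by simp
      have "D \<alpha> (Inl x) (Inl y) \<le> D \<alpha> (Inl x) (Inl (u n)) + (D \<alpha> (Inl (u n)) (Inl (v n)) + D \<alpha> (Inl (v n)) (Inl y))"
        using D.dist_triangle[of "Inl x" "Inl (u n)" "Inl y"] D.dist_triangle[of "Inl (u n)" "Inl (v n)" "Inl y"]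
          uv Suc by simp
      also have "\<dots> \<le> ((1 + 8 * \<delta>) * (\<delta> * ?r) + (1 / 2) ^ k * ((?r + sqrt ?r) / 4)) +
         ((?r + 2 * (\<delta> * ?r)) + ((1 + 8 * \<delta>) * (\<delta> * ?r) + (1 / 2) ^ k * ((?r + sqrt ?r) / 4)))"
        using side[of x "u n"] side[of "v n" y] mid D_bridge[of n] n dist_commute[of y "v n"] uv Suc
        by (intro add_mono) auto
      also have "\<dots> = (1 + 4 * \<delta> + 16 * (\<delta> * \<delta>)) * ?r + (1 / 2) ^ Suc k * (?r + sqrt ?r)"
        by (simp add: algebra_simps)
      \<comment> \<open>The excess \<open>2 * \<delta>\<close> of the bridge and
        \<open>(1 + 8 * \<delta>) * \<delta>\<close> for each end add up to at most
        \<open>5 * \<delta>\<close>, so the factor \<open>1 + 8 * \<delta>\<close> reproduces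
        itself.\<close>
      also have "\<dots> \<le> (1 + 8 * \<delta>) * ?r + (1 / 2) ^ Suc k * (?r + sqrt ?r)"
      proof -
        have "16 * (\<delta> * \<delta>) \<le> 1 * \<delta>" using \<delta> mult_right_mono[of "16 * \<delta>" 1 \<delta>] by simp
        then show ?thesis using r \<delta> by (intro add_right_mono mult_right_mono) auto
      qed
      finally show ?thesis .
    qed
  qed
  have "(\<lambda>k. (1 + 8 * \<delta>) * d x y + (1 / 2) ^ k * (d x y + sqrt (d x y))) \<longlonglongrightarrow> (1 + 8 * \<delta>) * d x y + 0 * (d x y + sqrt (d x y))"
    by (intro tendsto_intros LIMSEQ_power_zero) auto
  then show ?thesis
    using step[OF xy] by (intro LIMSEQ_le_const[of _ "(1 + 8 * \<delta>) * d x y"]) auto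
qed

section \<open>Lower bounds up to stage \<open>\<alpha>\<close>\<close>

lemma fragment_null_piece:
  assumes "\<gamma> < \<beta> n"
  shows "fragment_null N (D \<gamma>) (\<lambda>z. h n (rt n z))"
proof (rule pseudometric.dist_cf_imp_fragment_null[OF D_pseudometric L_nonneg])
  fix a b assume ab: "a \<in> N" "b \<in> N"
  have "iter_cf (A n) (e n) (\<beta> n) (rt n a) (rt n b) \<le> iter_cf (A n) (e n) (osuc \<gamma>) (rt n a) (rt n b)"
    using assms rt_in ab by (intro iter_cf_antimono[OF A_pseudometric]) (auto simp: osuc_le_iff)
  also have "\<dots> \<le> D (osuc \<gamma>) a b" using D_retract ab by blast
  also have "\<dots> = dist_cf N (D \<gamma>) a b" using iter_cf_osuc'[OF N_pseudometric ab] .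
  finally have "L n * iter_cf (A n) (e n) (\<beta> n) (rt n a) (rt n b) \<le> L n * dist_cf N (D \<gamma>) a b"
    using L_nonneg mult_left_mono by blast
  then show "\<bar>h n (rt n a) - h n (rt n b)\<bar> \<le> L n * dist_cf N (D \<gamma>) a b"
    using h_Lipschitz[OF rt_in rt_in, OF ab] order_trans by blast
qed

text \<open>\<open>bump x r\<close> is 1-Lipschitz for \<open>sqrt (d _ _)\<close> and vanishes on all endpoints of the bridges
  that collapse before stage \<open>\<gamma>\<close> if \<open>isolated \<gamma> x r\<close>. These functions show that the base remains
  locally a snowflake at stage \<open>\<gamma>\<close>.\<close>

definition bump :: "'a \<Rightarrow> real \<Rightarrow> 'a \<Rightarrow> real" where
  "bump x r y = max 0 (sqrt r - sqrt (d x y))"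

definition isolated :: "countable_ordinal \<Rightarrow> 'a \<Rightarrow> real \<Rightarrow> bool" where
  "isolated \<gamma> x r \<longleftrightarrow> (\<forall>n. \<beta> n < \<gamma> \<longrightarrow> r \<le> d x (u n) \<and> r \<le> d x (v n))"

lemma bump_W:
  assumes "x \<in> M"
  shows "bump x r \<in> W"
  unfolding W_def
proof (intro CollectI ballI)
  fix y z assume yz: "y \<in> M" "z \<in> M"
  have "\<bar>bump x r y - bump x r z\<bar> \<le> \<bar>sqrt (d x y) - sqrt (d x z)\<bar>" by (simp add: bump_def)
  also have "\<dots> \<le> sqrt \<bar>d x y - d x z\<bar>" using sqrt_diff_le dist_nonneg assms yz by simp
  also have "\<dots> \<le> sqrt (d y z)" using dist_diff_le assms yz by simp
  finally show "\<bar>bump x r y - bump x r z\<bar> \<le> sqrt (d y z)" .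
qed

text \<open>On the times \<open>T j\<close>, the bump around \<open>\<phi> s\<close> turns the
  fragment bound into the snowflake bound for nearby times, so the image is null. The sets
  \<open>T j\<close> exhaust the base except for points at distance \<open>0\<close> from an
  endpoint of one of finitely many bridges. The bump estimate is a hypothesis because it serves both
  inside the induction for \<open>ext_bump_Lipschitz\<close> and after it.\<close>

lemma fragment_null_base:
  assumes fin: "finite {n. \<beta> n < \<gamma>'}"
    and bump: "\<And>x r a b. x \<in> M \<Longrightarrow> isolated \<gamma>' x r \<Longrightarrow> a \<in> N \<Longrightarrow> b \<in> N \<Longrightarrow>
      \<bar>ext (bump x r) a - ext (bump x r) b\<bar> \<le> D \<gamma> a b"
    and \<phi>: "curve_fragment1 N (D \<gamma>) K \<phi>" and x: "x \<in> M"
  shows "negligible ((\<lambda>t. d x (pr (\<phi> t))) ` {t \<in> K. \<phi> t \<in> Inl ` M})"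
proof -
  let ?f = "\<lambda>t. d x (pr (\<phi> t))"
  let ?B = "{n. \<beta> n < \<gamma>'}"
  define T where "T j = {t \<in> K. \<phi> t \<in> Inl ` M \<and> isolated \<gamma>' (pr (\<phi> t)) (1 / Suc j)}" for j :: nat
  have null: "negligible (?f ` T j)" for j
  proof (rule negligible_image_quadratic)
    show "bounded (T j)"
      using \<phi> by (intro bounded_subset[OF compact_imp_bounded, of K]) (auto simp: T_def curve_fragment1_def)
    show "0 < sqrt (1 / Suc j)" by simp
    fix s t assume st: "s \<in> T j" "t \<in> T j" "\<bar>s - t\<bar> < sqrt (1 / Suc j)"
    define y z where "y = pr (\<phi> s)" and "z = pr (\<phi> t)"
    have sK: "s \<in> K" "t \<in> K" "isolated \<gamma>' y (1 / Suc j)" "\<phi> s \<in> Inl ` M" "\<phi> t \<in> Inl ` M"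
      using st(1,2) unfolding T_def y_def by simp_all
    then have yz: "y \<in> M" "z \<in> M" "\<phi> s = Inl y" "\<phi> t = Inl z" by (auto simp: y_def z_def)
    have "\<bar>ext (bump y (1 / Suc j)) (\<phi> s) - ext (bump y (1 / Suc j)) (\<phi> t)\<bar> \<le> D \<gamma> (\<phi> s) (\<phi> t)"
      using yz by (intro bump[OF yz(1) sK(3)]) simp_all
    also have "\<dots> \<le> \<bar>s - t\<bar>" using \<phi> sK(1,2) unfolding curve_fragment1_def by blast
    finally have "sqrt (1 / Suc j) - max 0 (sqrt (1 / Suc j) - sqrt (d y z)) \<le> \<bar>s - t\<bar>"
      using yz(1) unfolding yz(3,4) by (simp add: bump_def)
    \<comment> \<open>As \<open>\<bar>s - t\<bar>\<close> is below the height
      \<open>sqrt (1 / Suc j)\<close> of the bump, the maximum cannot be attained by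
      \<open>0\<close> alone.\<close>
    then have "sqrt (d y z) \<le> \<bar>s - t\<bar>" using st(3) by linarith
    then have "d y z \<le> (s - t)\<^sup>2" by (metis real_le_lsqrt real_sqrt_abs real_sqrt_le_iff)
    then show "\<bar>?f s - ?f t\<bar> \<le> (s - t)\<^sup>2"
      using dist_diff_le[OF x yz(1,2)] by (simp add: y_def z_def)
  qed
  have "?f ` {t \<in> K. \<phi> t \<in> Inl ` M} \<subseteq> (\<Union>j. ?f ` T j) \<union> (\<Union>n\<in>?B. {d x (u n), d x (v n)})"
  proof (intro image_subsetI)
    fix t assume t: "t \<in> {t \<in> K. \<phi> t \<in> Inl ` M}"
    define y where "y = pr (\<phi> t)"
    have y: "y \<in> M" using t by (auto simp: y_def)
    show "?f t \<in> (\<Union>j. ?f ` T j) \<union> (\<Union>n\<in>?B. {d x (u n), d x (v n)})"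
    proof (cases "\<exists>n\<in>?B. d y (u n) = 0 \<or> d y (v n) = 0")
      case True
      then obtain n where n: "n \<in> ?B" "d y (u n) = 0 \<or> d y (v n) = 0" by blast
      then have "?f t = d x (u n) \<or> ?f t = d x (v n)"
        using dist_cong[OF x x y uv(1)[of n]] dist_cong[OF x x y uv(2)[of n]] x unfolding y_def[symmetric] by auto
      then show ?thesis using n by blast
    next
      case False
      \<comment> \<open>The inserted \<open>1\<close> keeps the minimum meaningful when no bridge
        has collapsed.\<close>
      define m where "m = Min (insert 1 ((\<lambda>n. d y (u n)) ` ?B \<union> (\<lambda>n. d y (v n)) ` ?B))"
      have "0 < d y (u n)" "0 < d y (v n)" if "n \<in> ?B" for n
        using False that dist_nonneg[OF y uv(1)[of n]] dist_nonneg[OF y uv(2)[of n]] by (auto simp: less_le)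
      then have "0 < m" using fin unfolding m_def by (subst Min_gr_iff) auto
      then obtain j where j: "1 / Suc j < m" using reals_Archimedean[of m] by (auto simp: inverse_eq_divide)
      have "m \<le> d y (u n)" "m \<le> d y (v n)" if "n \<in> ?B" for n
        unfolding m_def using fin that by (auto intro!: Min_le)
      then have "isolated \<gamma>' y (1 / Suc j)" unfolding isolated_def using j by fastforce
      then have "t \<in> T j" using t by (simp add: T_def y_def)
      then show ?thesis by blast
    qed
  qed
  moreover have "negligible (\<Union>j. ?f ` T j)" using null by (intro negligible_countable_Union) auto
  moreover have "negligible (\<Union>n\<in>?B. {d x (u n), d x (v n)})" using fin by (intro negligible_finite) auto
  ultimately show ?thesis using negligible_Un negligible_subset by meson
qed

lemma fragment_null_split:
  assumes \<phi>: "curve_fragment1 N d' K \<phi>"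
    and base: "negligible ((\<lambda>t. g (\<phi> t)) ` {t \<in> K. \<phi> t \<in> Inl ` M})"
    and piece: "\<And>n. negligible ((\<lambda>t. g (\<phi> t)) ` {t \<in> K. \<exists>a\<in>A n. \<phi> t = Inr (n, a)})"
  shows "negligible ((\<lambda>t. g (\<phi> t)) ` K)"
proof (rule negligible_subset)
  show "negligible ((\<lambda>t. g (\<phi> t)) ` {t \<in> K. \<phi> t \<in> Inl ` M} \<union>
      (\<Union>n. (\<lambda>t. g (\<phi> t)) ` {t \<in> K. \<exists>a\<in>A n. \<phi> t = Inr (n, a)}))"
    using base piece by (intro negligible_Un negligible_countable_Union) auto
  have "\<phi> t \<in> N" if "t \<in> K" for t using \<phi> that by (auto simp: curve_fragment1_def)
  then show "(\<lambda>t. g (\<phi> t)) ` K \<subseteq> (\<lambda>t. g (\<phi> t)) ` {t \<in> K. \<phi> t \<in> Inl ` M} \<union>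
      (\<Union>n. (\<lambda>t. g (\<phi> t)) ` {t \<in> K. \<exists>a\<in>A n. \<phi> t = Inr (n, a)})"
    by (force elim: N_cases)
qed

text \<open>At a successor the image along fragments must be null. On the base this is
  \<open>fragment_null_base\<close> fed with the induction hypothesis. On a piece with
  \<open>\<beta> n < \<gamma>'\<close> nothing is known about \<open>h n\<close> along fragments,
  but the bump vanishes at both ends; on the other pieces \<open>h n\<close> has null image.
  \<open>\<gamma>'\<close> stays fixed so that the isolation condition does not change with the
  stage.\<close>

lemma ext_bump_Lipschitz:
  assumes "\<gamma>' < \<alpha>" "\<gamma> \<le> \<gamma>'" "x \<in> M" "isolated \<gamma>' x r" "a \<in> N" "b \<in> N"
  shows "\<bar>ext (bump x r) a - ext (bump x r) b\<bar> \<le> D \<gamma> a b"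
  using assms(2-)
proof (induction \<gamma> arbitrary: x r a b rule: ordinal_induct)
  case zero
  then show ?case using rho_ge(2)[OF _ _ bump_W] by (simp add: iter_cf_zero)
next
  case (limit \<gamma>)
  show ?case
  proof (rule iter_cf_limit_greatest[OF limit(1)])
    show "\<bar>ext (bump x r) a - ext (bump x r) b\<bar> \<le> D \<delta> a b" if "\<delta> < \<gamma>" for \<delta>
      using that limit by (intro limit(2)) auto
  qed
next
  case (osuc \<gamma>)
  let ?w = "bump x r"
  have \<gamma>: "\<gamma> < \<gamma>'" using osuc.prems osuc_le_iff by blast
  interpret D: pseudometric N "D \<gamma>" by (rule D_pseudometric)
  have fin: "finite {n. \<beta> n < \<gamma>'}" using \<beta>_cofinal assms(1) by blast
  have IH: "\<bar>ext (bump x r) a - ext (bump x r) b\<bar> \<le> D \<gamma> a b"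
    if "x \<in> M" "isolated \<gamma>' x r" "a \<in> N" "b \<in> N" for x r a b
    using osuc.IH[OF _ that] \<gamma> by simp
  have "fragment_null N (D \<gamma>) (ext ?w)"
    unfolding fragment_null_def
  proof (intro allI impI)
    fix K \<phi> assume \<phi>: "curve_fragment1 N (D \<gamma>) K \<phi>"
    show "negligible ((\<lambda>t. ext ?w (\<phi> t)) ` K)"
    proof (rule fragment_null_split[OF \<phi>])
      let ?S = "(\<lambda>t. d x (pr (\<phi> t))) ` {t \<in> K. \<phi> t \<in> Inl ` M}"
      have "negligible ?S" using fragment_null_base[OF fin IH \<phi> osuc.prems(2)] .
      then have "negligible (sqrt ` ?S)"
        using osuc.prems(2) by (intro negligible_sqrt_image) (auto simp: dist_nonneg)
      then have "negligible (insert 0 ((\<lambda>s. sqrt r + (- 1) * s) ` sqrt ` ?S))"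
        unfolding negligible_insert by (rule negligible_affine_image)
      moreover have "(\<lambda>t. ext ?w (\<phi> t)) ` {t \<in> K. \<phi> t \<in> Inl ` M} \<subseteq> insert 0 ((\<lambda>s. sqrt r + (- 1) * s) ` sqrt ` ?S)"
      proof (intro image_subsetI)
        fix t assume t: "t \<in> {t \<in> K. \<phi> t \<in> Inl ` M}"
        then have "ext ?w (\<phi> t) = max 0 (sqrt r + (- 1) * sqrt (d x (pr (\<phi> t))))" by (auto simp: bump_def)
        moreover have "sqrt r + (- 1) * sqrt (d x (pr (\<phi> t))) \<in> (\<lambda>s. sqrt r + (- 1) * s) ` sqrt ` ?S"
          using t by blast
        ultimately show "ext ?w (\<phi> t) \<in> insert 0 ((\<lambda>s. sqrt r + (- 1) * s) ` sqrt ` ?S)"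
          by (simp add: max_def)
      qed
      ultimately show "negligible ((\<lambda>t. ext ?w (\<phi> t)) ` {t \<in> K. \<phi> t \<in> Inl ` M})"
        using negligible_subset by blast
      fix n
      let ?T = "{t \<in> K. \<exists>a\<in>A n. \<phi> t = Inr (n, a)}"
      show "negligible ((\<lambda>t. ext ?w (\<phi> t)) ` ?T)"
      proof (cases "\<beta> n < \<gamma>'")
        case True
        then have "?w (u n) = 0" "?w (v n) = 0"
          using osuc.prems(3) by (auto simp: isolated_def bump_def)
        then have "(\<lambda>t. ext ?w (\<phi> t)) ` ?T \<subseteq> {0}" by auto
        then show ?thesis using negligible_sing negligible_subset by blast
      next
        case False
        then have "\<gamma> < \<beta> n" using \<gamma> by simp
        then have "negligible ((\<lambda>t. h n (rt n (\<phi> t))) ` K)"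
          using fragment_null_piece \<phi> unfolding fragment_null_def by blast
        then have "negligible ((\<lambda>s. ?w (u n) + (?w (v n) - ?w (u n)) * s) ` (\<lambda>t. h n (rt n (\<phi> t))) ` K)"
          by (rule negligible_affine_image)
        moreover have "(\<lambda>t. ext ?w (\<phi> t)) ` ?T \<subseteq> (\<lambda>s. ?w (u n) + (?w (v n) - ?w (u n)) * s) ` (\<lambda>t. h n (rt n (\<phi> t))) ` K"
        proof (intro image_subsetI)
          fix t assume t: "t \<in> ?T"
          then have "ext ?w (\<phi> t) = ?w (u n) + (?w (v n) - ?w (u n)) * h n (rt n (\<phi> t))"
            by (auto simp: algebra_simps)
          then show "ext ?w (\<phi> t) \<in> (\<lambda>s. ?w (u n) + (?w (v n) - ?w (u n)) * s) ` (\<lambda>t. h n (rt n (\<phi> t))) ` K"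
            using t by blast
        qed
        ultimately show ?thesis using negligible_subset by blast
      qed
    qed
  qed
  then have "\<bar>ext ?w a - ext ?w b\<bar> \<le> dist_cf N (D \<gamma>) a b"
    using IH osuc.prems by (intro D.fragment_null_imp_dist_cf) auto
  then show ?case using iter_cf_osuc'[OF N_pseudometric] osuc.prems by simp
qed

text \<open>The test function \<open>d (pr a) (pr _)\<close> is constant on each piece, so only the
  base matters; there the bumps at stage \<open>\<gamma>\<close> are available because
  \<open>\<gamma> < \<alpha>\<close> leaves finitely many collapsed bridges.\<close>

lemma D_lower:
  assumes "\<gamma> \<le> \<alpha>" "a \<in> N" "b \<in> N"
  shows "d (pr a) (pr b) \<le> D \<gamma> a b"
  using assms
proof (induction \<gamma> arbitrary: a b rule: ordinal_induct)
  case zero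
  then show ?case using rho_ge(1) by (simp add: iter_cf_zero)
next
  case (limit \<gamma>)
  show ?case
  proof (rule iter_cf_limit_greatest[OF limit(1)])
    show "d (pr a) (pr b) \<le> D \<delta> a b" if "\<delta> < \<gamma>" for \<delta>
      using that limit by (intro limit(2)) auto
  qed
next
  case (osuc \<gamma>)
  have \<gamma>: "\<gamma> < \<alpha>" using osuc.prems osuc_le_iff by blast
  interpret D: pseudometric N "D \<gamma>" by (rule D_pseudometric)
  let ?g = "\<lambda>z. d (pr a) (pr z)"
  have "fragment_null N (D \<gamma>) ?g"
    unfolding fragment_null_def
  proof (intro allI impI)
    fix K \<phi> assume \<phi>: "curve_fragment1 N (D \<gamma>) K \<phi>"
    show "negligible ((\<lambda>t. ?g (\<phi> t)) ` K)"
    proof (rule fragment_null_split[OF \<phi>])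
      show "negligible ((\<lambda>t. ?g (\<phi> t)) ` {t \<in> K. \<phi> t \<in> Inl ` M})"
        using fragment_null_base[OF \<beta>_cofinal[OF \<gamma>] ext_bump_Lipschitz[OF \<gamma> order_refl] \<phi> pr_in] osuc.prems by simp
      show "negligible ((\<lambda>t. ?g (\<phi> t)) ` {t \<in> K. \<exists>a\<in>A n. \<phi> t = Inr (n, a)})" for n
        by (rule negligible_subset[of "{d (pr a) (u n)}"]) auto
    qed
  qed
  moreover have "\<bar>?g x - ?g y\<bar> \<le> D \<gamma> x y" if "x \<in> N" "y \<in> N" for x y
  proof -
    have "\<bar>?g x - ?g y\<bar> \<le> d (pr x) (pr y)" using dist_diff_le pr_in that osuc.prems by blast
    also have "\<dots> \<le> D \<gamma> x y" using osuc.IH that \<gamma> by simp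
    finally show ?thesis .
  qed
  ultimately have "\<bar>?g a - ?g b\<bar> \<le> dist_cf N (D \<gamma>) a b"
    using osuc.prems by (intro D.fragment_null_imp_dist_cf) auto
  then show ?case using iter_cf_osuc'[OF N_pseudometric] osuc.prems pr_in by simp
qed

lemma N_rectifiable:
  assumes "\<gamma> < \<alpha>"
  shows "\<not> purely_1_unrectifiable N (D \<gamma>)"
proof -
  have "\<exists>n. \<not> \<beta> n < \<gamma>" using \<beta>_cofinal[OF assms] infinite_UNIV_nat by (metis UNIV_eq_I mem_Collect_eq)
  then obtain n where n: "\<gamma> \<le> \<beta> n" by (auto simp: not_less)
  show ?thesis
  proof (rule not_purely_1_unrectifiable_biLipschitz[OF A_rectifiable[OF n]])
    show "Inr (n, a) \<in> N" if "a \<in> A n" for a using that by simp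
    fix a b assume ab: "a \<in> A n" "b \<in> A n"
    then show "1 * iter_cf (A n) (e n) \<gamma> a b \<le> D \<gamma> (Inr (n, a)) (Inr (n, b)) \<and>
        D \<gamma> (Inr (n, a)) (Inr (n, b)) \<le> stretch n * iter_cf (A n) (e n) \<gamma> a b"
      using D_retract[of "Inr (n, a)" "Inr (n, b)" n \<gamma>] D_piece_le by simp
  qed (use stretch_pos[of n] in auto)
qed

lemma N_realizes:
  assumes "0 < \<delta>" "\<delta> \<le> 1 / 16" "8 * \<delta> \<le> \<epsilon>"
    and "\<And>x y. x \<in> M \<Longrightarrow> y \<in> M \<Longrightarrow> 0 < d x y \<Longrightarrow> \<exists>n. d x (u n) \<le> \<delta> * d x y \<and> d y (v n) \<le> \<delta> * d x y"
  shows "cf_realizes \<alpha> \<epsilon> M d N \<rho> pr"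
  unfolding cf_realizes_def
proof (intro conjI ballI allI impI N_pseudometric N_compact N_rectifiable)
  show "pr ` N = M" using pr_in by (force simp: image_iff intro: bexI[of _ "Inl _"])
  fix a b assume ab: "a \<in> N" "b \<in> N"
  show "d (pr a) (pr b) \<le> D \<alpha> a b" using D_lower ab by simp
  have "D \<alpha> a b \<le> (1 + 8 * \<delta>) * d (pr a) (pr b)"
    unfolding D_pr[OF ab] using D_upper[OF assms(1,2,4)] pr_in ab by blast
  also have "\<dots> \<le> (1 + \<epsilon>) * d (pr a) (pr b)"
    using assms(3) dist_nonneg pr_in ab by (intro mult_right_mono) auto
  finally show "D \<alpha> a b \<le> (1 + \<epsilon>) * d (pr a) (pr b)" .
qed

end

section \<open>The transfinite induction\<close>

text \<open>For each dyadic scale \<open>s j\<close>, all pairs at distance about \<open>s j\<close>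
  or less are taken from a finite net of mesh \<open>\<delta> * s (Suc j)\<close>. Each scale
  contributes finitely many pairs, hence the gaps tend to \<open>0\<close>.\<close>

lemma (in pseudometric) multiscale_pairs:
  assumes compact: "pm_compact M d" and "M \<noteq> {}" and \<delta>: "0 < \<delta>"
  obtains u v :: "nat \<Rightarrow> 'a" where "\<And>n. u n \<in> M" "\<And>n. v n \<in> M" "(\<lambda>n. d (u n) (v n)) \<longlonglongrightarrow> 0"
    "\<And>x y. x \<in> M \<Longrightarrow> y \<in> M \<Longrightarrow> 0 < d x y \<Longrightarrow> \<exists>n. d x (u n) \<le> \<delta> * d x y \<and> d y (v n) \<le> \<delta> * d x y"
proof -
  obtain x0 where x0: "x0 \<in> M" using assms(2) by blast
  obtain R where R: "R > 0" "\<And>x y. x \<in> M \<Longrightarrow> y \<in> M \<Longrightarrow> d x y \<le> R"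
    using bounded_dist[OF compact] by blast
  define s where "s j = R / 2 ^ j" for j :: nat
  have s: "0 < s j" "s (Suc j) = s j / 2" for j using R by (auto simp: s_def)
  have s_lim: "s \<longlonglongrightarrow> 0"
    using tendsto_mult_right_zero[OF LIMSEQ_power_zero[of "1 / 2 :: real"], of R]
    by (simp add: s_def[abs_def] power_divide)
  have "\<forall>j. \<exists>F. finite F \<and> F \<subseteq> M \<and> (\<forall>x\<in>M. \<exists>w\<in>F. d x w < \<delta> * s (Suc j))"
    using \<delta> s(1) by (intro allI totally_bounded[OF compact]) simp
  then obtain F where F: "\<And>j. finite (F j)" "\<And>j. F j \<subseteq> M" "\<And>j x. x \<in> M \<Longrightarrow> \<exists>w\<in>F j. d x w < \<delta> * s (Suc j)"
    by metis
  \<comment> \<open>Net points close to \<open>x\<close> and \<open>y\<close> with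
    \<open>d x y \<le> s j\<close> are at distance at most
    \<open>s j + 2 * \<delta> * s (Suc j)\<close>, which is
    \<open>(1 + \<delta>) * s j\<close>.\<close>
  define P where "P j = {(a, b). a \<in> F j \<and> b \<in> F j \<and> d a b \<le> (1 + \<delta>) * s j}" for j
  have "finite (P j)" for j
    by (rule finite_subset[of _ "F j \<times> F j"]) (use F(1) in \<open>auto simp: P_def\<close>)
  then have "\<forall>j. \<exists>l. set l = P j" using finite_list by blast
  then obtain l where l: "\<And>j. set (l j) = P j" by metis
  \<comment> \<open>Indices that encode no pair receive the degenerate pair \<open>(x0, x0)\<close>;
    bridges with gap \<open>0\<close> therefore do occur.\<close>
  define f where "f n = (case prod_decode n of (j, i) \<Rightarrow> if i < length (l j) then l j ! i else (x0, x0))" for n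
  have f: "f n = (x0, x0) \<or> (\<exists>j i. n = prod_encode (j, i) \<and> i < length (l j) \<and> f n \<in> P j)" for n
  proof (cases "prod_decode n")
    case (Pair j i)
    then have "n = prod_encode (j, i)" by (metis prod_decode_inverse)
    then show ?thesis using Pair l[of j] nth_mem[of i "l j"] by (auto simp: f_def)
  qed
  have P_M: "a \<in> M" "b \<in> M" "d a b \<le> (1 + \<delta>) * s j" if "(a, b) \<in> P j" for a b j
    using that F(2) by (auto simp: P_def)
  have f_M: "fst (f n) \<in> M" "snd (f n) \<in> M" for n
    using f[of n] x0 P_M by (metis fst_conv snd_conv prod.collapse)+
  show ?thesis
  proof
    show "fst (f n) \<in> M" "snd (f n) \<in> M" for n by (fact f_M)+
    show "(\<lambda>n. d (fst (f n)) (snd (f n))) \<longlonglongrightarrow> 0"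
    proof (rule LIMSEQ_I)
      fix c :: real assume c: "0 < c"
      have "(\<lambda>j. (1 + \<delta>) * s j) \<longlonglongrightarrow> 0" using tendsto_mult_right_zero[OF s_lim] .
      then obtain J where J: "\<And>j. j \<ge> J \<Longrightarrow> (1 + \<delta>) * s j < c"
        using order_tendstoD(2)[OF _ c] by (metis (no_types, lifting) eventually_sequentially)
      define S where "S = prod_encode ` (SIGMA j:{..<J}. {..<length (l j)})"
      have "finite S" by (auto simp: S_def)
      then obtain n0 where n0: "\<forall>n\<in>S. n < n0" using finite_nat_set_iff_bounded by blast
      have "d (fst (f n)) (snd (f n)) < c" if n: "n0 \<le> n" for n
        using f[of n]
      proof (elim disjE exE conjE)
        assume "f n = (x0, x0)" then show ?thesis using c x0 by simp
      next
        fix j i assume *: "n = prod_encode (j, i)" "i < length (l j)" "f n \<in> P j"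
        have "n \<notin> S" using n0 n by auto
        then have "J \<le> j" using * by (force simp: S_def)
        then show ?thesis using J P_M(3)[of "fst (f n)" "snd (f n)" j] *(3) by fastforce
      qed
      then show "\<exists>n0. \<forall>n\<ge>n0. norm (d (fst (f n)) (snd (f n)) - 0) < c"
        using dist_nonneg[OF f_M] by auto
    qed
    fix x y assume xy: "x \<in> M" "y \<in> M" "0 < d x y"
    have "\<exists>k. s k < d x y"
      using order_tendstoD(2)[OF s_lim xy(3)] by (auto simp: eventually_sequentially)
    then obtain k where k: "s k < d x y" "\<And>k'. k' < k \<Longrightarrow> \<not> s k' < d x y"
      using exists_least_iff[of "\<lambda>k. s k < d x y"] by blast
    have "s 0 = R" by (simp add: s_def)
    \<comment> \<open>No distance exceeds \<open>s 0 = R\<close>, so the first scale below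
      \<open>d x y\<close> has a predecessor.\<close>
    then have "k \<noteq> 0" using k(1) R(2)[OF xy(1,2)] by (metis not_less)
    then obtain j where kj: "k = Suc j" using not0_implies_Suc by blast
    then have j: "s (Suc j) < d x y" "d x y \<le> s j" using k(1) k(2)[of j] by auto
    obtain a b where ab: "a \<in> F j" "b \<in> F j" "d x a < \<delta> * s (Suc j)" "d y b < \<delta> * s (Suc j)"
      using F(3)[OF xy(1), of j] F(3)[OF xy(2), of j] by blast
    then have ab_M: "a \<in> M" "b \<in> M" using F(2) by auto
    have "d a b \<le> d x a + d x y + d y b"
      using dist_triangle[of a x b] dist_triangle[of x y b] dist_commute[of a x] ab_M xy by simp
    also have "\<dots> \<le> (1 + \<delta>) * s j" using ab j s(2)[of j] by (simp add: algebra_simps)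
    finally have "(a, b) \<in> P j" using ab by (simp add: P_def)
    then obtain i where i: "i < length (l j)" "l j ! i = (a, b)" using l by (metis in_set_conv_nth)
    then have "f (prod_encode (j, i)) = (a, b)" by (simp add: f_def)
    moreover have "\<delta> * s (Suc j) \<le> \<delta> * d x y" using j \<delta> by simp
    ultimately show "\<exists>n. d x (fst (f n)) \<le> \<delta> * d x y \<and> d y (snd (f n)) \<le> \<delta> * d x y"
      using ab by (intro exI[of _ "prod_encode (j, i)"]) auto
  qed
qed

text \<open>Running maxima of an enumeration of the ordinals below \<open>\<alpha>\<close>: once
  \<open>\<gamma>\<close> has been listed, all later terms are at least \<open>\<gamma>\<close>.
  Successors and limits are treated alike; below a successor the sequence is eventually its
  predecessor.\<close>

lemma ordinal_cofinal_sequence: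
  assumes "0 < (\<alpha> :: countable_ordinal)"
  obtains \<beta> :: "nat \<Rightarrow> countable_ordinal" where "\<And>n. \<beta> n < \<alpha>" "\<And>\<gamma>. \<gamma> < \<alpha> \<Longrightarrow> finite {n. \<beta> n < \<gamma>}"
proof -
  have ne: "{..<\<alpha>} \<noteq> {}" using assms by blast
  define s where "s = from_nat_into {..<\<alpha>}"
  have s: "s k < \<alpha>" for k using from_nat_into[OF ne, of k] by (simp add: s_def)
  define \<beta> where "\<beta> n = Max (s ` {..n})" for n
  show ?thesis
  proof
    show "\<beta> n < \<alpha>" for n unfolding \<beta>_def using s by (subst Max_less_iff) auto
    fix \<gamma> assume "\<gamma> < \<alpha>"
    then obtain k where k: "s k = \<gamma>"
      using from_nat_into_surj[OF countable_below, of \<gamma> \<alpha>] by (auto simp: s_def)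
    have "\<gamma> \<le> \<beta> n" if "k \<le> n" for n unfolding \<beta>_def using k that by (intro Max_ge) auto
    then have "{n. \<beta> n < \<gamma>} \<subseteq> {..<k}" by (auto simp: not_le[symmetric])
    then show "finite {n. \<beta> n < \<gamma>}" using finite_subset by blast
  qed
qed

section \<open>The pieces of the bridges\<close>

definition bridge_piece where
  "bridge_piece s \<beta> A e p q h L \<longleftrightarrow> pseudometric A e \<and> pm_compact A e \<and>
    p \<in> A \<and> q \<in> A \<and> h p = (0::real) \<and> h q = (1::real) \<and> (\<forall>a\<in>A. 0 \<le> h a \<and> h a \<le> 1) \<and> 0 \<le> L \<and>
    (\<forall>a\<in>A. \<forall>b\<in>A. e a b \<le> s \<and> \<bar>h a - h b\<bar> \<le> L * iter_cf A e \<beta> a b \<and> iter_cf A e (osuc \<beta>) a b = 0) \<and>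
    (\<forall>\<gamma>\<le>\<beta>. \<not> purely_1_unrectifiable A (iter_cf A e \<gamma>))"

lemma iter_cf_scale:
  assumes "pseudometric A e" "0 < c" "a \<in> A" "b \<in> A"
  shows "pseudometric A (\<lambda>a b. c * e a b)"
    and "iter_cf A (\<lambda>a b. c * e a b) \<gamma> a b = c * iter_cf A e \<gamma> a b"
proof -
  interpret pseudometric A e by fact
  show pm: "pseudometric A (\<lambda>a b. c * e a b)"
    using assms(2) dist_triangle by unfold_locales (auto simp: dist_commute distrib_left[symmetric])
  have "iter_cf A (\<lambda>a b. c * e a b) \<gamma> a b \<le> c * iter_cf A e \<gamma> a b"
    using iter_cf_Lipschitz[OF assms(1) pm, of c "\<lambda>x. x"] assms by simp
  moreover have "iter_cf A e \<gamma> a b \<le> (1 / c) * iter_cf A (\<lambda>a b. c * e a b) \<gamma> a b"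
    using iter_cf_Lipschitz[OF pm assms(1), of "1 / c" "\<lambda>x. x"] assms by simp
  ultimately show "iter_cf A (\<lambda>a b. c * e a b) \<gamma> a b = c * iter_cf A e \<gamma> a b"
    using assms(2) by (simp add: field_simps)
qed

text \<open>An inverse of \<open>h\<close>, run at half speed, is a 1-Lipschitz curve over a full
  interval, and such a domain has no gaps.\<close>

lemma dist_cf_interval_zero:
  assumes "pseudometric A D" and onto: "h ` A = {0..1}"
    and le: "\<And>a b. a \<in> A \<Longrightarrow> b \<in> A \<Longrightarrow> D a b \<le> 2 * \<bar>h a - h b\<bar>" and ab: "a \<in> A" "b \<in> A"
  shows "dist_cf A D a b = 0"
proof -
  interpret pseudometric A D by fact
  interpret cf: pseudometric A "dist_cf A D" by (rule pseudometric_dist_cf)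
  have *: "dist_cf A D a b \<le> 0" if ab: "a \<in> A" "b \<in> A" "h a < h b" for a b
  proof -
    let ?K = "{2 * h a .. 2 * h b}"
    \<comment> \<open>\<open>h\<close> need not be injective, so the chosen inverse could miss
      \<open>a\<close> and \<open>b\<close>; the end values are therefore prescribed.\<close>
    define \<phi> where "\<phi> t = (if t = 2 * h a then a else if t = 2 * h b then b else inv_into A h (t / 2))" for t
    have IS: "Inf ?K = 2 * h a" "Sup ?K = 2 * h b" using ab by auto
    have h01: "h a \<in> {0..1}" "h b \<in> {0..1}" using onto ab by blast+
    have \<phi>: "\<phi> t \<in> A \<and> h (\<phi> t) = t / 2" if "t \<in> ?K" for t
    proof -
      have "t / 2 \<in> h ` A" using that h01 unfolding onto by simp
      then have "inv_into A h (t / 2) \<in> A" "h (inv_into A h (t / 2)) = t / 2"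
        using inv_into_into f_inv_into_f by metis+
      then show ?thesis using ab by (auto simp: \<phi>_def)
    qed
    have "curve_fragment1 A D ?K \<phi>"
      unfolding curve_fragment1_def
    proof (intro conjI ballI)
      show "\<phi> \<in> ?K \<rightarrow> A" using \<phi> by blast
      fix s t assume "s \<in> ?K" "t \<in> ?K"
      then have "D (\<phi> s) (\<phi> t) \<le> 2 * \<bar>s / 2 - t / 2\<bar>" using le[of "\<phi> s" "\<phi> t"] \<phi> by metis
      then show "D (\<phi> s) (\<phi> t) \<le> \<bar>s - t\<bar>" by (simp add: abs_if split: if_splits)
    qed (use ab in auto)
    then have "dist_cf A D (\<phi> (Inf ?K)) (\<phi> (Sup ?K)) \<le> measure lebesgue ({Inf ?K..Sup ?K} - ?K)"
      by (rule dist_cf_le)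
    moreover have "\<phi> (2 * h a) = a" "\<phi> (2 * h b) = b" using ab by (auto simp: \<phi>_def)
    ultimately show ?thesis unfolding IS by simp
  qed
  consider "h a < h b" | "h b < h a" | "h a = h b" by linarith
  then have "dist_cf A D a b \<le> 0"
  proof cases
    case 3
    then show ?thesis using le[OF ab] dist_cf_le_dist[OF ab] by simp
  next
    case 2
    then show ?thesis using *[OF ab(2,1)] cf.dist_commute[OF ab] by simp
  qed (use * ab in auto)
  then show ?thesis using cf.dist_nonneg[OF ab] by simp
qed

lemma pm_compact_unit_interval: "pm_compact {0..1} (\<lambda>s t :: real. \<bar>s - t\<bar>)"
  unfolding pm_compact_def
proof (intro allI impI)
  fix \<sigma> :: "nat \<Rightarrow> real" assume "range \<sigma> \<subseteq> {0..1}"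
  moreover have "seq_compact {0..1 :: real}" by (simp add: compact_imp_seq_compact)
  ultimately obtain l r where "l \<in> {0..1}" "strict_mono (r :: nat \<Rightarrow> nat)" "(\<sigma> \<circ> r) \<longlonglongrightarrow> l"
    unfolding seq_compact_def by (metis image_subset_iff iso_tuple_UNIV_I)
  then show "\<exists>l\<in>{0..1}. \<exists>r. strict_mono r \<and> (\<lambda>k. \<bar>\<sigma> (r k) - l\<bar>) \<longlonglongrightarrow> 0"
    by (intro bexI[of _ l] exI[of _ r]) (auto simp: o_def tendsto_rabs_zero_iff LIM_zero_iff)
qed

text \<open>The unit interval as constant sequences, so that it has the type on which the induction
  runs.\<close>

definition unit_arc :: "(nat \<Rightarrow> real) set" where "unit_arc = (\<lambda>t _. t) ` {0..1}"

definition arc_dist :: "(nat \<Rightarrow> real) \<Rightarrow> (nat \<Rightarrow> real) \<Rightarrow> real" where "arc_dist f g = \<bar>f 0 - g 0\<bar>"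

lemma unit_arc:
  "Metric_space unit_arc arc_dist" "pm_compact unit_arc arc_dist" "unit_arc \<noteq> {}" "(\<lambda>f. f 0) ` unit_arc = {0..1}"
proof -
  show "Metric_space unit_arc arc_dist"
    by standard (auto simp: unit_arc_def arc_dist_def fun_eq_iff)
  show "pm_compact unit_arc arc_dist"
    by (rule pm_compact_image[OF pm_compact_unit_interval, of "\<lambda>t _. t" _ 1])
      (auto simp: unit_arc_def arc_dist_def)
  show "unit_arc \<noteq> {}" "(\<lambda>f. f 0) ` unit_arc = {0..1}" by (auto simp: unit_arc_def image_image)
qed

text \<open>Up to a factor \<open>2\<close>, stage \<open>\<beta>\<close> is the interval
  parametrized by \<open>h\<close>. It therefore still contains a bi-Lipschitz interval, while the
  next stage collapses along it.\<close>

lemma bridge_piece_exists: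
  assumes real: "cf_realizes \<beta> 1 unit_arc arc_dist N \<rho> \<pi>" and "0 < s"
  shows "\<exists>e p q h L. bridge_piece s \<beta> N e p q h L"
proof -
  let ?D = "iter_cf N \<rho>"
  have N: "pseudometric N \<rho>" "pm_compact N \<rho>"
    and rect: "\<And>\<gamma>. \<gamma> < \<beta> \<Longrightarrow> \<not> purely_1_unrectifiable N (?D \<gamma>)" and onto: "\<pi> ` N = unit_arc"
    and near: "\<And>a b. a \<in> N \<Longrightarrow> b \<in> N \<Longrightarrow> arc_dist (\<pi> a) (\<pi> b) \<le> ?D \<beta> a b"
      "\<And>a b. a \<in> N \<Longrightarrow> b \<in> N \<Longrightarrow> ?D \<beta> a b \<le> (1 + 1) * arc_dist (\<pi> a) (\<pi> b)"
    using real unfolding cf_realizes_def by blast+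
  interpret pseudometric N \<rho> by fact
  define h where "h a = \<pi> a 0" for a
  have h_onto: "h ` N = {0..1}" using unit_arc(4) unfolding onto[symmetric] image_image h_def .
  have h: "\<bar>h a - h b\<bar> \<le> ?D \<beta> a b" "?D \<beta> a b \<le> 2 * \<bar>h a - h b\<bar>" if "a \<in> N" "b \<in> N" for a b
    using near[OF that] by (simp_all add: arc_dist_def h_def)
  have g: "inv_into N h t \<in> N" "h (inv_into N h t) = t" if "t \<in> {0..1}" for t
    using that h_onto inv_into_into f_inv_into_f by metis+
  have zero: "?D (osuc \<beta>) a b = 0" if "a \<in> N" "b \<in> N" for a b
    using dist_cf_interval_zero[OF pseudometric_iter_cf[OF N(1)] h_onto h(2) that] iter_cf_osuc'[OF N(1) that] by simp
  have "\<not> purely_1_unrectifiable N (?D \<beta>)"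
  proof -
    have "1 * \<bar>s - t\<bar> \<le> ?D \<beta> (inv_into N h s) (inv_into N h t) \<and> ?D \<beta> (inv_into N h s) (inv_into N h t) \<le> 2 * \<bar>s - t\<bar>"
      if "s \<in> {0..1}" "t \<in> {0..1}" for s t
      using h[OF g(1)[OF that(1)] g(1)[OF that(2)]] g(2)[OF that(1)] g(2)[OF that(2)] by simp
    moreover have "{0..1::real} \<in> sets lebesgue" "emeasure lebesgue {0..1::real} > 0" by auto
    moreover have "inv_into N h \<in> {0..1} \<rightarrow> N" using g by blast
    ultimately show ?thesis unfolding purely_1_unrectifiable_def using zero_less_one by blast
  qed
  then have rect': "\<not> purely_1_unrectifiable N (?D \<gamma>)" if "\<gamma> \<le> \<beta>" for \<gamma>
    using rect that by (cases "\<gamma> = \<beta>") auto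
  obtain R where R: "R > 0" "\<And>x y. x \<in> N \<Longrightarrow> y \<in> N \<Longrightarrow> \<rho> x y \<le> R"
    using bounded_dist[OF N(2)] by blast
  \<comment> \<open>Scaling brings the diameter down to \<open>s\<close>. The price is the Lipschitz
    constant \<open>1 / c\<close> of \<open>h\<close>, which only enlarges
    \<open>stretch\<close>.\<close>
  define c where "c = s / R"
  have c: "c > 0" using R assms(2) by (simp add: c_def)
  let ?e = "\<lambda>a b. c * \<rho> a b"
  note scale = iter_cf_scale[OF N(1) c]
  have "bridge_piece s \<beta> N ?e (inv_into N h 0) (inv_into N h 1) h (1 / c)"
    unfolding bridge_piece_def
  proof (intro conjI ballI allI impI)
    show pm: "pseudometric N ?e" using scale(1) g(1)[of 0] by auto
    show "pm_compact N ?e"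
      by (rule pm_compact_image[OF N(2), of "\<lambda>x. x" _ c]) (use c dist_nonneg in auto)
    show "inv_into N h 0 \<in> N" "inv_into N h 1 \<in> N" "h (inv_into N h 0) = 0" "h (inv_into N h 1) = 1"
      using g by auto
    show "0 \<le> 1 / c" using c by simp
    show "\<not> purely_1_unrectifiable N (iter_cf N ?e \<gamma>)" if "\<gamma> \<le> \<beta>" for \<gamma>
      by (rule not_purely_1_unrectifiable_biLipschitz[OF rect'[OF that], of "\<lambda>x. x" _ c c])
        (use c scale(2) in auto)
    fix a assume a: "a \<in> N"
    then have "h a \<in> {0..1}" using h_onto by blast
    then show "0 \<le> h a" "h a \<le> 1" by auto
    fix b assume b: "b \<in> N"
    have "c * \<rho> a b \<le> c * R" using R(2)[OF a b] c by simp
    then show "?e a b \<le> s" using R(1) by (simp add: c_def)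
    show "iter_cf N ?e (osuc \<beta>) a b = 0" using scale(2)[OF a b] zero[OF a b] by simp
    show "\<bar>h a - h b\<bar> \<le> 1 / c * iter_cf N ?e \<beta> a b" using scale(2)[OF a b, of \<beta>] h(1)[OF a b] c by simp
  qed
  then show ?thesis by blast
qed

lemma cf_realizes_exists:
  fixes M :: "(nat \<Rightarrow> real) set"
  assumes "Metric_space M d" "pm_compact M d" "M \<noteq> {}" "\<epsilon> > 0"
  shows "\<exists>(N :: (nat \<Rightarrow> real) set) \<rho> \<pi>. Metric_space N \<rho> \<and> cf_realizes \<alpha> \<epsilon> M d N \<rho> \<pi>"
  using assms
proof (induction \<alpha> arbitrary: M d \<epsilon> rule: less_induct)
  case (less \<alpha>)
  interpret pseudometric M d using Metric_space_pseudometric less.prems(1) by blast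
  show ?case
  proof (cases "\<alpha> = 0")
    case True
    have "cf_realizes \<alpha> \<epsilon> M d M d (\<lambda>x. x)"
      unfolding cf_realizes_def True
    proof (intro conjI ballI allI impI)
      fix a b assume "a \<in> M" "b \<in> M"
      then show "d a b \<le> iter_cf M d 0 a b" "iter_cf M d 0 a b \<le> (1 + \<epsilon>) * d a b"
        using less.prems(4) dist_nonneg by (auto simp: iter_cf_zero distrib_right)
    qed (use pseudometric_axioms less.prems countable_ordinal_zero_le leD in auto)
    then show ?thesis using less.prems by blast
  next
    case False
    then have "0 < \<alpha>" using countable_ordinal_zero_le[of \<alpha>] by (simp add: order.strict_iff_order)
    then obtain \<beta> :: "nat \<Rightarrow> countable_ordinal"
      where \<beta>: "\<And>n. \<beta> n < \<alpha>" "\<And>\<gamma>. \<gamma> < \<alpha> \<Longrightarrow> finite {n. \<beta> n < \<gamma>}"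
      using ordinal_cofinal_sequence[OF \<open>0 < \<alpha>\<close>] by metis
    \<comment> \<open>\<open>D_upper\<close> requires \<open>\<delta> \<le> 1 / 16\<close> and
      yields distortion \<open>8 * \<delta>\<close>.\<close>
    define \<delta> where "\<delta> = min (1 / 16) (\<epsilon> / 8)"
    have \<delta>: "0 < \<delta>" "\<delta> \<le> 1 / 16" "8 * \<delta> \<le> \<epsilon>" using less.prems(4) by (auto simp: \<delta>_def)
    obtain u v :: "nat \<Rightarrow> nat \<Rightarrow> real" where pairs: "\<And>n. u n \<in> M" "\<And>n. v n \<in> M" "(\<lambda>n. d (u n) (v n)) \<longlonglongrightarrow> 0"
      "\<And>x y. x \<in> M \<Longrightarrow> y \<in> M \<Longrightarrow> 0 < d x y \<Longrightarrow> \<exists>n. d x (u n) \<le> \<delta> * d x y \<and> d y (v n) \<le> \<delta> * d x y"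
    proof (rule multiscale_pairs[OF less.prems(2,3) \<delta>(1)])
      fix u v :: "nat \<Rightarrow> nat \<Rightarrow> real"
      assume "\<And>n. u n \<in> M" "\<And>n. v n \<in> M" "(\<lambda>n. d (u n) (v n)) \<longlonglongrightarrow> 0"
        "\<And>x y. x \<in> M \<Longrightarrow> y \<in> M \<Longrightarrow> 0 < d x y \<Longrightarrow> \<exists>n. d x (u n) \<le> \<delta> * d x y \<and> d y (v n) \<le> \<delta> * d x y"
      then show thesis by (rule that)
    qed
    \<comment> \<open>Degenerate pairs also need a piece of positive size, hence the second
      case.\<close>
    define s where "s n = (if 0 < d (u n) (v n) then min (d (u n) (v n)) (1 / Suc n) else 1 / Suc n)" for n
    have s: "0 < s n" "s n \<le> 1 / Suc n" "0 < d (u n) (v n) \<Longrightarrow> s n \<le> d (u n) (v n)" for n by (auto simp: s_def)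
    have "\<exists>(A :: (nat \<Rightarrow> real) set) e p q h L. bridge_piece (s n) (\<beta> n) A e p q h L" for n
    proof -
      obtain A :: "(nat \<Rightarrow> real) set" and \<rho> \<pi> where "cf_realizes (\<beta> n) 1 unit_arc arc_dist A \<rho> \<pi>"
        using less.IH[OF \<beta>(1)[of n] unit_arc(1-3), of 1] by auto
      then show ?thesis using bridge_piece_exists s(1) by blast
    qed
    then obtain A :: "nat \<Rightarrow> (nat \<Rightarrow> real) set" and e p q h L where
      piece: "\<And>n. bridge_piece (s n) (\<beta> n) (A n) (e n) (p n) (q n) (h n) (L n)"
      by metis
    interpret bridges M d u v A e p q h L \<beta> \<alpha>
    proof (intro bridges.intro bridges_axioms.intro pseudometric_axioms)
      fix n a b assume ab: "a \<in> A n" "b \<in> A n"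
      have "e n a b \<le> s n" using piece[of n] ab by (simp add: bridge_piece_def)
      then show "e n a b \<le> 1 / Suc n" "0 < d (u n) (v n) \<Longrightarrow> e n a b \<le> d (u n) (v n)"
        using s(2,3)[of n] by auto
    qed (use piece pairs \<beta> less.prems in \<open>auto simp: bridge_piece_def\<close>)
    have "cf_realizes \<alpha> \<epsilon> M d N \<rho> pr" using N_realizes[OF \<delta> pairs(4)] .
    then obtain N' :: "(nat \<Rightarrow> real) set" and \<rho>' \<pi>' where "Metric_space N' \<rho>'" "cf_realizes \<alpha> \<epsilon> M d N' \<rho>' \<pi>'"
      by (rule cf_realizes_embed[OF _ less.prems(3,1)])
    then show ?thesis by blast
  qed
qed

theorem theorem5:
  fixes M :: "'a set" and d :: "'a \<Rightarrow> 'a \<Rightarrow> real"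
    and \<alpha> :: countable_ordinal and \<epsilon> :: real
  assumes "Metric_space M d"
    and "compact_space (Metric_space.mtopology M d)"
    and "M \<noteq> {}"
    and "\<epsilon> > 0"
  shows "\<exists>(N :: (nat \<Rightarrow> real) set) \<rho>.
      Metric_space N \<rho> \<and> compact_space (Metric_space.mtopology N \<rho>) \<and>
      Fin \<alpha> \<le> cf_index N \<rho> \<and>
      (\<exists>\<phi>. almost_isometry \<epsilon> M d (space_cf N \<rho> \<alpha>) (mdist_cf N \<rho> \<alpha>) \<phi>)"
proof -
  interpret Metric_space M d by fact
  interpret pm: pseudometric M d using assms(1) by (rule Metric_space_pseudometric)
  have compact: "pm_compact M d" using assms(2) compact_space_iff_pm_compact by simp
  \<comment> \<open>\<open>cf_realizes_exists\<close> works within the type of sequences, where it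
    can pass from \<open>M\<close> to the unit arc; so \<open>M\<close> is first copied
    there.\<close>
  obtain M' :: "(nat \<Rightarrow> real) set" and d' f where M': "Metric_space M' d'" "f ` M = M'"
    and iso: "\<And>x y. x \<in> M \<Longrightarrow> y \<in> M \<Longrightarrow> d' (f x) (f y) = d x y"
    using pm.embed_nat_real[OF compact assms(3)] by blast
  have inj: "inj_on f M"
    using iso zero Metric_space.mdist_zero[OF M'(1)] M'(2) by (metis imageI inj_onI)
  have "pm_compact M' d'"
    using pm_compact_image[OF compact M'(2), of 1 d'] iso nonneg by simp
  then obtain N :: "(nat \<Rightarrow> real) set" and \<rho> \<pi> where N: "Metric_space N \<rho>"
    and real': "cf_realizes \<alpha> \<epsilon> M' d' N \<rho> \<pi>"
    using cf_realizes_exists[OF M'(1) _ _ assms(4), of \<alpha>] M'(2) assms(3) by blast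
  have real: "cf_realizes \<alpha> \<epsilon> M d N \<rho> (\<lambda>a. inv_into M f (\<pi> a))"
    by (rule cf_realizes_retarget[OF real' M'(2) inj]) (rule iso)
  then have "compact_space (Metric_space.mtopology N \<rho>)"
    using Metric_space.compact_space_iff_pm_compact[OF N] by (simp add: cf_realizes_def)
  then show ?thesis
    using N cf_realizes_imp_almost_isometric[OF assms(1) real assms(4)] by blast
qed

end
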